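(* For all positive integers $q,k,c$ there exists a number $f(q,k,c)$, depending only on $q,k,c$, with the following property. Let $A$ be an (additively written) abelian group and $L=\bigoplus_{a\in A}L_a$ an $A$-graded Lie algebra such that for every $a\in A$ the component $L_a$ is ad-nilpotent of index $k$, i.e. $[L,\underbrace{L_a,\ldots,L_a}_{k}]=0$. Assume that $L$ admits a finite group $H$ of double automorphisms with $|H|=q$ such that $C_A(h)=0$ for all nontrivial $h\in H$ and $C_L(H)$ is nilpotent of class $c$. Then $L$ is nilpotent of class at most $f(q,k,c)$.
   Context: A Lie algebra means a Lie algebra over some commutative ring with unity. An $A$-graded Lie algebra is a Lie algebra $L=\bigoplus_{a\in A}L_a$ where the $L_a$ are subspaces (submodules) with $[L_a,L_b]\subseteq L_{a+b}$ for all $a,b\in A$. Commutators are left-normed: $[x_1,x_2,\ldots,x_n]=[\ldots[[x_1,x_2],x_3],\ldots,x_n]$, and $[L,K,\ldots,K]$ denotes the span of the corresponding commutators. A subspace $K$ of $L$ is ad-nilpotent of index (at most) $n$ if $[L,\underbrace{K,\ldots,K}_{n}]=0$. A double automorphism of $L$ is an automorphism $\phi$ of the Lie algebra $L$ that permutes the grading components in such a way that $L_a^\phi=L_{a^\phi}$ for all $a\in A$, where $a\mapsto a^\phi$ is an automorphism of the group $A$. A group $H$ of double automorphisms of $L$ is a group of automorphisms of $L$ which in this way acts on $A$ by group automorphisms, with $L_a^h=L_{a^h}$ for all $a\in A$, $h\in H$. One writes $C_L(H)=\{l\in L: l^h=l \text{ for all } h\in H\}$ and $C_A(h)=\{a\in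 A: a^h=a\}$. *)

theory Defs
  imports "HOL-Algebra.Algebra"
begin

text \<open>
  The \<open>mult\<close> and \<open>one\<close> fields inherited from \<open>ring\<close> play no role in a Lie algebra \<open>L\<close>
  (as already for \<open>module\<close>), nor in the additive group \<open>A\<close> below.
\<close>

record ('r, 'l) lie_algebra = "('r, 'l) module" +
  bracket :: "'l \<Rightarrow> 'l \<Rightarrow> 'l"

locale lie_algebra = module R L
  for R :: "'r ring" (structure) and L :: "('r, 'l) lie_algebra" (structure) +
  assumes bracket_closed:
      "\<lbrakk>x \<in> carrier L; y \<in> carrier L\<rbrakk> \<Longrightarrow> bracket L x y \<in> carrier L"
    and bracket_add_left:
      "\<lbrakk>x \<in> carrier L; y \<in> carrier L; z \<in> carrier L\<rbrakk> \<Longrightarrow>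
        bracket L (x \<oplus>\<^bsub>L\<^esub> y) z = bracket L x z \<oplus>\<^bsub>L\<^esub> bracket L y z"
    and bracket_add_right:
      "\<lbrakk>x \<in> carrier L; y \<in> carrier L; z \<in> carrier L\<rbrakk> \<Longrightarrow>
        bracket L x (y \<oplus>\<^bsub>L\<^esub> z) = bracket L x y \<oplus>\<^bsub>L\<^esub> bracket L x z"
    and bracket_smult_left:
      "\<lbrakk>r \<in> carrier R; x \<in> carrier L; y \<in> carrier L\<rbrakk> \<Longrightarrow>
        bracket L (r \<odot>\<^bsub>L\<^esub> x) y = r \<odot>\<^bsub>L\<^esub> bracket L x y"
    and bracket_smult_right:
      "\<lbrakk>r \<in> carrier R; x \<in> carrier L; y \<in> carrier L\<rbrakk> \<Longrightarrow>
        bracket L x (r \<odot>\<^bsub>L\<^esub> y) = r \<odot>\<^bsub>L\<^esub> bracket L x y"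
    and bracket_self:
      "x \<in> carrier L \<Longrightarrow> bracket L x x = \<zero>\<^bsub>L\<^esub>"
    and jacobi:
      "\<lbrakk>x \<in> carrier L; y \<in> carrier L; z \<in> carrier L\<rbrakk> \<Longrightarrow>
        bracket L (bracket L x y) z \<oplus>\<^bsub>L\<^esub> bracket L (bracket L y z) x
          \<oplus>\<^bsub>L\<^esub> bracket L (bracket L z x) y = \<zero>\<^bsub>L\<^esub>"

definition lin_span :: "'r ring \<Rightarrow> ('r, 'l) lie_algebra \<Rightarrow> 'l set \<Rightarrow> 'l set" where
  "lin_span R L S = \<Inter> {N. submodule N R L \<and> S \<subseteq> N}"

text \<open>
  \<open>[U, K, \<dots>, K]\<close> with \<open>n\<close> copies of \<open>K\<close>: the span of the left-normed commutators
  \<open>[u, y\<^sub>1, \<dots>, y\<^sub>n] = foldl (bracket L) u [y\<^sub>1, \<dots>, y\<^sub>n]\<close>.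
\<close>

definition comm_span ::
    "'r ring \<Rightarrow> ('r, 'l) lie_algebra \<Rightarrow> 'l set \<Rightarrow> 'l set \<Rightarrow> nat \<Rightarrow> 'l set" where
  "comm_span R L U K n =
     lin_span R L {foldl (bracket L) u ys |u ys. u \<in> U \<and> set ys \<subseteq> K \<and> length ys = n}"

definition ad_nilpotent :: "'r ring \<Rightarrow> ('r, 'l) lie_algebra \<Rightarrow> 'l set \<Rightarrow> nat \<Rightarrow> bool" where
  "ad_nilpotent R L K n \<longleftrightarrow> comm_span R L (carrier L) K n = {\<zero>\<^bsub>L\<^esub>}"

text \<open>
  For a subalgebra \<open>K\<close>: the term \<open>[K, K, \<dots>, K]\<close> (with \<open>c + 1\<close> entries) of its lower central
  series vanishes, i.e. \<open>K\<close> is nilpotent of class at most \<open>c\<close>.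
\<close>

definition nilpotent_class_le ::
    "'r ring \<Rightarrow> ('r, 'l) lie_algebra \<Rightarrow> 'l set \<Rightarrow> nat \<Rightarrow> bool" where
  "nilpotent_class_le R L K c \<longleftrightarrow> comm_span R L K K c = {\<zero>\<^bsub>L\<^esub>}"

text \<open>
  \<open>A\<close> is written additively (\<open>\<oplus>\<^bsub>A\<^esub>\<close>, \<open>\<zero>\<^bsub>A\<^esub>\<close>). The axiom \<open>direct_sum\<close> says that \<open>L\<close> is the
  internal direct sum of the submodules \<open>C a\<close>.
\<close>

locale graded_lie_algebra = lie_algebra R L + A: abelian_group A
  for R :: "'r ring" and A :: "'a ring" and L :: "('r, 'l) lie_algebra" +
  fixes C :: "'a \<Rightarrow> 'l set"
  assumes component_submodule: "a \<in> carrier A \<Longrightarrow> submodule (C a) R L"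
    and direct_sum:
      "x \<in> carrier L \<Longrightarrow>
        \<exists>!f. f \<in> (\<Pi>\<^sub>E a\<in>carrier A. C a) \<and> finite {a \<in> carrier A. f a \<noteq> \<zero>\<^bsub>L\<^esub>} \<and>
          x = (\<Oplus>\<^bsub>L\<^esub>a\<in>{a \<in> carrier A. f a \<noteq> \<zero>\<^bsub>L\<^esub>}. f a)"
    and bracket_component:
      "\<lbrakk>a \<in> carrier A; b \<in> carrier A; x \<in> C a; y \<in> C b\<rbrakk> \<Longrightarrow> bracket L x y \<in> C (a \<oplus>\<^bsub>A\<^esub> b)"

definition lie_auto :: "'r ring \<Rightarrow> ('r, 'l) lie_algebra \<Rightarrow> ('l \<Rightarrow> 'l) set" where
  "lie_auto R L = {\<phi> \<in> Bij (carrier L).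
     (\<forall>x\<in>carrier L. \<forall>y\<in>carrier L. \<phi> (x \<oplus>\<^bsub>L\<^esub> y) = \<phi> x \<oplus>\<^bsub>L\<^esub> \<phi> y) \<and>
     (\<forall>r\<in>carrier R. \<forall>x\<in>carrier L. \<phi> (r \<odot>\<^bsub>L\<^esub> x) = r \<odot>\<^bsub>L\<^esub> \<phi> x) \<and>
     (\<forall>x\<in>carrier L. \<forall>y\<in>carrier L. \<phi> (bracket L x y) = bracket L (\<phi> x) (\<phi> y))}"

definition Lie_AutoGroup :: "'r ring \<Rightarrow> ('r, 'l) lie_algebra \<Rightarrow> ('l \<Rightarrow> 'l) monoid" where
  "Lie_AutoGroup R L = BijGroup (carrier L) \<lparr>carrier := lie_auto R L\<rparr>"

text \<open>
  The action \<open>act\<close> of \<open>H\<close> on \<open>A\<close> is part of the data, since an automorphism of \<open>L\<close> does not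
  determine where \<open>a\<close> goes when \<open>C a\<close> is zero.
\<close>

locale double_automorphism_group = graded_lie_algebra R A L C
  for R :: "'r ring" and A :: "'a ring" and L :: "('r, 'l) lie_algebra" and C :: "'a \<Rightarrow> 'l set" +
  fixes H :: "('l \<Rightarrow> 'l) set" and act :: "('l \<Rightarrow> 'l) \<Rightarrow> 'a \<Rightarrow> 'a"
  assumes H_subgroup: "subgroup H (Lie_AutoGroup R L)"
    and act_hom: "act \<in> hom (Lie_AutoGroup R L \<lparr>carrier := H\<rparr>) (AutoGroup (add_monoid A))"
    and permutes_components: "\<lbrakk>h \<in> H; a \<in> carrier A\<rbrakk> \<Longrightarrow> h ` C a = C (act h a)"

definition fixed_subalgebra :: "('r, 'l) lie_algebra \<Rightarrow> ('l \<Rightarrow> 'l) set \<Rightarrow> 'l set" where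
  "fixed_subalgebra L H = {x \<in> carrier L. \<forall>h\<in>H. h x = x}"

definition admissible ::
    "nat \<Rightarrow> nat \<Rightarrow> nat \<Rightarrow> 'r ring \<Rightarrow> 'a ring \<Rightarrow> ('r, 'l) lie_algebra \<Rightarrow> ('a \<Rightarrow> 'l set) \<Rightarrow>
      ('l \<Rightarrow> 'l) set \<Rightarrow> (('l \<Rightarrow> 'l) \<Rightarrow> 'a \<Rightarrow> 'a) \<Rightarrow> bool" where
  "admissible q k c R A L C H act \<longleftrightarrow>
     double_automorphism_group R A L C H act \<and>
     (\<forall>a\<in>carrier A. ad_nilpotent R L (C a) k) \<and>
     finite H \<and> card H = q \<and>
     (\<forall>h\<in>H. h \<noteq> \<one>\<^bsub>Lie_AutoGroup R L\<^esub> \<longrightarrow> {a \<in> carrier A. act h a = a} = {\<zero>\<^bsub>A\<^esub>}) \<and>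
     nilpotent_class_le R L (fixed_subalgebra L H) c"

text \<open>
  A bound depending only on \<open>q, k, c\<close> must in particular not depend on the types that carry
  \<open>R\<close>, \<open>A\<close> and \<open>L\<close>, and HOL cannot quantify over types below an existential quantifier.
  The bound is therefore a closed constant: the least one that works for all structures
  whose carriers are sets of integers, i.e. up to isomorphism for all countable ones. If any bound
  valid for all structures exists, then this one is also valid for all of them: if
  \<open>[x\<^sub>0, \<dots>, x\<^sub>N] \<noteq> 0\<close> with homogeneous \<open>x\<^sub>i\<close>, then the \<open>H\<close>-invariant Lie subring (an
  algebra over the integers) generated by the \<open>x\<^sub>i\<close> and by finitely many homogeneous elements
  on which \<open>H\<close> acts faithfully, graded by the subgroup of \<open>A\<close> generated by the orbits of the
  degrees involved, is a countable structure satisfying the same hypotheses. Should no bound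
  for the countable structures exist, \<open>LEAST\<close> is an arbitrary number, which is then no
  bound either.
\<close>

definition nilpotency_bound :: "nat \<Rightarrow> nat \<Rightarrow> nat \<Rightarrow> nat" where
  "nilpotency_bound q k c = (LEAST N.
     \<forall>(R :: int ring) (A :: int ring) (L :: (int, int) lie_algebra) C H act.
       admissible q k c R A L C H act \<longrightarrow> nilpotent_class_le R L (carrier L) N)"

end

theory Submission
  imports Defs "HOL-Library.Countable_Set"
begin

text \<open>
  All statements say that certain left-normed commutators vanish, so the scalars are forgotten and
  the work is done in a Lie ring \<open>L\<close> graded by an abelian group. The proof has three
  parts.

  \<^bold>\<open>Independent degrees.\<close> If \<open>x\<^sub>0, \<dots>, x\<^sub>c\<close> are
  homogeneous of degrees \<open>a\<^sub>0, \<dots>, a\<^sub>c\<close>, the sums over their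
  \<open>H\<close>-orbits are fixed by \<open>H\<close>, so their commutator is zero. Its
  component of degree \<open>a\<^sub>0 + \<dots> + a\<^sub>c\<close> is \<open>[x\<^sub>0,
  \<dots>, x\<^sub>c]\<close> alone, provided that \<open>h\<^sub>0 a\<^sub>0 + \<dots> +
  h\<^sub>c a\<^sub>c = a\<^sub>0 + \<dots> + a\<^sub>c\<close> only if all
  \<open>h\<^sub>i\<close> are trivial; call such a sequence of degrees independent. So
  independent commutators of length \<open>c + 1\<close> vanish. Since \<open>H\<close> acts
  freely on the nonzero degrees, an independent sequence can be continued independently by all but
  boundedly many degrees (\<open>dependent_letters\<close>). A downward induction on the length
  therefore considers a commutator \<open>u\<close> of independent degrees such that, modulo a
  term of the upper central series, \<open>u\<close> commutes with all components except for those
  with degrees in a bounded set \<open>D\<close>. By absorption, \<open>u\<close> lies in a later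
  term whose index is bounded. The induction ends with sequences of length 1, that is, with all
  components of nonzero degree, and the component of degree 0 is ad-nilpotent.

  \<^bold>\<open>Absorption.\<close> In a commutator \<open>[u, x\<^sub>1, \<dots>,
  x\<^sub>n]\<close> the letters commute modulo shorter commutators of the same degree. A letter
  of degree outside \<open>D\<close> can be moved next to \<open>u\<close>, and more than \<open>k
  |D|\<close> letters contain \<open>k\<close> of equal degree, which kill \<open>u\<close>.
  Hence, modulo the given term of the series, the ideal generated by \<open>u\<close> lives in
  boundedly many degrees, and only boundedly many components of \<open>L\<close> act nontrivially
  on it. It remains to see that such an action is nilpotent (\<open>absorption\<close>).

  \<^bold>\<open>Finite support.\<close> Suppose that modulo an ideal only the components with
  degrees in a finite set \<open>D\<close> are nonzero. Unless \<open>D\<close> is contained in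
  \<open>{0}\<close>, there is a map from \<open>D\<close> to residues that is additive where sums
  stay in \<open>D\<close> and is not zero everywhere (\<open>ex_residue_map\<close>). By
  induction on \<open>|D|\<close> the part of residue 0 acts nilpotently, and then a version of
  Kreknin's theorem on cyclically graded Lie rings yields solvability of bounded derived length
  (\<open>finite_support_solvable\<close>). Walking up the derived series, where letters commute
  modulo the next term and every single component is nilpotent, turns solvability into nilpotency
  (\<open>solvable_imp_nilpotent_action\<close>).

  These three parts give an explicit bound, valid for all carriers
  (\<open>admissible_class_bound\<close>). The constant \<open>nilpotency_bound\<close> is the
  least bound for structures carried by sets of integers. A nonzero commutator of this length in
  an arbitrary structure would survive in the countable substructure generated by its entries
  under all operations and under \<open>H\<close>, together with elements that keep the action of
  \<open>H\<close> faithful. Such a substructure can be carried over to the integers, where the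
  commutator vanishes.
\<close>

section \<open>Left-normed commutators in Lie rings\<close>

text \<open>
  The additive group of a Lie algebra with its bracket, which decide about the vanishing of
  commutators.
\<close>

locale lie_ring = abelian_group L for L :: "('l, 'm) ring_scheme" (structure) +
  fixes br :: "'l \<Rightarrow> 'l \<Rightarrow> 'l"  (infixl \<open>\<bullet>\<close> 70)
  assumes br_closed [simp, intro]:
      "\<lbrakk>x \<in> carrier L; y \<in> carrier L\<rbrakk> \<Longrightarrow> x \<bullet> y \<in> carrier L"
    and br_add_left:
      "\<lbrakk>x \<in> carrier L; y \<in> carrier L; z \<in> carrier L\<rbrakk> \<Longrightarrow> (x \<oplus> y) \<bullet> z = x \<bullet> z \<oplus> y \<bullet> z"
    and br_add_right:
      "\<lbrakk>x \<in> carrier L; y \<in> carrier L; z \<in> carrier L\<rbrakk> \<Longrightarrow> x \<bullet> (y \<oplus> z) = x \<bullet> y \<oplus> x \<bullet> z"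
    and br_self: "x \<in> carrier L \<Longrightarrow> x \<bullet> x = \<zero>"
    and br_jacobi:
      "\<lbrakk>x \<in> carrier L; y \<in> carrier L; z \<in> carrier L\<rbrakk> \<Longrightarrow>
        x \<bullet> y \<bullet> z \<oplus> y \<bullet> z \<bullet> x \<oplus> z \<bullet> x \<bullet> y = \<zero>"
begin

lemma br_zero_left [simp]: "x \<in> carrier L \<Longrightarrow> \<zero> \<bullet> x = \<zero>"
  using br_add_left[of \<zero> \<zero> x] by (simp add: add.l_cancel_one')

lemma br_zero_right [simp]: "x \<in> carrier L \<Longrightarrow> x \<bullet> \<zero> = \<zero>"
  using br_add_right[of x \<zero> \<zero>] by (simp add: add.l_cancel_one')

lemma br_neg_left: "\<lbrakk>x \<in> carrier L; y \<in> carrier L\<rbrakk> \<Longrightarrow> (\<ominus> x) \<bullet> y = \<ominus> (x \<bullet> y)"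
  using br_add_left[of x "\<ominus> x" y]
  by (metis a_inv_closed br_closed br_zero_left minus_equality r_neg a_comm)

lemma br_neg_right: "\<lbrakk>x \<in> carrier L; y \<in> carrier L\<rbrakk> \<Longrightarrow> x \<bullet> (\<ominus> y) = \<ominus> (x \<bullet> y)"
  using br_add_right[of x y "\<ominus> y"]
  by (metis a_inv_closed br_closed br_zero_right minus_equality r_neg a_comm)

lemma br_anticomm:
  assumes "x \<in> carrier L" "y \<in> carrier L"
  shows "y \<bullet> x = \<ominus> (x \<bullet> y)"
proof -
  have "(x \<oplus> y) \<bullet> (x \<oplus> y) = x \<bullet> y \<oplus> y \<bullet> x"
    using assms br_add_left[of x y "x \<oplus> y"] by (simp add: br_add_right br_self)
  then have "y \<bullet> x \<oplus> x \<bullet> y = \<zero>"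
    using assms br_self[of "x \<oplus> y"] by (metis a_comm add.m_closed br_closed)
  then show ?thesis
    using assms by (simp add: minus_equality)
qed

lemma br_br_swap:
  assumes [simp]: "x \<in> carrier L" "y \<in> carrier L" "z \<in> carrier L"
  shows "x \<bullet> y \<bullet> z = x \<bullet> z \<bullet> y \<oplus> x \<bullet> (y \<bullet> z)"
proof -
  have "x \<bullet> y \<bullet> z \<oplus> (\<ominus> (x \<bullet> (y \<bullet> z)) \<oplus> \<ominus> (x \<bullet> z \<bullet> y)) = \<zero>"
    using br_jacobi[of x y z] br_anticomm[of x "y \<bullet> z"] br_anticomm[of x z]
    by (simp add: br_neg_left a_assoc)
  then have "x \<bullet> y \<bullet> z = \<ominus> (\<ominus> (x \<bullet> (y \<bullet> z)) \<oplus> \<ominus> (x \<bullet> z \<bullet> y))"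
    by (metis (no_types, lifting) a_inv_closed add.m_closed assms br_closed minus_equality)
  then show ?thesis
    by (simp add: minus_add a_comm)
qed

lemma br_br_right:
  assumes [simp]: "x \<in> carrier L" "y \<in> carrier L" "z \<in> carrier L"
  shows "x \<bullet> (y \<bullet> z) = x \<bullet> y \<bullet> z \<oplus> \<ominus> (x \<bullet> z \<bullet> y)"
  using br_br_swap[of x y z] a_comm[of "x \<bullet> z \<bullet> y"] by (simp add: a_assoc r_neg)

definition addsub :: "'l set \<Rightarrow> bool" where
  "addsub S \<longleftrightarrow> S \<subseteq> carrier L \<and> \<zero> \<in> S \<and> (\<forall>x\<in>S. \<forall>y\<in>S. x \<oplus> y \<in> S) \<and> (\<forall>x\<in>S. \<ominus> x \<in> S)"

lemma addsubI:
  assumes "S \<subseteq> carrier L" "\<zero> \<in> S" "\<And>x y. \<lbrakk>x \<in> S; y \<in> S\<rbrakk> \<Longrightarrow> x \<oplus> y \<in> S" "\<And>x. x \<in> S \<Longrightarrow> \<ominus> x \<in> S"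
  shows "addsub S"
  using assms unfolding addsub_def by blast

lemma addsubD:
  assumes "addsub S"
  shows "x \<in> S \<Longrightarrow> x \<in> carrier L" "\<zero> \<in> S" "\<lbrakk>x \<in> S; y \<in> S\<rbrakk> \<Longrightarrow> x \<oplus> y \<in> S" "x \<in> S \<Longrightarrow> \<ominus> x \<in> S"
  using assms unfolding addsub_def by blast+

lemma addsub_carrier: "addsub (carrier L)"
  by (simp add: addsub_def)

lemma addsub_zero: "addsub {\<zero>}"
  by (simp add: addsub_def)

lemma addsub_br_comm:
  assumes "addsub S" "x \<bullet> y \<in> S" "x \<in> carrier L" "y \<in> carrier L"
  shows "y \<bullet> x \<in> S"
  using addsubD(4)[OF assms(1,2)] br_anticomm[of x y] assms by simp

text \<open>
  The Jacobi identity in the form in which it serves to interchange two letters modulo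
  \<open>S\<close>.
\<close>

lemma addsub_br_swap:
  assumes "addsub S" "x \<bullet> z \<bullet> y \<in> S" "x \<bullet> (y \<bullet> z) \<in> S"
    "x \<in> carrier L" "y \<in> carrier L" "z \<in> carrier L"
  shows "x \<bullet> y \<bullet> z \<in> S"
  using addsubD(3)[OF assms(1-3)] br_br_swap[of x y z] assms by simp

lemma addsub_br_right:
  assumes "addsub S" "x \<bullet> y \<bullet> z \<in> S" "x \<bullet> z \<bullet> y \<in> S"
    "x \<in> carrier L" "y \<in> carrier L" "z \<in> carrier L"
  shows "x \<bullet> (y \<bullet> z) \<in> S"
  using addsubD(3)[OF assms(1,2) addsubD(4)[OF assms(1,3)]] br_br_right[of x y z] assms by simp

inductive_set aspan :: "'l set \<Rightarrow> 'l set" for S where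
  aspan_zero: "\<zero> \<in> aspan S"
| aspan_base: "\<lbrakk>x \<in> S; x \<in> carrier L\<rbrakk> \<Longrightarrow> x \<in> aspan S"
| aspan_add: "\<lbrakk>x \<in> aspan S; y \<in> aspan S\<rbrakk> \<Longrightarrow> x \<oplus> y \<in> aspan S"
| aspan_neg: "x \<in> aspan S \<Longrightarrow> \<ominus> x \<in> aspan S"

lemma aspan_closed: "x \<in> aspan S \<Longrightarrow> x \<in> carrier L"
  by (induction rule: aspan.induct) auto

lemma addsub_aspan: "addsub (aspan S)"
  by (rule addsubI) (auto intro: aspan.intros aspan_closed)

lemma aspan_least:
  assumes "addsub T" "\<And>x. \<lbrakk>x \<in> S; x \<in> carrier L\<rbrakk> \<Longrightarrow> x \<in> T" "x \<in> aspan S"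
  shows "x \<in> T"
  using assms(3) by induction (auto intro: assms(2) addsubD[OF assms(1)])

lemma aspan_mono: "S \<subseteq> T \<Longrightarrow> aspan S \<subseteq> aspan T"
  by (meson addsub_aspan aspan_base aspan_least subsetD subsetI)

lemma addsub_vimage_left:
  assumes "addsub S" "y \<in> carrier L"
  shows "addsub {x \<in> carrier L. x \<bullet> y \<in> S}"
  using assms by (intro addsubI) (auto simp: br_add_left br_neg_left dest: addsubD)

lemma addsub_vimage_right:
  assumes "addsub S" "x \<in> carrier L"
  shows "addsub {y \<in> carrier L. x \<bullet> y \<in> S}"
  using assms by (intro addsubI) (auto simp: br_add_right br_neg_right dest: addsubD)

lemma addsub_Inter:
  assumes "\<And>i. i \<in> I \<Longrightarrow> addsub (S i)"
  shows "addsub {x \<in> carrier L. \<forall>i\<in>I. x \<in> S i}"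
  using assms by (intro addsubI) (auto dest: addsubD)

lemma br_aspan_left:
  assumes "addsub T" "\<And>x. \<lbrakk>x \<in> S; x \<in> carrier L\<rbrakk> \<Longrightarrow> x \<bullet> y \<in> T" "x \<in> aspan S" "y \<in> carrier L"
  shows "x \<bullet> y \<in> T"
  using aspan_least[OF addsub_vimage_left[OF assms(1,4)], of S x] assms by blast

lemma br_aspan_right:
  assumes "addsub T" "\<And>y. \<lbrakk>y \<in> S; y \<in> carrier L\<rbrakk> \<Longrightarrow> x \<bullet> y \<in> T" "y \<in> aspan S" "x \<in> carrier L"
  shows "x \<bullet> y \<in> T"
  using aspan_least[OF addsub_vimage_right[OF assms(1,4)], of S y] assms by blast

lemma br_aspan_aspan:
  assumes "addsub U" "\<And>x y. \<lbrakk>x \<in> S; y \<in> T; x \<in> carrier L; y \<in> carrier L\<rbrakk> \<Longrightarrow> x \<bullet> y \<in> U"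
    "x \<in> aspan S" "y \<in> aspan T"
  shows "x \<bullet> y \<in> U"
proof (rule br_aspan_left[OF assms(1) _ assms(3)])
  show "x \<bullet> y \<in> U" if "x \<in> S" "x \<in> carrier L" for x
    by (rule br_aspan_right[OF assms(1) _ assms(4)]) (use assms(2) that in auto)
qed (rule aspan_closed[OF assms(4)])

abbreviation comm :: "'l \<Rightarrow> 'l list \<Rightarrow> 'l" where
  "comm u xs \<equiv> foldl br u xs"

lemma comm_closed: "\<lbrakk>u \<in> carrier L; set xs \<subseteq> carrier L\<rbrakk> \<Longrightarrow> comm u xs \<in> carrier L"
  by (induction xs arbitrary: u) auto

lemma comm_invariant:
  assumes "\<And>x y. \<lbrakk>x \<in> F; y \<in> V\<rbrakk> \<Longrightarrow> x \<bullet> y \<in> F" "u \<in> F" "set xs \<subseteq> V"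
  shows "comm u xs \<in> F"
  using assms(2,3) by (induction xs arbitrary: u) (auto intro: assms(1))

lemma addsub_vimage_comm:
  assumes "addsub S" "set xs \<subseteq> carrier L"
  shows "addsub {u \<in> carrier L. comm u xs \<in> S}"
  using assms(2)
proof (induction xs)
  case Nil
  have "{u \<in> carrier L. comm u [] \<in> S} = S"
    using assms(1) by (auto dest: addsubD)
  then show ?case
    using assms(1) by simp
next
  case (Cons x xs)
  then have "addsub {u \<in> carrier L. u \<bullet> x \<in> {u \<in> carrier L. comm u xs \<in> S}}"
    by (intro addsub_vimage_left) auto
  moreover have "{u \<in> carrier L. u \<bullet> x \<in> {u \<in> carrier L. comm u xs \<in> S}}
      = {u \<in> carrier L. comm u (x # xs) \<in> S}"
    using Cons.prems by auto
  ultimately show ?case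
    by simp
qed

lemma comm_zero: "set xs \<subseteq> carrier L \<Longrightarrow> comm \<zero> xs = \<zero>"
  by (induction xs) auto

lemma comm_aspan_start:
  assumes "addsub T" "\<And>u. \<lbrakk>u \<in> S; u \<in> carrier L\<rbrakk> \<Longrightarrow> comm u xs \<in> T" "u \<in> aspan S" "set xs \<subseteq> carrier L"
  shows "comm u xs \<in> T"
  using aspan_least[OF addsub_vimage_comm[OF assms(1,4)], of S u] assms by blast

definition ideal_of :: "'l set \<Rightarrow> bool" where
  "ideal_of K \<longleftrightarrow> addsub K \<and> (\<forall>x\<in>K. \<forall>y\<in>carrier L. x \<bullet> y \<in> K)"

lemma ideal_ofI:
  assumes "addsub K" "\<And>x y. \<lbrakk>x \<in> K; y \<in> carrier L\<rbrakk> \<Longrightarrow> x \<bullet> y \<in> K"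
  shows "ideal_of K"
  using assms unfolding ideal_of_def by blast

lemma ideal_ofD:
  assumes "ideal_of K"
  shows "addsub K" "x \<in> K \<Longrightarrow> x \<in> carrier L"
    "\<lbrakk>x \<in> K; y \<in> carrier L\<rbrakk> \<Longrightarrow> x \<bullet> y \<in> K" "\<lbrakk>x \<in> K; y \<in> carrier L\<rbrakk> \<Longrightarrow> y \<bullet> x \<in> K"
proof -
  show K: "addsub K" and "x \<in> K \<Longrightarrow> x \<in> carrier L"
    using assms by (auto simp: ideal_of_def dest: addsubD)
  show *: "x \<bullet> y \<in> K" if "x \<in> K" "y \<in> carrier L" for x y
    using assms that by (auto simp: ideal_of_def)
  show "y \<bullet> x \<in> K" if "x \<in> K" "y \<in> carrier L"
    using addsub_br_comm[OF K *[OF that]] that K by (auto dest: addsubD)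
qed

lemma comm_ideal:
  assumes "ideal_of K" "u \<in> K" "set xs \<subseteq> carrier L"
  shows "comm u xs \<in> K"
  using comm_invariant[of K "carrier L" u xs] assms ideal_ofD by blast

text \<open>
  Multilinearity, one letter at a time: the elements that are sent into \<open>F'\<close> by every
  \<open>j\<close> letters from \<open>V\<close> form an additive subgroup. Letters from
  \<open>K\<close> act trivially on \<open>F/F'\<close> and come for free.
\<close>

lemma comm_aspan_letters:
  assumes F: "addsub F" "addsub F'" "F' \<subseteq> F"
    and V: "V \<subseteq> carrier L"
    and inv: "\<And>x y. \<lbrakk>x \<in> F; y \<in> V\<rbrakk> \<Longrightarrow> x \<bullet> y \<in> F" "\<And>x y. \<lbrakk>x \<in> F'; y \<in> V\<rbrakk> \<Longrightarrow> x \<bullet> y \<in> F'"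
    and K: "K \<subseteq> carrier L" "\<And>x y. \<lbrakk>x \<in> F; y \<in> K\<rbrakk> \<Longrightarrow> x \<bullet> y \<in> F'"
    and nil: "\<And>u xs. \<lbrakk>u \<in> F; set xs \<subseteq> V; length xs = n\<rbrakk> \<Longrightarrow> comm u xs \<in> F'"
    and u: "u \<in> F" "set xs \<subseteq> aspan (K \<union> V)" "length xs = n"
  shows "comm u xs \<in> F'"
proof -
  define G where "G j = {u \<in> F. \<forall>xs. set xs \<subseteq> V \<and> length xs = j \<longrightarrow> comm u xs \<in> F'}" for j
  have "G j = {u \<in> carrier L. \<forall>S \<in> insert F ((\<lambda>xs. {u \<in> carrier L. comm u xs \<in> F'}) ` {xs. set xs \<subseteq> V \<and> length xs = j}). u \<in> S}" for j
    using F(1) by (auto simp: G_def dest: addsubD)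
  moreover have "addsub {u \<in> carrier L. \<forall>S \<in> insert F ((\<lambda>xs. {u \<in> carrier L. comm u xs \<in> F'}) ` {xs. set xs \<subseteq> V \<and> length xs = j}). u \<in> S}" for j
    using F V by (intro addsub_Inter) (auto intro!: addsub_vimage_comm)
  ultimately have G: "addsub (G j)" for j
    by simp
  have FG: "F' \<subseteq> G j" for j
    using F(3) comm_invariant[of F' V, OF inv(2)] by (auto simp: G_def)
  have step: "u \<bullet> v \<in> G j" if "u \<in> G (Suc j)" "v \<in> aspan (K \<union> V)" for u v j
  proof (rule br_aspan_right[OF G _ that(2)])
    show "u \<in> carrier L"
      using that(1) G addsubD by blast
    fix y assume y: "y \<in> K \<union> V" "y \<in> carrier L"
    have "u \<in> F"
      using that(1) by (simp add: G_def)
    show "u \<bullet> y \<in> G j"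
    proof (cases "y \<in> K")
      case True
      then show ?thesis
        using K(2)[OF \<open>u \<in> F\<close>] FG by blast
    next
      case False
      then have yV: "y \<in> V"
        using y by blast
      have "comm (u \<bullet> y) xs \<in> F'" if "set xs \<subseteq> V" "length xs = j" for xs
      proof -
        have "comm u (y # xs) \<in> F'"
          using \<open>u \<in> G (Suc j)\<close> yV that unfolding G_def by (metis (mono_tags, lifting) insert_subset
              length_Cons list.simps(15) mem_Collect_eq)
        then show ?thesis
          by simp
      qed
      then show ?thesis
        using inv(1)[OF \<open>u \<in> F\<close> yV] unfolding G_def by blast
    qed
  qed
  have key: "comm u xs \<in> F'" if "u \<in> G j" "set xs \<subseteq> aspan (K \<union> V)" "length xs = j" for u xs j
    using that
  proof (induction xs arbitrary: u j)
    case Nil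
    then show ?case
      by (auto simp: G_def)
  next
    case (Cons x xs)
    then show ?case
      using step[of u "length xs" x] by auto
  qed
  have "u \<in> G n"
    using u(1) nil by (simp add: G_def)
  from key[OF this u(2,3)] show ?thesis .
qed

end

section \<open>Kreknin's theorem relative to an ideal\<close>

context lie_ring
begin

text \<open>
  A family graded by the residues modulo \<open>n\<close>. Everything is relative to an ideal
  \<open>K\<close>, which takes the role of zero and is kept inside all members of the family, so
  that no quotients are formed.
\<close>

definition zgraded :: "'l set \<Rightarrow> nat \<Rightarrow> (nat \<Rightarrow> 'l set) \<Rightarrow> bool" where
  "zgraded K n M \<longleftrightarrow> (\<forall>i<n. addsub (M i) \<and> K \<subseteq> M i) \<and>
     (\<forall>i<n. \<forall>j<n. \<forall>x\<in>M i. \<forall>y\<in>M j. x \<bullet> y \<in> M ((i + j) mod n))"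

lemma zgradedD:
  assumes "zgraded K n M"
  shows "i < n \<Longrightarrow> addsub (M i)" "\<lbrakk>i < n; x \<in> K\<rbrakk> \<Longrightarrow> x \<in> M i" "\<lbrakk>i < n; x \<in> M i\<rbrakk> \<Longrightarrow> x \<in> carrier L"
    "\<lbrakk>i < n; j < n; x \<in> M i; y \<in> M j\<rbrakk> \<Longrightarrow> x \<bullet> y \<in> M ((i + j) mod n)"
  using assms unfolding zgraded_def by (blast dest: addsubD)+

definition zderived :: "'l set \<Rightarrow> nat \<Rightarrow> (nat \<Rightarrow> 'l set) \<Rightarrow> nat \<Rightarrow> 'l set" where
  "zderived K n M i =
     aspan (K \<union> {x \<bullet> y |u v x y. u < n \<and> v < n \<and> (u + v) mod n = i \<and> x \<in> M u \<and> y \<in> M v})"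

lemma zderived_subset:
  assumes "zgraded K n M" "i < n" "x \<in> zderived K n M i"
  shows "x \<in> M i"
  using assms(3) unfolding zderived_def
  by (rule aspan_least[OF zgradedD(1)[OF assms(1,2)], rotated]) (use assms zgradedD in auto)

lemma br_in_zderived:
  assumes "zgraded K n M" "u < n" "v < n" "x \<in> M u" "y \<in> M v"
  shows "x \<bullet> y \<in> zderived K n M ((u + v) mod n)"
  unfolding zderived_def
proof (rule aspan_base)
  show "x \<bullet> y \<in> carrier L"
    using zgradedD(3)[OF assms(1)] assms by blast
qed (use assms in blast)

lemma zgraded_zderived:
  assumes "ideal_of K" "zgraded K n M"
  shows "zgraded K n (zderived K n M)"
  unfolding zgraded_def
proof (intro conjI allI impI ballI)
  fix i assume "i < n"
  show "addsub (zderived K n M i)"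
    by (simp add: zderived_def addsub_aspan)
  show "K \<subseteq> zderived K n M i"
    using ideal_ofD[OF assms(1)] by (auto simp: zderived_def intro: aspan_base)
next
  fix i j x y
  assume "i < n" "j < n" "x \<in> zderived K n M i" "y \<in> zderived K n M j"
  then show "x \<bullet> y \<in> zderived K n M ((i + j) mod n)"
    by (intro br_in_zderived assms) (auto intro: zderived_subset[OF assms(2)])
qed

lemma zgraded_zderived_pow:
  assumes "ideal_of K" "zgraded K n M"
  shows "zgraded K n ((zderived K n ^^ t) M)"
  by (induction t) (auto intro: assms zgraded_zderived)

lemma zderived_pow_subset:
  assumes "ideal_of K" "zgraded K n M" "i < n" "x \<in> (zderived K n ^^ t) M i"
  shows "x \<in> M i"
  using assms(4)
  by (induction t) (auto dest: zderived_subset[OF zgraded_zderived_pow[OF assms(1,2)] assms(3)])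

text \<open>
  The homogeneous parts of the graded subring generated by the components of residue at least
  \<open>t\<close>.
\<close>

inductive zgen :: "'l set \<Rightarrow> nat \<Rightarrow> nat \<Rightarrow> (nat \<Rightarrow> 'l set) \<Rightarrow> nat \<Rightarrow> 'l \<Rightarrow> bool"
  for K n t M where
  zgen_K: "\<lbrakk>x \<in> K; i < n\<rbrakk> \<Longrightarrow> zgen K n t M i x"
| zgen_base: "\<lbrakk>x \<in> M i; t \<le> i; i < n\<rbrakk> \<Longrightarrow> zgen K n t M i x"
| zgen_add: "\<lbrakk>zgen K n t M i x; zgen K n t M i y\<rbrakk> \<Longrightarrow> zgen K n t M i (x \<oplus> y)"
| zgen_neg: "zgen K n t M i x \<Longrightarrow> zgen K n t M i (\<ominus> x)"
| zgen_br: "\<lbrakk>zgen K n t M i x; zgen K n t M j y\<rbrakk> \<Longrightarrow> zgen K n t M ((i + j) mod n) (x \<bullet> y)"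

lemma zgen_component:
  assumes "zgraded K n M" "zgen K n t M i x"
  shows "i < n \<and> x \<in> M i"
  using assms(2)
proof induction
  case (zgen_add i x y)
  then show ?case
    using addsubD(3)[OF zgradedD(1)[OF assms(1)]] by auto
next
  case (zgen_neg i x)
  then show ?case
    using addsubD(4)[OF zgradedD(1)[OF assms(1)]] by auto
next
  case (zgen_br i x j y)
  then show ?case
    using zgradedD(4)[OF assms(1)] by auto
qed (use zgradedD(2)[OF assms(1)] in auto)

lemma zgen_mono:
  assumes "\<And>i x. \<lbrakk>i < n; t \<le> i; x \<in> N i\<rbrakk> \<Longrightarrow> zgen K n t' M i x" "zgen K n t N i x"
  shows "zgen K n t' M i x"
  using assms(2) by induction (auto intro: zgen.intros assms(1))

lemma addsub_zgen:
  assumes "ideal_of K" "zgraded K n M" "i < n"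
  shows "addsub {x. zgen K n t M i x}"
proof (rule addsubI)
  show "{x. zgen K n t M i x} \<subseteq> carrier L"
    using zgen_component[OF assms(2)] zgradedD(3)[OF assms(2)] by blast
qed (use assms(3) addsubD(2)[OF ideal_ofD(1)[OF assms(1)]] in \<open>auto intro: zgen.intros\<close>)

text \<open>
  Brackets with a fixed element are derivations, and those with elements of residue 0 preserve the
  components that generate.
\<close>

lemma zgen_br_zero_component:
  assumes K: "ideal_of K" and M: "zgraded K n M" and "zgen K n t M i z" and w: "w \<in> M 0" and n: "0 < n"
  shows "zgen K n t M i (z \<bullet> w)"
  using assms(3)
proof induction
  case (zgen_K x i)
  then show ?case
    using ideal_ofD[OF K] zgradedD(3)[OF M n w] by (auto intro: zgen.intros)
next
  case (zgen_base x i)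
  then show ?case
    using zgradedD(4)[OF M zgen_base(3) n zgen_base(1) w] by (auto intro: zgen.intros)
next
  case (zgen_add i x y)
  then have "x \<in> carrier L" "y \<in> carrier L" "w \<in> carrier L"
    using zgen_component[OF M] zgradedD(3)[OF M] w n by blast+
  then show ?case
    using zgen.zgen_add[OF zgen_add.IH] by (simp add: br_add_left)
next
  case (zgen_neg i x)
  then have "x \<in> carrier L" "w \<in> carrier L"
    using zgen_component[OF M] zgradedD(3)[OF M] w n by blast+
  then show ?case
    using zgen.zgen_neg[OF zgen_neg.IH] by (simp add: br_neg_left)
next
  case (zgen_br i x j y)
  then have c: "x \<in> carrier L" "y \<in> carrier L" "w \<in> carrier L"
    using zgen_component[OF M] zgradedD(3)[OF M] w n by blast+
  have "zgen K n t M ((i + j) mod n) (x \<bullet> w \<bullet> y)" "zgen K n t M ((i + j) mod n) (x \<bullet> (y \<bullet> w))"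
    using zgen_br by (auto intro: zgen.intros)
  then show ?case
    using c zgen.zgen_add by (simp add: br_br_swap[of x y w])
qed

text \<open>
  The Jacobi identity turns a commutator with a compound element into left-normed commutators, and
  the last letter of each of them is a generator.
\<close>

lemma br_zgen_expand:
  assumes K: "ideal_of K" and M: "zgraded K n M" and N: "zgraded K n N" "\<And>i. i < n \<Longrightarrow> N i \<subseteq> M i"
    and "zgen K n t N v z" "x \<in> M u" "u < n"
  shows "x \<bullet> z \<in> aspan (K \<union> {w \<bullet> y |i j w y. i < n \<and> t \<le> j \<and> j < n \<and> (i + j) mod n = (u + v) mod n \<and>
           w \<in> M i \<and> y \<in> N j})"
  using assms(5-7)
proof (induction arbitrary: x u)
  case (zgen_K z v)
  then show ?case
    using ideal_ofD[OF K] zgradedD(3)[OF M] by (intro aspan_base) auto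
next
  case (zgen_base z v)
  show ?case
  proof (rule aspan_base)
    show "x \<bullet> z \<in> carrier L"
      using zgradedD(3)[OF M] zgradedD(3)[OF N(1)] zgen_base by blast
  qed (use zgen_base in blast)
next
  case (zgen_add i y z)
  then have "x \<in> carrier L" "y \<in> carrier L" "z \<in> carrier L"
    using zgen_component[OF N(1)] zgradedD(3)[OF N(1)] zgradedD(3)[OF M] by blast+
  then show ?case
    using aspan_add[OF zgen_add.IH[OF zgen_add.prems]] by (simp add: br_add_right)
next
  case (zgen_neg i z)
  then have "x \<in> carrier L" "z \<in> carrier L"
    using zgen_component[OF N(1)] zgradedD(3)[OF N(1)] zgradedD(3)[OF M] by blast+
  then show ?case
    using aspan_neg[OF zgen_neg.IH[OF zgen_neg.prems]] by (simp add: br_neg_right)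
next
  case (zgen_br i y j z)
  then have *: "i < n" "y \<in> M i" "j < n" "z \<in> M j"
    using zgen_component[OF N(1)] N(2) by blast+
  have mods: "((u + i) mod n + j) mod n = (u + (i + j) mod n) mod n"
    "((u + j) mod n + i) mod n = (u + (i + j) mod n) mod n"
    by (simp_all add: mod_simps ac_simps)
  have "x \<bullet> y \<in> M ((u + i) mod n)" "x \<bullet> z \<in> M ((u + j) mod n)"
    using zgradedD(4)[OF M] zgen_br.prems * by auto
  note zgen_br.IH(2)[OF this(1)] zgen_br.IH(1)[OF this(2)]
  then show ?case
    using * zgen_br.prems zgradedD(3)[OF M] unfolding mods
    by (intro addsub_br_right addsub_aspan) auto
qed

text \<open>
  The heart of Kreknin's theorem. An element of residue \<open>t\<close> in the derived family is
  a sum of brackets \<open>[w, y]\<close> with a generator \<open>y\<close> of residue \<open>j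
  \<ge> t\<close>. If \<open>j > t\<close>, then \<open>w\<close> has residue \<open>n + t - j >
  t\<close> as well, so both factors are generators of residue greater than \<open>t\<close>. If
  \<open>j = t\<close>, then \<open>w\<close> has residue 0.
\<close>

lemma zderived_step:
  assumes K: "ideal_of K" and M: "zgraded K n M" and N: "zgraded K n N" "\<And>i. i < n \<Longrightarrow> N i \<subseteq> M i"
    and N': "zgraded K n N'" "\<And>i x. \<lbrakk>i < n; x \<in> N' i\<rbrakk> \<Longrightarrow> zgen K n t N i x"
    and t: "t < n" and x: "x \<in> zderived K n N' t"
  shows "x \<in> aspan ({x. zgen K n (Suc t) M t x} \<union> {y \<bullet> w |y w. y \<in> N t \<and> w \<in> M 0})"
    (is "_ \<in> aspan ?G")
proof -
  have NM: "N' i \<subseteq> M i" if "i < n" for i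
    using N'(2) zgen_component[OF N(1)] N(2) that by blast
  have KG: "z \<in> aspan ?G" if "z \<in> K" for z
    using that t ideal_ofD(2)[OF K] by (auto intro!: aspan_base zgen_K)
  have last: "w \<bullet> y \<in> aspan ?G"
    if i: "i < n" "w \<in> M i" and j: "t \<le> j" "j < n" "y \<in> N j" and ij: "(i + j) mod n = t" for i j w y
  proof -
    have c: "w \<in> carrier L" "y \<in> carrier L"
      using that zgradedD(3)[OF M] N(2) by blast+
    show ?thesis
    proof (cases "j = t")
      case True
      have "i = 0"
      proof (rule ccontr)
        assume "i \<noteq> 0"
        then have "(i + t) mod n \<noteq> t"
          using i(1) t by (cases "i + t < n") (auto simp: mod_if)
        then show False
          using ij True by simp
      qed
      have "y \<bullet> w \<in> ?G"
        using True \<open>i = 0\<close> i(2) j(3) by blast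
      then have "y \<bullet> w \<in> aspan ?G"
        using c by (intro aspan_base) auto
      then show ?thesis
        using addsub_br_comm[OF addsub_aspan _ c(2,1)] by blast
    next
      case False
      then have "Suc t \<le> j"
        using j by simp
      moreover have "Suc t \<le> i"
      proof -
        have "i + j \<noteq> t"
          using \<open>Suc t \<le> j\<close> by simp
        moreover have "i + j < n + n"
          using i j by simp
        ultimately have "i + j = n + t"
          using ij t by (metis add_diff_cancel_left' le_add_diff_inverse linorder_not_less mod_if mod_less less_diff_conv2)
        then show ?thesis
          using j(2) by simp
      qed
      ultimately have "zgen K n (Suc t) M ((i + j) mod n) (w \<bullet> y)"
        using i j N(2) by (intro zgen_br zgen_base) auto
      then show ?thesis
        using ij c by (intro aspan_base) auto
    qed
  qed
  show ?thesis
    using x unfolding zderived_def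
  proof (rule aspan_least[OF addsub_aspan, rotated])
    fix z assume z: "z \<in> K \<union> {x \<bullet> y |u v x y. u < n \<and> v < n \<and> (u + v) mod n = t \<and> x \<in> N' u \<and> y \<in> N' v}"
      "z \<in> carrier L"
    show "z \<in> aspan ?G"
    proof (cases "z \<in> K")
      case False
      then obtain u v x y where *: "z = x \<bullet> y" "u < n" "v < n" "(u + v) mod n = t" "x \<in> N' u" "y \<in> N' v"
        using z by blast
      have "x \<in> M u"
        using NM * by blast
      note br_zgen_expand[OF K M N N'(2)[OF *(3,6)] this *(2)]
      then show ?thesis
        unfolding *(1,4) by (rule aspan_least[OF addsub_aspan, rotated]) (use KG last in auto)
    qed (rule KG)
  qed
qed

text \<open>
  The derived length for \<open>e\<close> nonzero components when \<open>m\<close> letters of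
  residue 0 act as zero. Eliminating one component takes \<open>m\<close> rounds, each of one
  derivation after the previous bound, and the previous bound once more for the remaining
  components.
\<close>

primrec solv_bound :: "nat \<Rightarrow> nat \<Rightarrow> nat" where
  "solv_bound m 0 = 0"
| "solv_bound m (Suc e) = m * Suc (solv_bound m e) + solv_bound m e"

text \<open>
  The derived series is pushed into the subrings generated by components of larger and larger
  residue. In the step, \<open>zderived_step\<close> is applied repeatedly: after \<open>j\<close>
  rounds an element of residue \<open>t\<close> is expressed by generators of larger residue, up
  to commutators with \<open>j\<close> letters of residue 0, and these vanish for \<open>j =
  m\<close>. Vanishing components are skipped, so only the number of the others enters the bound.
  The lemma is stated for all families at once because the induction hypothesis is needed for the
  terms of the derived series.
\<close>

lemma kreknin_generated:
  assumes K: "ideal_of K" and "t \<le> n" and n: "0 < n"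
    and "zgraded K n M"
    and "\<And>i x ws. \<lbrakk>i < n; x \<in> M i; set ws \<subseteq> M 0; length ws = m\<rbrakk> \<Longrightarrow> comm x ws \<in> K"
    and "card {i. i < t \<and> \<not> M i \<subseteq> K} \<le> e"
    and "i < n" "x \<in> (zderived K n ^^ solv_bound m e) M i"
  shows "zgen K n t M i x"
  using assms(2,4-)
proof (induction t arbitrary: M e i x)
  case 0
  then show ?case
    using zderived_pow_subset[OF K] by (auto intro: zgen_base)
next
  case (Suc t)
  note M = Suc.prems(2) and nil = Suc.prems(3)
  have t: "t < n"
    using Suc.prems by simp
  show ?case
  proof (cases "M t \<subseteq> K")
    case True
    then have "{i. i < Suc t \<and> \<not> M i \<subseteq> K} = {i. i < t \<and> \<not> M i \<subseteq> K}"
      by (auto simp: less_Suc_eq)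
    then have "card {i. i < t \<and> \<not> M i \<subseteq> K} \<le> e"
      using Suc.prems(4) by metis
    then have "zgen K n t M i x"
      by (intro Suc.IH[OF less_imp_le[OF t] M _ _ Suc.prems(5,6)]) (rule nil)
    then show ?thesis
    proof (rule zgen_mono[rotated])
      fix i x assume "i < n" "t \<le> i" "x \<in> M i"
      then show "zgen K n (Suc t) M i x"
        using True by (cases "i = t") (auto intro: zgen_K zgen_base)
    qed
  next
    case False
    then have "{i. i < Suc t \<and> \<not> M i \<subseteq> K} = insert t {i. i < t \<and> \<not> M i \<subseteq> K}"
      by (auto simp: less_Suc_eq)
    moreover have "card (insert t {i. i < t \<and> \<not> M i \<subseteq> K}) = Suc (card {i. i < t \<and> \<not> M i \<subseteq> K})"
      by (rule card_insert_disjoint) auto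
    ultimately have "Suc (card {i. i < t \<and> \<not> M i \<subseteq> K}) \<le> e"
      using Suc.prems(4) by (elim subst)
    then have e: "e = Suc (e - 1)" "card {i. i < t \<and> \<not> M i \<subseteq> K} \<le> e - 1"
      by linarith+
    define e' where "e' = e - 1"
    note e = e[folded e'_def]
    define s where "s = solv_bound m e'"
    define D where "D = (\<lambda>r. (zderived K n ^^ r) M)"
    have D: "zgraded K n (D r)" "\<And>i. i < n \<Longrightarrow> D r i \<subseteq> M i" for r
      unfolding D_def by (rule zgraded_zderived_pow[OF K M], rule subsetI, rule zderived_pow_subset[OF K M])
    have IH: "zgen K n t (D r) i x" if "i < n" "x \<in> D (s + r) i" for r i x
    proof (rule Suc.IH[OF _ D(1) _ _ \<open>i < n\<close>])
      show "comm x ws \<in> K" if "i < n" "x \<in> D r i" "set ws \<subseteq> D r 0" "length ws = m" for i x ws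
      proof (rule nil[OF that(1)])
        show "x \<in> M i" "set ws \<subseteq> M 0" "length ws = m"
          using that D(2) n by blast+
      qed
      have "{i. i < t \<and> \<not> D r i \<subseteq> K} \<subseteq> {i. i < t \<and> \<not> M i \<subseteq> K}"
      proof (intro Collect_mono impI, elim conjE)
        fix i assume "i < t" "\<not> D r i \<subseteq> K"
        then show "i < t \<and> \<not> M i \<subseteq> K"
          using D(2)[of i r] t by auto
      qed
      then have "card {i. i < t \<and> \<not> D r i \<subseteq> K} \<le> card {i. i < t \<and> \<not> M i \<subseteq> K}"
        by (rule card_mono[rotated]) simp
      then show "card {i. i < t \<and> \<not> D r i \<subseteq> K} \<le> e'"
        using e(2) by (rule le_trans)
      show "x \<in> (zderived K n ^^ solv_bound m e') (D r) i"
        using that(2) by (simp add: D_def s_def funpow_add)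
    qed (use t in simp)
    let ?Q = "{x. zgen K n (Suc t) M t x}"
    have Q: "addsub ?Q"
      by (rule addsub_zgen[OF K M t])
    have iter: "x \<in> aspan (?Q \<union> {comm y ws |y ws. y \<in> M t \<and> set ws \<subseteq> M 0 \<and> length ws = j})"
      (is "_ \<in> aspan (?G j)") if "x \<in> D (j * Suc s) t" for x j
      using that
    proof (induction j arbitrary: x)
      case 0
      have "x \<in> M t"
        using 0 by (simp add: D_def)
      then have "x \<in> ?G 0"
        by force
      then show ?case
        using zgradedD(3)[OF M t] \<open>x \<in> M t\<close> by (blast intro: aspan_base)
    next
      case (Suc j)
      have "x \<in> zderived K n (D (s + j * Suc s)) t"
        using Suc.prems by (simp add: D_def add.left_commute)
      then have "x \<in> aspan (?Q \<union> {y \<bullet> w |y w. y \<in> D (j * Suc s) t \<and> w \<in> M 0})"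
        using zderived_step[OF K M D D(1) IH t] by blast
      then show ?case
      proof (rule aspan_least[OF addsub_aspan, rotated])
        fix z assume z: "z \<in> ?Q \<union> {y \<bullet> w |y w. y \<in> D (j * Suc s) t \<and> w \<in> M 0}" "z \<in> carrier L"
        show "z \<in> aspan (?G (Suc j))"
        proof (cases "z \<in> ?Q")
          case True
          then show ?thesis
            using z(2) by (blast intro: aspan_base)
        next
          case False
          then obtain y w where yw: "z = y \<bullet> w" "y \<in> D (j * Suc s) t" "w \<in> M 0"
            using z by blast
          have w: "w \<in> carrier L"
            using zgradedD(3)[OF M n] yw by blast
          have "y \<bullet> w \<in> aspan (?G (Suc j))"
          proof (rule br_aspan_left[OF addsub_aspan _ Suc.IH[OF yw(2)] w])
            fix x assume x: "x \<in> ?G j" "x \<in> carrier L"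
            show "x \<bullet> w \<in> aspan (?G (Suc j))"
            proof (rule aspan_base)
              show "x \<bullet> w \<in> carrier L"
                using x w by simp
              show "x \<bullet> w \<in> ?G (Suc j)"
              proof (cases "x \<in> ?Q")
                case True
                then show ?thesis
                  using zgen_br_zero_component[OF K M _ yw(3) n] by blast
              next
                case False
                then obtain y' ws where "x = comm y' ws" "y' \<in> M t" "set ws \<subseteq> M 0" "length ws = j"
                  using x by blast
                then have "x \<bullet> w = comm y' (ws @ [w])" "set (ws @ [w]) \<subseteq> M 0" "length (ws @ [w]) = Suc j"
                  using yw(3) by auto
                then show ?thesis
                  using \<open>y' \<in> M t\<close> by blast
              qed
            qed
          qed
          then show ?thesis
            using yw(1) by simp
        qed
      qed
    qed
    have Dt: "zgen K n (Suc t) M t x" if "x \<in> D (m * Suc s) t" for x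
    proof -
      have "x \<in> ?Q"
        by (rule aspan_least[OF Q _ iter[OF that]]) (use nil[OF t] t in \<open>auto intro: zgen_K\<close>)
      then show ?thesis
        by simp
    qed
    have "x \<in> D (s + m * Suc s) i"
      using Suc.prems(6) by (simp add: D_def e(1) s_def add.commute)
    then have "zgen K n t (D (m * Suc s)) i x"
      using IH Suc.prems(5) by blast
    then show ?thesis
    proof (rule zgen_mono[rotated])
      fix i x assume "i < n" "t \<le> i" "x \<in> D (m * Suc s) i"
      then show "zgen K n (Suc t) M i x"
      proof (cases "i = t")
        case False
        then show ?thesis
          using D(2) \<open>i < n\<close> \<open>t \<le> i\<close> \<open>x \<in> D (m * Suc s) i\<close> by (intro zgen_base) auto
      qed (use Dt in blast)
    qed
  qed
qed

text \<open>
  For \<open>t = n\<close> no generators are left. Kreknin's classical theorem is the case in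
  which the component of residue 0 vanishes.
\<close>

theorem kreknin:
  assumes K: "ideal_of K" and n: "0 < n" and M: "zgraded K n M"
    and "\<And>i x ws. \<lbrakk>i < n; x \<in> M i; set ws \<subseteq> M 0; length ws = m\<rbrakk> \<Longrightarrow> comm x ws \<in> K"
    and "card {i. i < n \<and> \<not> M i \<subseteq> K} \<le> e"
    and "i < n" "x \<in> (zderived K n ^^ solv_bound m e) M i"
  shows "x \<in> K"
proof -
  have "zgen K n n M i x"
    by (rule kreknin_generated[OF K order_refl n M _ assms(5-)]) (rule assms(4))
  then show ?thesis
    by induction (use ideal_ofD[OF K] addsubD in \<open>auto dest: zgen_component[OF M] zgradedD(3)[OF M]\<close>)
qed

end

section \<open>Reordering letters, and solvable families that act nilpotently\<close>

lemma ex_labels: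
  "set xs \<subseteq> (\<Union>a\<in>D. B a) \<Longrightarrow> \<exists>ps. set ps \<subseteq> Sigma D B \<and> map snd ps = xs"
proof (induction xs)
  case (Cons x xs)
  then obtain ps a where "set ps \<subseteq> Sigma D B" "map snd ps = xs" "a \<in> D" "x \<in> B a"
    by auto
  then have "set ((a, x) # ps) \<subseteq> Sigma D B \<and> map snd ((a, x) # ps) = x # xs"
    by auto
  then show ?case
    by (rule exI)
qed simp

context lie_ring
begin

lemma comm_swap_letters:
  assumes S: "addsub S" and "u \<in> carrier L" "set xs \<subseteq> carrier L" "p \<in> carrier L" "q \<in> carrier L" "set ys \<subseteq> carrier L"
    and "comm u (xs @ (p \<bullet> q) # ys) \<in> S" "comm u (xs @ q # p # ys) \<in> S"
  shows "comm u (xs @ p # q # ys) \<in> S"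
proof -
  let ?T = "{v \<in> carrier L. comm v ys \<in> S}" and ?w = "comm u xs"
  have w: "?w \<in> carrier L"
    using assms comm_closed by simp
  have T: "addsub ?T"
    by (rule addsub_vimage_comm[OF S]) fact
  have "?w \<bullet> q \<bullet> p \<in> ?T" "?w \<bullet> (p \<bullet> q) \<in> ?T"
    using assms w by auto
  from addsub_br_swap[OF T this w] assms show ?thesis
    by simp
qed

text \<open>
  Letters carry labels because the error terms of the reordering have to be controlled by the
  labels of the letters that they come from.
\<close>

lemma comm_move_letter:
  assumes S: "addsub S" and u: "u \<in> carrier L"
    and swap: "\<And>xs p q zs. mset (xs @ p # q # zs) = mset ps \<Longrightarrow>
      comm u (map snd xs @ (snd p \<bullet> snd q) # map snd zs) \<in> S"
    and "mset (pre @ ys @ p # zs) = mset ps" "snd ` set ps \<subseteq> carrier L"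
    and "comm u (map snd (pre @ ys @ p # zs)) \<in> S"
  shows "comm u (map snd (pre @ p # ys @ zs)) \<in> S"
  using assms(4-)
proof (induction ys arbitrary: pre)
  case (Cons y ys)
  have sets: "set (pre @ (y # ys) @ p # zs) = set ps"
    using Cons.prems(1) by (rule mset_eq_setD)
  have IH: "comm u (map snd (pre @ y # p # ys @ zs)) \<in> S"
    using Cons.IH[of "pre @ [y]"] Cons.prems by simp
  have "comm u (map snd (pre @ p # y # ys @ zs)) \<in> S"
    unfolding map_append list.map
  proof (rule comm_swap_letters[OF S u])
    show "comm u (map snd pre @ (snd p \<bullet> snd y) # (map snd ys @ map snd zs)) \<in> S"
      using swap[of pre p y "ys @ zs"] Cons.prems(1) by (simp add: add_mset_commute)
  qed (use IH Cons.prems sets in auto)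
  then show ?case
    by simp
qed simp

lemma comm_permute:
  assumes S: "addsub S" and u: "u \<in> carrier L"
    and swap: "\<And>xs p q zs. mset (xs @ p # q # zs) = mset ps \<Longrightarrow>
      comm u (map snd xs @ (snd p \<bullet> snd q) # map snd zs) \<in> S"
    and ps: "snd ` set ps \<subseteq> carrier L" and qs: "mset qs = mset ps" "comm u (map snd qs) \<in> S"
  shows "comm u (map snd ps) \<in> S"
proof -
  have "comm u (map snd (pre @ xs)) \<in> S"
    if "mset xs = mset ys" "mset (pre @ xs) = mset ps" "comm u (map snd (pre @ ys)) \<in> S" for pre xs ys
    using that
  proof (induction xs arbitrary: pre ys)
    case (Cons x xs)
    have "set (x # xs) = set ys"
      using Cons.prems(1) by (rule mset_eq_setD)
    then have "x \<in> set ys"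
      by auto
    then obtain ys1 ys2 where ys: "ys = ys1 @ x # ys2"
      by (auto dest: split_list)
    have "comm u (map snd (pre @ x # ys1 @ ys2)) \<in> S"
      using Cons.prems ys by (intro comm_move_letter[OF S u _ _ ps] swap) auto
    then show ?case
      using Cons.IH[of "ys1 @ ys2" "pre @ [x]"] Cons.prems ys by simp
  qed simp
  from this[of ps qs "[]"] qs show ?thesis
    by simp
qed


text \<open>
  By the pigeonhole principle some \<open>k\<close> letters share their label, and they can be
  collected at the front, where they are known to vanish.
\<close>

lemma comm_collect_letters:
  fixes ps :: "('c \<times> 'l) list"
  assumes S: "addsub S" and u: "u \<in> carrier L"
    and D: "finite D" "fst ` set ps \<subseteq> D" "card D * k < length ps" and ps: "snd ` set ps \<subseteq> carrier L"
    and swap: "\<And>xs p q zs. mset (xs @ p # q # zs) = mset ps \<Longrightarrow>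
      comm u (map snd xs @ (snd p \<bullet> snd q) # map snd zs) \<in> S"
    and nil: "\<And>a qs rs. \<lbrakk>a \<in> D; fst ` set qs \<subseteq> {a}; length qs = k; mset (qs @ rs) = mset ps\<rbrakk> \<Longrightarrow>
      comm u (map snd (qs @ rs)) \<in> S"
  shows "comm u (map snd ps) \<in> S"
proof -
  have "\<exists>a\<in>D. k \<le> count_list (map fst ps) a"
  proof (rule ccontr)
    assume "\<not> (\<exists>a\<in>D. k \<le> count_list (map fst ps) a)"
    then have "(\<Sum>a\<in>D. count_list (map fst ps) a) \<le> (\<Sum>a\<in>D. k)"
      by (intro sum_mono) auto
    moreover have "(\<Sum>a\<in>D. count_list (map fst ps) a) = length ps"
      using sum_count_set[of "map fst ps" D] D by simp
    ultimately show False
      using D(3) by simp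
  qed
  then obtain a where a: "a \<in> D" "k \<le> length (filter (\<lambda>p. fst p = a) ps)"
    by (auto simp: count_list_eq_length_filter filter_map comp_def eq_commute)
  define qs where "qs = filter (\<lambda>p. fst p = a) ps"
  define rs where "rs = drop k qs @ filter (\<lambda>p. fst p \<noteq> a) ps"
  have "mset (take k qs @ rs) = mset ps"
    by (simp add: rs_def qs_def flip: append_assoc)
  show ?thesis
  proof (rule comm_permute[OF S u _ ps])
    show "mset (take k qs @ rs) = mset ps"
      by fact
    show "comm u (map snd (take k qs @ rs)) \<in> S"
    proof (rule nil[OF a(1)])
      show "fst ` set (take k qs) \<subseteq> {a}"
        using set_take_subset[of k qs] by (auto simp: qs_def)
      show "length (take k qs) = k"
        using a(2) by (simp add: qs_def)
    qed fact
  qed (rule swap)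
qed

end

text \<open>
  The direct sum is described by spanning and independence of the components, which is how it is
  used.
\<close>

locale graded_lie_ring = lie_ring L br + A: abelian_group A
  for L :: "('l, 'm) ring_scheme" (structure) and br :: "'l \<Rightarrow> 'l \<Rightarrow> 'l"  (infixl \<open>\<bullet>\<close> 70)
    and A :: "('a, 'n) ring_scheme" +
  fixes C :: "'a \<Rightarrow> 'l set"
  assumes component_addsub: "a \<in> carrier A \<Longrightarrow> addsub (C a)"
    and component_br: "\<lbrakk>a \<in> carrier A; b \<in> carrier A; x \<in> C a; y \<in> C b\<rbrakk> \<Longrightarrow> x \<bullet> y \<in> C (a \<oplus>\<^bsub>A\<^esub> b)"
    and component_span: "carrier L \<subseteq> aspan (\<Union>a\<in>carrier A. C a)"
    and component_independent: "\<lbrakk>a \<in> carrier A; x \<in> C a; x \<in> aspan (\<Union>b\<in>carrier A - {a}. C b)\<rbrakk> \<Longrightarrow> x = \<zero>"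
begin

lemma component_carrier: "\<lbrakk>a \<in> carrier A; x \<in> C a\<rbrakk> \<Longrightarrow> x \<in> carrier L"
  using component_addsub addsubD(1) by blast

text \<open>
  The homogeneous components of the derived series of the part of \<open>L\<close> with degrees in
  \<open>D\<close>. Brackets with degree outside \<open>D\<close> are dropped, as they act
  trivially in the applications.
\<close>

primrec derived_component :: "'a set \<Rightarrow> nat \<Rightarrow> 'a \<Rightarrow> 'l set" where
  "derived_component D 0 a = C a"
| "derived_component D (Suc t) a =
     aspan {x \<bullet> y |u v x y. u \<in> D \<and> v \<in> D \<and> u \<oplus>\<^bsub>A\<^esub> v = a \<and> x \<in> derived_component D t u \<and> y \<in> derived_component D t v}"

lemma derived_component_subset:
  assumes D: "D \<subseteq> carrier A" and "a \<in> D"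
  shows "addsub (derived_component D t a) \<and> derived_component D (Suc t) a \<subseteq> derived_component D t a \<and> derived_component D t a \<subseteq> C a"
  using assms(2)
proof (induction t arbitrary: a)
  case 0
  have "x \<in> C a" if "x \<in> derived_component D (Suc 0) a" for x
    by (rule aspan_least[OF component_addsub _ that[unfolded derived_component.simps]])
      (use 0 D in \<open>auto intro: component_br\<close>)
  then show ?case
    using 0 D component_addsub by auto
next
  case (Suc t)
  have "x \<in> derived_component D (Suc t) a" if "x \<in> derived_component D (Suc (Suc t)) a" for x
  proof -
    have "{x \<bullet> y |u v x y. u \<in> D \<and> v \<in> D \<and> u \<oplus>\<^bsub>A\<^esub> v = a \<and> x \<in> derived_component D (Suc t) u \<and> y \<in> derived_component D (Suc t) v}
      \<subseteq> {x \<bullet> y |u v x y. u \<in> D \<and> v \<in> D \<and> u \<oplus>\<^bsub>A\<^esub> v = a \<and> x \<in> derived_component D t u \<and> y \<in> derived_component D t v}"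
      using Suc.IH by blast
    from aspan_mono[OF this] that show ?thesis
      by (auto simp del: derived_component.simps simp add: derived_component.simps(2)[of D "Suc t"] derived_component.simps(2)[of D t])
  qed
  moreover have "derived_component D (Suc t) a \<subseteq> C a"
    using Suc.IH[OF Suc.prems] by blast
  moreover have "addsub (derived_component D (Suc t) a)"
    by (simp add: addsub_aspan)
  ultimately show ?case
    by blast
qed

lemma derived_component_component: "\<lbrakk>D \<subseteq> carrier A; a \<in> D; x \<in> derived_component D t a\<rbrakk> \<Longrightarrow> x \<in> C a"
  using derived_component_subset by blast

lemma derived_component_Suc: "\<lbrakk>D \<subseteq> carrier A; a \<in> D; x \<in> derived_component D (Suc t) a\<rbrakk> \<Longrightarrow> x \<in> derived_component D t a"
  using derived_component_subset by blast

lemma derived_component_br: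
  assumes D: "D \<subseteq> carrier A" and "u \<in> D" "v \<in> D" "x \<in> derived_component D t u" "y \<in> derived_component D t v"
  shows "x \<bullet> y \<in> derived_component D (Suc t) (u \<oplus>\<^bsub>A\<^esub> v)"
  unfolding derived_component.simps
proof (rule aspan_base)
  show "x \<bullet> y \<in> carrier L"
    using derived_component_subset[OF D] assms component_carrier by blast
qed (use assms in blast)

text \<open>
  With \<open>Y\<close> the next member of the derived series, the subgroups \<open>[F, Y,
  \<dots>, Y]\<close> form a finite descending chain from \<open>F\<close> to \<open>F'\<close>.
  On each factor of the chain letters commute, because their brackets lie in \<open>Y\<close>, and
  then \<open>comm_collect_letters\<close> applies.
\<close>

lemma nilpotent_action_step:
  assumes D: "D \<subseteq> carrier A" "finite D"
    and F: "addsub F" "addsub F'" "F' \<subseteq> F"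
    and inv: "\<And>f a x. \<lbrakk>f \<in> F; a \<in> D; x \<in> C a\<rbrakk> \<Longrightarrow> f \<bullet> x \<in> F" "\<And>f a x. \<lbrakk>f \<in> F'; a \<in> D; x \<in> C a\<rbrakk> \<Longrightarrow> f \<bullet> x \<in> F'"
    and out: "\<And>f a b x y. \<lbrakk>f \<in> F; a \<in> D; b \<in> D; a \<oplus>\<^bsub>A\<^esub> b \<notin> D; x \<in> C a; y \<in> C b\<rbrakk> \<Longrightarrow> f \<bullet> (x \<bullet> y) \<in> F'"
    and nil: "\<And>f a xs. \<lbrakk>f \<in> F; a \<in> D; set xs \<subseteq> C a; length xs = k\<rbrakk> \<Longrightarrow> comm f xs \<in> F'"
    and Y: "\<And>f xs. \<lbrakk>f \<in> F; set xs \<subseteq> (\<Union>a\<in>D. derived_component D (Suc t) a); length xs = m\<rbrakk> \<Longrightarrow> comm f xs \<in> F'"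
    and f: "f \<in> F" "set xs \<subseteq> (\<Union>a\<in>D. derived_component D t a)" "length xs = Suc (card D * k) * m"
  shows "comm f xs \<in> F'"
proof -
  define V where "V = (\<Union>a\<in>D. derived_component D t a)"
  define Y where "Y = (\<Union>a\<in>D. derived_component D (Suc t) a)"
  define N where "N = Suc (card D * k)"
  define G where "G j = aspan (F' \<union> {comm f ys |f ys. f \<in> F \<and> set ys \<subseteq> Y \<and> length ys = j})" for j
  have YV: "Y \<subseteq> V"
    using derived_component_Suc[OF D(1)] unfolding Y_def V_def by blast
  have VC: "x \<in> V \<Longrightarrow> \<exists>a\<in>D. x \<in> C a" for x
    using derived_component_component[OF D(1)] unfolding V_def by blast
  then have Vc: "V \<subseteq> carrier L"
    using D component_carrier by blast
  have Fc: "F \<subseteq> carrier L"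
    using F(1) by (simp add: addsub_def)
  have FV: "f \<bullet> x \<in> F" if "f \<in> F" "x \<in> V" for f x
    using inv(1) VC that by blast
  have F'V: "f \<bullet> x \<in> F'" if "f \<in> F'" "x \<in> V" for f x
    using inv(2) VC that by blast
  have G_sub: "addsub (G j)" "F' \<subseteq> G j" for j
    using F Fc by (auto simp: G_def addsub_aspan intro!: aspan_base)
  have G_comm: "comm f ys \<in> G j" if "f \<in> F" "set ys \<subseteq> Y" "length ys = j" for f ys j
  proof -
    have "comm f ys \<in> carrier L"
      using that YV Vc Fc by (intro comm_closed) auto
    then show ?thesis
      unfolding G_def by (intro aspan_base) (use that in auto)
  qed
  have GF: "G j \<subseteq> F" for j
  proof
    fix x assume "x \<in> G j"
    then show "x \<in> F"
      unfolding G_def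
      by (rule aspan_least[OF F(1), rotated]) (use F(3) FV YV comm_invariant[of F V] in auto)
  qed
  have VV: "f \<bullet> (x \<bullet> y) \<in> G (Suc j)" if "f \<in> G j" "x \<in> V" "y \<in> V" "\<And>g z. \<lbrakk>g \<in> G j; z \<in> Y\<rbrakk> \<Longrightarrow> g \<bullet> z \<in> G (Suc j)" for f x y j
  proof -
    obtain a b where ab: "a \<in> D" "b \<in> D" "x \<in> derived_component D t a" "y \<in> derived_component D t b"
      using \<open>x \<in> V\<close> \<open>y \<in> V\<close> unfolding V_def by blast
    show ?thesis
    proof (cases "a \<oplus>\<^bsub>A\<^esub> b \<in> D")
      case True
      then have "x \<bullet> y \<in> Y"
        using derived_component_br[OF D(1) ab] by (auto simp: Y_def simp del: derived_component.simps)
      then show ?thesis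
        using that by blast
    next
      case False
      then have "f \<bullet> (x \<bullet> y) \<in> F'"
        using out[of f a b x y] ab derived_component_component[OF D(1)] GF[of j] \<open>f \<in> G j\<close> by blast
      then show ?thesis
        using G_sub by blast
    qed
  qed
  have GY: "f \<bullet> y \<in> G (Suc j)" if "f \<in> G j" "y \<in> Y" for f y j
  proof (rule br_aspan_left[OF G_sub(1) _ that(1)[unfolded G_def]])
    show yc: "y \<in> carrier L"
      using that YV Vc by blast
    fix x assume x: "x \<in> F' \<union> {comm f ys |f ys. f \<in> F \<and> set ys \<subseteq> Y \<and> length ys = j}" "x \<in> carrier L"
    show "x \<bullet> y \<in> G (Suc j)"
    proof (cases "x \<in> F'")
      case True
      then show ?thesis
        using F'V YV that G_sub by blast
    next
      case False
      then obtain g ys where "x = comm g ys" "g \<in> F" "set ys \<subseteq> Y" "length ys = j"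
        using x by blast
      then show ?thesis
        using G_comm[of g "ys @ [y]" "Suc j"] that by simp
    qed
  qed
  \<comment> \<open>Letters act on \<open>[F, Y, \<dots>, Y]\<close> as derivations, and \<open>[Y, V]\<close> lies in \<open>Y\<close> up to elements that
    act trivially.\<close>
  have GV: "f \<bullet> x \<in> G j" if "f \<in> G j" "x \<in> V" for f x j
  proof (rule br_aspan_left[OF G_sub(1) _ that(1)[unfolded G_def]])
    show xc: "x \<in> carrier L"
      using that Vc by blast
    have key: "comm g ys \<bullet> x \<in> G (length ys)" if "g \<in> F" "set ys \<subseteq> Y" for g ys
      using that
    proof (induction ys rule: rev_induct)
      case Nil
      then show ?case
        using FV[OF _ \<open>x \<in> V\<close>] G_comm[of "g \<bullet> x" "[]"] by simp
    next
      case (snoc y ys)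
      have y: "y \<in> Y" "y \<in> V" "y \<in> carrier L" and g: "comm g ys \<in> G (length ys)"
        using snoc.prems YV Vc G_comm by auto
      have "comm g ys \<bullet> x \<bullet> y \<in> G (Suc (length ys))"
        using GY snoc y by simp
      moreover have "comm g ys \<bullet> (y \<bullet> x) \<in> G (Suc (length ys))"
        using VV[OF g y(2) \<open>x \<in> V\<close> GY] .
      ultimately have "comm g ys \<bullet> y \<bullet> x \<in> G (Suc (length ys))"
        by (rule addsub_br_swap[OF G_sub(1)]) (use g GF Fc xc y in auto)
      then show ?case
        by simp
    qed
    fix z assume z: "z \<in> F' \<union> {comm f ys |f ys. f \<in> F \<and> set ys \<subseteq> Y \<and> length ys = j}"
    then show "z \<bullet> x \<in> G j"
      using F'V[OF _ \<open>x \<in> V\<close>] G_sub key by blast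
  qed
  have descend: "comm f xs \<in> G (Suc j)" if "f \<in> G j" "set xs \<subseteq> V" "length xs = N" for f xs j
  proof -
    obtain ps where ps: "set ps \<subseteq> Sigma D (derived_component D t)" "map snd ps = xs"
      using ex_labels[OF \<open>set xs \<subseteq> V\<close>[unfolded V_def]] by (elim exE conjE)
    have psV: "snd p \<in> V" if "p \<in> set ps" for p
    proof -
      have "p \<in> Sigma D (derived_component D t)"
        using ps(1) that by (rule subsetD)
      then show ?thesis
        unfolding V_def by (elim SigmaE) (simp, rule bexI)
    qed
    have "comm f (map snd ps) \<in> G (Suc j)"
    proof (rule comm_collect_letters[OF G_sub(1) _ D(2)])
      show "f \<in> carrier L"
        using that(1) GF Fc by blast
      show "fst ` set ps \<subseteq> D" "snd ` set ps \<subseteq> carrier L"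
        using ps psV Vc by auto
      have "length ps = N"
        using that(3) ps(2) by (metis length_map)
      then show "card D * k < length ps"
        by (simp add: N_def)
    next
      fix ys p q zs assume "mset (ys @ p # q # zs) = mset ps"
      then have sets: "set (ys @ p # q # zs) = set ps"
        by (rule mset_eq_setD)
      have V': "snd ` set (ys @ p # q # zs) \<subseteq> V"
        unfolding sets using psV by (rule image_subsetI)
      have "comm f (map snd ys) \<in> G j"
        by (rule comm_invariant[of "G j" V, OF GV \<open>f \<in> G j\<close>]) (use V' in auto)
      then have "comm f (map snd ys) \<bullet> (snd p \<bullet> snd q) \<in> G (Suc j)"
        using \<open>comm f (map snd ys) \<in> G j\<close> V' GY by (intro VV) auto
      then have "comm (comm f (map snd ys) \<bullet> (snd p \<bullet> snd q)) (map snd zs) \<in> G (Suc j)"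
        by - (rule comm_invariant[of "G (Suc j)" V, OF GV], use V' in auto)
      then show "comm f (map snd ys @ (snd p \<bullet> snd q) # map snd zs) \<in> G (Suc j)"
        by simp
    next
      fix a qs rs assume *: "a \<in> D" "fst ` set qs \<subseteq> {a}" "length qs = k" "mset (qs @ rs) = mset ps"
      from *(4) have sets: "set (qs @ rs) = set ps"
        by (rule mset_eq_setD)
      have V': "snd ` set (qs @ rs) \<subseteq> V"
        unfolding sets using psV by (rule image_subsetI)
      have "set (map snd qs) \<subseteq> C a"
      proof
        fix x assume "x \<in> set (map snd qs)"
        then obtain p where "p \<in> set qs" "x = snd p"
          by auto
        then have "fst p = a" "p \<in> Sigma D (derived_component D t)"
          using *(2) sets ps(1) by auto
        then have "x \<in> derived_component D t a"
          unfolding \<open>x = snd p\<close> by (elim SigmaE) simp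
        then show "x \<in> C a"
          by (rule derived_component_component[OF D(1) *(1)])
      qed
      then have "comm f (map snd qs) \<in> F'"
        using nil[of f a "map snd qs"] GF that(1) * by auto
      then have "comm (comm f (map snd qs)) (map snd rs) \<in> F'"
        by - (rule comm_invariant[of F' V, OF F'V], use V' in auto)
      then show "comm f (map snd (qs @ rs)) \<in> G (Suc j)"
        using G_sub by auto
    qed
    then show ?thesis
      using ps by simp
  qed
  have "comm f xs \<in> G j" if "set xs \<subseteq> V" "length xs = N * j" for xs j
    using that
  proof (induction j arbitrary: xs)
    case 0
    then show ?case
      using G_comm[of f "[]"] f by simp
  next
    case (Suc j)
    have "comm f (take (N * j) xs) \<in> G j"
      using Suc.prems set_take_subset[of "N * j" xs] by (intro Suc.IH) auto
    then have "comm (comm f (take (N * j) xs)) (drop (N * j) xs) \<in> G (Suc j)"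
      using Suc.prems set_drop_subset[of "N * j" xs] by (intro descend) auto
    then show ?case
      by (metis append_take_drop_id foldl_append)
  qed
  then have "comm f xs \<in> G m"
    using f by (simp add: V_def N_def)
  then show ?thesis
    unfolding G_def
    by (rule aspan_least[OF F(2), rotated]) (use Y[folded Y_def] in auto)
qed

text \<open>
  From the trivial end of the derived series upwards, each term multiplies the length by the same
  factor.
\<close>

lemma solvable_imp_nilpotent_action:
  assumes D: "D \<subseteq> carrier A" "finite D"
    and F: "addsub F" "addsub F'" "F' \<subseteq> F"
    and inv: "\<And>f a x. \<lbrakk>f \<in> F; a \<in> D; x \<in> C a\<rbrakk> \<Longrightarrow> f \<bullet> x \<in> F" "\<And>f a x. \<lbrakk>f \<in> F'; a \<in> D; x \<in> C a\<rbrakk> \<Longrightarrow> f \<bullet> x \<in> F'"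
    and out: "\<And>f a b x y. \<lbrakk>f \<in> F; a \<in> D; b \<in> D; a \<oplus>\<^bsub>A\<^esub> b \<notin> D; x \<in> C a; y \<in> C b\<rbrakk> \<Longrightarrow> f \<bullet> (x \<bullet> y) \<in> F'"
    and nil: "\<And>f a xs. \<lbrakk>f \<in> F; a \<in> D; set xs \<subseteq> C a; length xs = k\<rbrakk> \<Longrightarrow> comm f xs \<in> F'"
    and s: "\<And>f a x. \<lbrakk>f \<in> F; a \<in> D; x \<in> derived_component D s a\<rbrakk> \<Longrightarrow> f \<bullet> x \<in> F'"
    and f: "f \<in> F" "set xs \<subseteq> (\<Union>a\<in>D. C a)" "length xs = Suc (card D * k) ^ s"
  shows "comm f xs \<in> F'"
proof -
  have "comm f xs \<in> F'"
    if "j \<le> s" "f \<in> F" "set xs \<subseteq> (\<Union>a\<in>D. derived_component D (s - j) a)" "length xs = Suc (card D * k) ^ j" for j f xs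
    using that
  proof (induction j arbitrary: f xs)
    case 0
    then obtain x where "xs = [x]"
      by (auto simp: length_Suc_conv)
    then show ?case
      using s 0 by auto
  next
    case (Suc j)
    have eq: "Suc (s - Suc j) = s - j"
      using Suc.prems by simp
    show ?case
    proof (rule nilpotent_action_step[OF D F inv out nil])
      fix f xs
      assume "f \<in> F" "set xs \<subseteq> (\<Union>a\<in>D. derived_component D (Suc (s - Suc j)) a)" "length xs = Suc (card D * k) ^ j"
      then show "comm f xs \<in> F'"
        unfolding eq using Suc.IH Suc.prems(1) by simp
    qed (use Suc.prems in auto)
  qed
  from this[of s f xs] f show ?thesis
    by simp
qed

end

section \<open>Finitely many nilpotent components\<close>

text \<open>
  Among the subgroups that do not contain \<open>D\<close>, choose \<open>S\<close> such that
  \<open>D \<inter> S\<close> is as large as possible, and \<open>x \<in> D - S\<close>. By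
  maximality, \<open>D\<close> lies in the subgroup generated by \<open>S\<close> and
  \<open>x\<close>, so modulo \<open>S\<close> its elements are multiples of \<open>x\<close>. The
  multipliers are well defined modulo the order \<open>n\<close> of \<open>x\<close> modulo
  \<open>S\<close>, or modulo 2 if this order is infinite.
\<close>

lemma (in abelian_group) ex_residue_map:
  assumes D: "finite D" "D \<subseteq> carrier G" "\<not> D \<subseteq> {\<zero>}"
  obtains n :: nat and r :: "'a \<Rightarrow> nat" where
    "0 < n" "\<And>a. a \<in> D \<Longrightarrow> r a < n"
    "\<And>a b. \<lbrakk>a \<in> D; b \<in> D; a \<oplus> b \<in> D\<rbrakk> \<Longrightarrow> r (a \<oplus> b) = (r a + r b) mod n"
    "\<exists>a\<in>D. r a \<noteq> 0"
proof -
  define P where "P S \<longleftrightarrow> subgroup S (add_monoid G) \<and> \<not> D \<subseteq> S" for S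
  have "P {\<zero>}"
    using D(3) add.triv_subgroup by (simp add: P_def)
  moreover have "\<forall>S. P S \<longrightarrow> card (D \<inter> S) < Suc (card D)"
    using D(1) by (auto simp: less_Suc_eq_le intro: card_mono)
  ultimately obtain S where S: "P S" "\<And>T. P T \<Longrightarrow> card (D \<inter> T) \<le> card (D \<inter> S)"
    using ex_has_greatest_nat[of P "{\<zero>}" "\<lambda>S. card (D \<inter> S)" "Suc (card D)"] by auto
  have S_sub: "subgroup S (add_monoid G)"
    using S(1) by (simp add: P_def)
  have S_closed: "a \<in> carrier G" "\<zero> \<in> S" "\<lbrakk>a \<in> S; b \<in> S\<rbrakk> \<Longrightarrow> a \<oplus> b \<in> S" "\<ominus> a \<in> S" if "a \<in> S" for a b
    using that subgroup.mem_carrier[OF S_sub] subgroup.one_closed[OF S_sub]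
      subgroup.m_closed[OF S_sub] subgroup.m_inv_closed[OF S_sub] by (auto simp: a_inv_def)
  have S_zero: "\<zero> \<in> S"
    using subgroup.one_closed[OF S_sub] by simp
  obtain x where x: "x \<in> D" "x \<notin> S" "x \<in> carrier G"
    using S(1) D(2) by (auto simp: P_def)
  define T where "T = {a \<in> carrier G. \<exists>i::int. a \<oplus> [i] \<cdot> x \<in> S}"
  have pow_add: "[(i + j)] \<cdot> x = [i] \<cdot> x \<oplus> [j] \<cdot> x" for i j :: int
    using x(3) by (rule add.int_pow_mult)
  have pow_neg: "[(- i)] \<cdot> x = \<ominus> ([i] \<cdot> x)" for i :: int
    using x(3) by (rule add.int_pow_neg)
  have pow_closed: "[i] \<cdot> x \<in> carrier G" for i :: int
    using x(3) by simp
  have pow_zero: "[(0::int)] \<cdot> x = \<zero>"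
    using pow_add[of 0 0] pow_closed[of 0] by (simp add: add.l_cancel_one')
  have "D \<subseteq> T"
  proof (rule ccontr)
    assume nD: "\<not> D \<subseteq> T"
    have "subgroup T (add_monoid G)"
    proof (rule add.subgroupI)
      show "T \<subseteq> carrier G"
        by (auto simp: T_def)
      have "\<zero> \<oplus> [(0::int)] \<cdot> x \<in> S"
        using S_zero by (simp add: pow_zero)
      then have "\<zero> \<in> T"
        unfolding T_def by blast
      then show "T \<noteq> {}"
        by blast
      show "\<ominus> a \<in> T" if "a \<in> T" for a
      proof -
        obtain i :: int where i: "a \<in> carrier G" "a \<oplus> [i] \<cdot> x \<in> S"
          using \<open>a \<in> T\<close> unfolding T_def by blast
        have "\<ominus> a \<oplus> [(- i)] \<cdot> x = \<ominus> (a \<oplus> [i] \<cdot> x)"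
          using i(1) pow_closed by (simp add: pow_neg minus_add)
        then have "\<ominus> a \<oplus> [(- i)] \<cdot> x \<in> S"
          using S_closed(4)[OF i(2)] by simp
        then show ?thesis
          using i(1) unfolding T_def by blast
      qed
      show "a \<oplus> b \<in> T" if "a \<in> T" "b \<in> T" for a b
      proof -
        obtain i j :: int where ij: "a \<in> carrier G" "a \<oplus> [i] \<cdot> x \<in> S" "b \<in> carrier G" "b \<oplus> [j] \<cdot> x \<in> S"
          using \<open>a \<in> T\<close> \<open>b \<in> T\<close> unfolding T_def by blast
        have "(a \<oplus> b) \<oplus> [(i + j)] \<cdot> x = (a \<oplus> [i] \<cdot> x) \<oplus> (b \<oplus> [j] \<cdot> x)"
          using ij pow_closed by (simp add: pow_add a_ac)
        then have "(a \<oplus> b) \<oplus> [(i + j)] \<cdot> x \<in> S"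
          using S_closed(3)[OF ij(2) ij(2,4)] by simp
        then show ?thesis
          using ij unfolding T_def by blast
      qed
    qed
    then have "P T"
      using nD by (simp add: P_def)
    moreover have "card (D \<inter> S) < card (D \<inter> T)"
    proof (rule psubset_card_mono)
      have "a \<in> T" if "a \<in> S" for a
      proof -
        have "a \<oplus> [(0::int)] \<cdot> x \<in> S"
          using that S_closed(1) by (simp add: pow_zero)
        then show ?thesis
          using S_closed(1)[OF that] unfolding T_def by blast
      qed
      moreover have "x \<in> T"
      proof -
        have "x \<oplus> [(- 1::int)] \<cdot> x \<in> S"
          using x(3) S_zero pow_neg[of 1] by (simp add: r_neg)
        then show ?thesis
          using x(3) unfolding T_def by blast
      qed
      ultimately show "D \<inter> S \<subset> D \<inter> T"
        using x by blast
    qed (use D in simp)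
    ultimately show False
      using S(2)[of T] by simp
  qed
  define I where "I = {i::int. [i] \<cdot> x \<in> S}"
  have I_add: "i + j \<in> I" if "i \<in> I" "j \<in> I" for i j
    using that S_closed(3) by (simp add: I_def pow_add)
  have I_neg: "- i \<in> I" if "i \<in> I" for i
    using that S_closed(4) by (simp add: I_def pow_neg)
  have I_diff: "i - j \<in> I" if "i \<in> I" "j \<in> I" for i j
    using I_add[OF that(1) I_neg[OF that(2)]] by simp
  have I1: "1 \<notin> I"
    using x by (simp add: I_def)
  have "\<exists>n::nat. 2 \<le> n \<and> (\<forall>i\<in>I. int n dvd i)"
  proof (cases "\<exists>n::nat. 0 < n \<and> int n \<in> I")
    case True
    define n where "n = (LEAST n::nat. 0 < n \<and> int n \<in> I)"
    have n: "0 < n" "int n \<in> I"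
      using LeastI_ex[OF True] by (simp_all add: n_def)
    have mult: "int m * int n \<in> I" for m :: nat
    proof (induction m)
      case 0
      then show ?case
        using I_diff[OF n(2) n(2)] by simp
    next
      case (Suc m)
      then show ?case
        using I_add[OF n(2)] by (simp add: distrib_right)
    qed
    have zmult: "m * int n \<in> I" for m :: int
      using mult[of "nat m"] I_neg[OF mult[of "nat (- m)"]] by (cases "0 \<le> m") auto
    have "int n dvd i" if "i \<in> I" for i
    proof -
      have "i mod int n \<in> I"
        using I_diff[OF that zmult[of "i div int n"]] by (simp add: minus_div_mult_eq_mod)
      then have "int (nat (i mod int n)) \<in> I"
        using n by simp
      moreover have "nat (i mod int n) < n"
        using n(1) by (simp add: nat_less_iff)
      ultimately have "nat (i mod int n) = 0"
        using not_less_Least[of "nat (i mod int n)" "\<lambda>n. 0 < n \<and> int n \<in> I"] n_def by auto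
      then have "i mod int n = 0"
        using n(1) pos_mod_sign[of "int n" i] by linarith
      then show ?thesis
        by (rule mod_0_imp_dvd)
    qed
    moreover have "n \<noteq> 1"
      using n(2) I1 by auto
    ultimately show ?thesis
      using n(1) by (intro exI[of _ n]) auto
  next
    case False
    have "i = 0" if "i \<in> I" for i
    proof (rule ccontr)
      assume "i \<noteq> 0"
      then have "0 < nat \<bar>i\<bar>" "int (nat \<bar>i\<bar>) \<in> I"
        using that I_neg[OF that] by (auto simp: abs_if)
      then show False
        using False by blast
    qed
    then show ?thesis
      by (intro exI[of _ 2]) auto
  qed
  then obtain n :: nat where n: "2 \<le> n" "\<And>i. i \<in> I \<Longrightarrow> int n dvd i"
    by blast
  define e where "e a = (SOME i::int. a \<oplus> [i] \<cdot> x \<in> S)" for a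
  define r where "r a = nat (e a mod int n)" for a
  have e: "a \<oplus> [e a] \<cdot> x \<in> S" if "a \<in> D" for a
    unfolding e_def by (rule someI_ex) (use \<open>D \<subseteq> T\<close> that in \<open>auto simp: T_def\<close>)
  have r_int: "int (r a) = e a mod int n" for a
    using n(1) by (simp add: r_def)
  have e_unique: "e a mod int n = i mod int n" if "a \<in> D" "a \<oplus> [i] \<cdot> x \<in> S" for a i
  proof -
    have ac: "a \<in> carrier G"
      using that D by blast
    have "(a \<oplus> [e a] \<cdot> x) \<oplus> \<ominus> (a \<oplus> [i] \<cdot> x) = [(e a + - i)] \<cdot> x"
      unfolding pow_add pow_neg using ac pow_closed[of "e a"] pow_closed[of i]
      by (simp add: minus_add a_ac r_neg1 r_neg2)
    then have "e a + - i \<in> I"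
      using S_closed(3)[OF e[OF that(1)] e[OF that(1)] S_closed(4)[OF that(2)]] by (simp add: I_def)
    then show ?thesis
      using n(2) by (simp add: mod_eq_dvd_iff)
  qed
  show thesis
  proof (rule that[of n r])
    show "0 < n"
      using n by simp
    show "r a < n" if "a \<in> D" for a
      using n(1) by (simp add: r_def nat_less_iff)
    show "r (a \<oplus> b) = (r a + r b) mod n" if "a \<in> D" "b \<in> D" "a \<oplus> b \<in> D" for a b
    proof -
      have c: "a \<in> carrier G" "b \<in> carrier G"
        using that D by auto
      have "(a \<oplus> b) \<oplus> [(e a + e b)] \<cdot> x = (a \<oplus> [e a] \<cdot> x) \<oplus> (b \<oplus> [e b] \<cdot> x)"
        using c pow_closed by (simp add: pow_add a_ac)
      then have "(a \<oplus> b) \<oplus> [(e a + e b)] \<cdot> x \<in> S"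
        using S_closed(3)[OF e e e] that by simp
      then have "int (r (a \<oplus> b)) = (e a + e b) mod int n"
        using e_unique[OF that(3)] r_int by simp
      also have "\<dots> = int ((r a + r b) mod n)"
        by (simp add: r_int zmod_int mod_add_eq)
      finally show ?thesis
        by simp
    qed
    have "x \<oplus> [(- 1::int)] \<cdot> x \<in> S"
      using x(3) S_zero pow_neg[of 1] by (simp add: r_neg)
    then have "e x mod int n = (- 1) mod int n"
      using e_unique x by blast
    also have "\<dots> \<noteq> 0"
      using n(1) by (simp add: zmod_minus1)
    finally show "\<exists>a\<in>D. r a \<noteq> 0"
      using x(1) r_int[of x] by (intro bexI[of _ x]) auto
  qed
qed


context graded_lie_ring
begin

lemma nilpotent_action:
  assumes D: "D \<subseteq> carrier A" "finite D" "card D \<le> d"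
    and F: "addsub F" "addsub F'" "F' \<subseteq> F"
    and inv: "\<And>f a x. \<lbrakk>f \<in> F; a \<in> D; x \<in> C a\<rbrakk> \<Longrightarrow> f \<bullet> x \<in> F" "\<And>f a x. \<lbrakk>f \<in> F'; a \<in> D; x \<in> C a\<rbrakk> \<Longrightarrow> f \<bullet> x \<in> F'"
    and out: "\<And>f a b x y. \<lbrakk>f \<in> F; a \<in> D; b \<in> D; a \<oplus>\<^bsub>A\<^esub> b \<notin> D; x \<in> C a; y \<in> C b\<rbrakk> \<Longrightarrow> f \<bullet> (x \<bullet> y) \<in> F'"
    and nil: "\<And>f a xs. \<lbrakk>f \<in> F; a \<in> D; set xs \<subseteq> C a; length xs = k\<rbrakk> \<Longrightarrow> comm f xs \<in> F'"
    and s: "\<And>f a x. \<lbrakk>f \<in> F; a \<in> D; x \<in> derived_component D s a\<rbrakk> \<Longrightarrow> f \<bullet> x \<in> F'"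
    and f: "f \<in> F" "set xs \<subseteq> (\<Union>a\<in>D. C a)" "Suc (d * k) ^ s \<le> length xs"
  shows "comm f xs \<in> F'"
proof -
  define N where "N = Suc (card D * k) ^ s"
  have "N \<le> Suc (d * k) ^ s"
    unfolding N_def using D(3) by (intro power_mono) auto
  then have N: "length (take N xs) = N"
    using f(3) by simp
  have sub: "set (take N xs) \<subseteq> (\<Union>a\<in>D. C a)" "set (drop N xs) \<subseteq> (\<Union>a\<in>D. C a)"
    using set_take_subset[of N xs] set_drop_subset[of N xs] f(2) by auto
  have "comm f (take N xs) \<in> F'"
    by (rule solvable_imp_nilpotent_action[OF D(1,2) F inv out nil s f(1) sub(1)]) (use N in \<open>simp_all add: N_def\<close>)
  then have "comm (comm f (take N xs)) (drop N xs) \<in> F'"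
    by - (rule comm_invariant[of F' "\<Union>a\<in>D. C a"], use inv(2) sub(2) in auto)
  then show ?thesis
    by (metis append_take_drop_id foldl_append)
qed

end

text \<open>
  The recursion follows the proof below: the degrees of residue 0 are fewer than all degrees and
  act nilpotently by induction, and Kreknin's theorem is applied with the resulting number of
  letters.
\<close>

primrec support_solv_bound :: "nat \<Rightarrow> nat \<Rightarrow> nat" where
  "support_solv_bound k 0 = 0"
| "support_solv_bound k (Suc d) =
     lie_ring.solv_bound (max k (Suc (d * k) ^ support_solv_bound k d)) (Suc d)"

locale nil_graded_lie_ring = graded_lie_ring L br A C
  for L :: "('l, 'm) ring_scheme" (structure) and br :: "'l \<Rightarrow> 'l \<Rightarrow> 'l"  (infixl \<open>\<bullet>\<close> 70)
    and A :: "('a, 'n) ring_scheme" and C :: "'a \<Rightarrow> 'l set" +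
  fixes k :: nat
  assumes component_nil: "\<lbrakk>a \<in> carrier A; x \<in> carrier L; set xs \<subseteq> C a; length xs = k\<rbrakk> \<Longrightarrow> comm x xs = \<zero>"
begin

text \<open>
  The special case of the adjoint action on \<open>L\<close> modulo \<open>K\<close>.
\<close>

lemma nilpotent_mod_ideal:
  assumes K: "ideal_of K" and D: "D \<subseteq> carrier A" "finite D" "card D \<le> d"
    and out: "\<And>a b x y. \<lbrakk>a \<in> D; b \<in> D; a \<oplus>\<^bsub>A\<^esub> b \<notin> D; x \<in> C a; y \<in> C b\<rbrakk> \<Longrightarrow> x \<bullet> y \<in> K"
    and s: "\<And>a. a \<in> D \<Longrightarrow> derived_component D s a \<subseteq> K"
    and x: "x \<in> carrier L" "set xs \<subseteq> (\<Union>a\<in>D. C a)" "Suc (d * k) ^ s \<le> length xs"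
  shows "comm x xs \<in> K"
proof (rule nilpotent_action[OF D addsub_carrier ideal_ofD(1)[OF K] _ _ _ _ _ _ x])
  have Dc: "x \<in> carrier L" if "a \<in> D" "x \<in> C a" for a x
    using that D component_carrier by blast
  show "K \<subseteq> carrier L"
    using ideal_ofD(2)[OF K] by blast
  show "f \<bullet> x \<in> carrier L" if "f \<in> carrier L" "a \<in> D" "x \<in> C a" for f a x
    using that Dc by blast
  show "f \<bullet> x \<in> K" if "f \<in> K" "a \<in> D" "x \<in> C a" for f a x
    using that Dc ideal_ofD(3)[OF K] by blast
  show "f \<bullet> (x \<bullet> y) \<in> K" if "f \<in> carrier L" "a \<in> D" "b \<in> D" "a \<oplus>\<^bsub>A\<^esub> b \<notin> D" "x \<in> C a" "y \<in> C b" for f a b x y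
    using ideal_ofD(4)[OF K out] that by blast
  show "comm f xs \<in> K" if "f \<in> carrier L" "a \<in> D" "set xs \<subseteq> C a" "length xs = k" for f a xs
    using component_nil[OF _ that(1,3,4)] D that(2) addsubD(2)[OF ideal_ofD(1)[OF K]] by auto
  show "f \<bullet> x \<in> K" if "f \<in> carrier L" "a \<in> D" "x \<in> derived_component D s a" for f a x
    using ideal_ofD(4)[OF K] s that by blast
qed

text \<open>
  The residues cut \<open>D\<close> down to the proper subset \<open>E\<close> of degrees of
  residue 0, which is closed under addition within \<open>D\<close>. By induction \<open>E\<close>
  acts nilpotently modulo \<open>K\<close>, and Kreknin's theorem applies to the coarser grading
  by residues. If \<open>D\<close> has no nonzero element, a single residue is used, and
  nilpotency of the component of degree 0 is the assumption on \<open>L\<close>.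
\<close>

theorem finite_support_solvable:
  assumes K: "ideal_of K" and D: "D \<subseteq> carrier A" "finite D" "card D \<le> d"
    and out: "\<And>a b x y. \<lbrakk>a \<in> D; b \<in> D; a \<oplus>\<^bsub>A\<^esub> b \<notin> D; x \<in> C a; y \<in> C b\<rbrakk> \<Longrightarrow> x \<bullet> y \<in> K"
    and a: "a \<in> D"
  shows "derived_component D (support_solv_bound k d) a \<subseteq> K"
  using D out a
proof (induction d arbitrary: D a)
  case 0
  then show ?case
    by simp
next
  case (Suc d)
  note D = Suc.prems(1-3) and out = Suc.prems(4)
  define m where "m = max k (Suc (d * k) ^ support_solv_bound k d)"
  have K0: "\<zero> \<in> K"
    using ideal_ofD(1)[OF K] by (rule addsubD)
  have Dc: "C a \<subseteq> carrier L" if "a \<in> D" for a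
    using that D component_carrier by blast
  have ext: "comm x xs \<in> K"
    if "comm x (take j xs) \<in> K" "x \<in> carrier L" "set xs \<subseteq> carrier L" for x xs j
  proof -
    have "comm (comm x (take j xs)) (drop j xs) \<in> K"
      using comm_ideal[OF K that(1)] that(3) set_drop_subset[of j xs] by blast
    then show ?thesis
      by (metis append_take_drop_id foldl_append)
  qed
  obtain n :: nat and r where r: "0 < n" "\<And>a. a \<in> D \<Longrightarrow> r a < n"
      "\<And>a b. \<lbrakk>a \<in> D; b \<in> D; a \<oplus>\<^bsub>A\<^esub> b \<in> D\<rbrakk> \<Longrightarrow> r (a \<oplus>\<^bsub>A\<^esub> b) = (r a + r b) mod n"
      "\<And>x xs. \<lbrakk>x \<in> carrier L; set xs \<subseteq> (\<Union>a\<in>{a \<in> D. r a = 0}. C a); length xs = m\<rbrakk> \<Longrightarrow> comm x xs \<in> K"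
  proof (cases "D \<subseteq> {\<zero>\<^bsub>A\<^esub>}")
    case True
    have "comm x xs \<in> K" if x: "x \<in> carrier L" "set xs \<subseteq> (\<Union>a\<in>D. C a)" "length xs = m" for x xs
    proof (rule ext[where j = k])
      have xs: "set xs \<subseteq> C \<zero>\<^bsub>A\<^esub>"
        using that True by blast
      then have "comm x (take k xs) = \<zero>"
        using that set_take_subset[of k xs] by (intro component_nil[of "\<zero>\<^bsub>A\<^esub>"]) (auto simp: m_def)
      then show "comm x (take k xs) \<in> K"
        using K0 by simp
      show "set xs \<subseteq> carrier L"
        using xs component_carrier[of "\<zero>\<^bsub>A\<^esub>"] by auto
    qed fact
    then show ?thesis
      by (intro that[of 1 "\<lambda>_. 0"]) auto
  next
    case False
    obtain n :: nat and r :: "'a \<Rightarrow> nat" where r: "0 < n" "\<And>a. a \<in> D \<Longrightarrow> r a < n"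
      "\<And>a b. \<lbrakk>a \<in> D; b \<in> D; a \<oplus>\<^bsub>A\<^esub> b \<in> D\<rbrakk> \<Longrightarrow> r (a \<oplus>\<^bsub>A\<^esub> b) = (r a + r b) mod n"
      "\<exists>a\<in>D. r a \<noteq> 0"
    proof (rule A.ex_residue_map[OF D(2,1) False])
      fix n :: nat and r :: "'a \<Rightarrow> nat"
      assume "0 < n" "\<And>a. a \<in> D \<Longrightarrow> r a < n"
        "\<And>a b. \<lbrakk>a \<in> D; b \<in> D; a \<oplus>\<^bsub>A\<^esub> b \<in> D\<rbrakk> \<Longrightarrow> r (a \<oplus>\<^bsub>A\<^esub> b) = (r a + r b) mod n"
        "\<exists>a\<in>D. r a \<noteq> 0"
      then show thesis
        by (rule that)
    qed
    define E where "E = {a \<in> D. r a = 0}"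
    have E: "E \<subseteq> carrier A" "finite E" "E \<subseteq> D"
      using D by (auto simp: E_def)
    obtain a where "a \<in> D" "r a \<noteq> 0"
      using r(4) by (rule bexE)
    then have "a \<in> D" "a \<notin> E"
      by (auto simp: E_def)
    then have "E \<subset> D"
      using E(3) by blast
    then have "card E < card D"
      by (rule psubset_card_mono[OF D(2)])
    then have Ed: "card E \<le> d"
      using D(3) by linarith
    have Eout: "x \<bullet> y \<in> K" if "a \<in> E" "b \<in> E" "a \<oplus>\<^bsub>A\<^esub> b \<notin> E" "x \<in> C a" "y \<in> C b" for a b x y
    proof (rule out[OF _ _ _ that(4,5)])
      show "a \<oplus>\<^bsub>A\<^esub> b \<notin> D"
        using that r(3)[of a b] by (auto simp: E_def)
    qed (use that E in auto)
    have "comm x xs \<in> K" if "x \<in> carrier L" "set xs \<subseteq> (\<Union>a\<in>E. C a)" "length xs = m" for x xs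
    proof (rule nilpotent_mod_ideal[OF K E(1,2) Ed _ _ that(1,2)])
      show "derived_component E (support_solv_bound k d) a \<subseteq> K" if "a \<in> E" for a
        by (rule Suc.IH[OF E(1,2) Ed _ that]) (rule Eout)
      show "Suc (d * k) ^ support_solv_bound k d \<le> length xs"
        by (simp add: that(3) m_def)
    qed (rule Eout)
    then show ?thesis
      unfolding E_def by (intro that[of n r] r)
  qed
  \<comment> \<open>the coarser grading by residues, to which Kreknin's theorem is applied\<close>
  define M where "M i = aspan (K \<union> (\<Union>a\<in>{a \<in> D. r a = i}. C a))" for i
  have KM: "x \<in> M i" if "x \<in> K" for x i
    unfolding M_def using that ideal_ofD(2)[OF K] by (intro aspan_base) auto
  have CM: "x \<in> M (r a)" if "a \<in> D" "x \<in> C a" for x a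
    unfolding M_def using that Dc by (intro aspan_base) auto
  have M: "zgraded K n M"
    unfolding zgraded_def
  proof (intro conjI allI impI ballI)
    fix i j x y assume ij: "i < n" "j < n" and xy: "x \<in> M i" "y \<in> M j"
    have sub: "addsub (M ((i + j) mod n))"
      by (simp add: M_def addsub_aspan)
    show "x \<bullet> y \<in> M ((i + j) mod n)"
    proof (rule br_aspan_aspan[OF sub _ xy[unfolded M_def]])
      fix x y assume x: "x \<in> K \<union> (\<Union>a\<in>{a \<in> D. r a = i}. C a)" "x \<in> carrier L"
        and y: "y \<in> K \<union> (\<Union>a\<in>{a \<in> D. r a = j}. C a)" "y \<in> carrier L"
      show "x \<bullet> y \<in> M ((i + j) mod n)"
      proof (cases "x \<in> K \<or> y \<in> K")
        case True
        then show ?thesis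
          using ideal_ofD(3,4)[OF K] x(2) y(2) KM by blast
      next
        case False
        then obtain a b where ab: "a \<in> D" "b \<in> D" "r a = i" "r b = j" "x \<in> C a" "y \<in> C b"
          using x y by blast
        show ?thesis
        proof (cases "a \<oplus>\<^bsub>A\<^esub> b \<in> D")
          case True
          have "x \<bullet> y \<in> C (a \<oplus>\<^bsub>A\<^esub> b)"
            using ab D by (intro component_br) auto
          then show ?thesis
            using CM[OF True] r(3)[OF ab(1,2) True] ab by simp
        next
          case False
          then show ?thesis
            using out[OF ab(1,2) False ab(5,6)] KM by blast
        qed
      qed
    qed
  next
    fix i assume "i < n"
    show "addsub (M i)"
      by (simp add: M_def addsub_aspan)
    show "K \<subseteq> M i"
      using KM by (rule subsetI)
  qed
  have dM: "derived_component D t a \<subseteq> (zderived K n ^^ t) M (r a)" if "a \<in> D" for t a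
    using that
  proof (induction t arbitrary: a)
    case 0
    then show ?case
      using CM by auto
  next
    case (Suc t)
    note Mt = zgraded_zderived_pow[OF K M, of t]
    have sub: "addsub ((zderived K n ^^ Suc t) M (r a))"
      using zgradedD(1)[OF zgraded_zderived_pow[OF K M]] r(2)[OF Suc.prems] by blast
    show ?case
    proof
      fix x assume "x \<in> derived_component D (Suc t) a"
      then have x: "x \<in> aspan {x \<bullet> y |u v x y. u \<in> D \<and> v \<in> D \<and> u \<oplus>\<^bsub>A\<^esub> v = a \<and> x \<in> derived_component D t u \<and> y \<in> derived_component D t v}"
        by simp
      show "x \<in> (zderived K n ^^ Suc t) M (r a)"
      proof (rule aspan_least[OF sub _ x])
        fix z assume "z \<in> {x \<bullet> y |u v x y. u \<in> D \<and> v \<in> D \<and> u \<oplus>\<^bsub>A\<^esub> v = a \<and> x \<in> derived_component D t u \<and> y \<in> derived_component D t v}"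
        then obtain u v x y where *: "z = x \<bullet> y" "u \<in> D" "v \<in> D" "u \<oplus>\<^bsub>A\<^esub> v = a" "x \<in> derived_component D t u" "y \<in> derived_component D t v"
          by blast
        have "x \<bullet> y \<in> zderived K n ((zderived K n ^^ t) M) ((r u + r v) mod n)"
          using Suc.IH * r(2) by (intro br_in_zderived[OF Mt]) auto
        then show "z \<in> (zderived K n ^^ Suc t) M (r a)"
          using r(3)[OF *(2,3)] * Suc.prems by simp
      qed
    qed
  qed
  have "{i. i < n \<and> \<not> M i \<subseteq> K} \<subseteq> r ` D"
  proof
    fix i assume "i \<in> {i. i < n \<and> \<not> M i \<subseteq> K}"
    then have "\<not> M i \<subseteq> K"
      by blast
    then obtain x where "x \<in> M i" "x \<notin> K"
      by blast
    have "{a \<in> D. r a = i} \<noteq> {}"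
    proof
      assume "{a \<in> D. r a = i} = {}"
      then have "x \<in> aspan K"
        using \<open>x \<in> M i\<close> unfolding M_def by (simp del: Collect_empty_eq)
      then have "x \<in> K"
        by (rule aspan_least[OF ideal_ofD(1)[OF K], rotated])
      then show False
        using \<open>x \<notin> K\<close> by contradiction
    qed
    then show "i \<in> r ` D"
      by blast
  qed
  then have "card {i. i < n \<and> \<not> M i \<subseteq> K} \<le> card (r ` D)"
    using D(2) by (intro card_mono) auto
  also have "\<dots> \<le> Suc d"
    using card_image_le[OF D(2), of r] D(3) by linarith
  finally have e: "card {i. i < n \<and> \<not> M i \<subseteq> K} \<le> Suc d" .
  show ?case
  proof
    fix x assume "x \<in> derived_component D (support_solv_bound k (Suc d)) a"
    then have x: "x \<in> (zderived K n ^^ solv_bound m (Suc d)) M (r a)"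
      using dM[OF Suc.prems(5)] by (auto simp: m_def)
    show "x \<in> K"
    proof (rule kreknin[OF K r(1) M _ e r(2)[OF Suc.prems(5)] x])
      fix i x ws assume *: "i < n" "x \<in> M i" "set ws \<subseteq> M 0" "length ws = m"
      have V: "(\<Union>a\<in>{a \<in> D. r a = 0}. C a) \<subseteq> carrier L"
        using Dc by blast
      show "comm x ws \<in> K"
      proof (rule comm_aspan_letters[OF addsub_carrier ideal_ofD(1)[OF K] _ _ _ _ _ _ _ _ *(3)[unfolded M_def] *(4)])
        show "x \<in> carrier L"
          using zgradedD(3)[OF M *(1,2)] .
      qed (use V ideal_ofD[OF K] r(4) in blast)+
    qed
  qed
qed

end

section \<open>Elements centralised by almost all components\<close>

text \<open>
  Here \<open>\<Sum>i\<le>d * k. d ^ i\<close> counts the sums of at most \<open>d * k\<close>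
  degrees from a set of size \<open>d\<close>, and \<open>d'\<close> bounds the number of
  differences of such sums.
\<close>

definition absorption_bound :: "nat \<Rightarrow> nat \<Rightarrow> nat" where
  "absorption_bound k d = (let d' = (\<Sum>i\<le>d * k. d ^ i)\<^sup>2 in Suc (d' * k) ^ support_solv_bound k d')"

context nil_graded_lie_ring
begin

definition degree_sum :: "'a list \<Rightarrow> 'a \<Rightarrow> 'a" where
  "degree_sum ds e = fold (add A) ds e"

lemma degree_sum_simps [simp]:
  "degree_sum [] e = e" "degree_sum (d # ds) e = degree_sum ds (d \<oplus>\<^bsub>A\<^esub> e)"
  "degree_sum (ds @ ds') e = degree_sum ds' (degree_sum ds e)"
  by (simp_all add: degree_sum_def)

lemma degree_sum_closed: "\<lbrakk>set ds \<subseteq> carrier A; e \<in> carrier A\<rbrakk> \<Longrightarrow> degree_sum ds e \<in> carrier A"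
  by (induction ds arbitrary: e) auto

lemma degree_sum_permute:
  assumes "mset ds = mset ds'" "set ds \<subseteq> carrier A" "e \<in> carrier A"
  shows "degree_sum ds e = degree_sum ds' e"
  unfolding degree_sum_def
  by (rule fold_permuted_eq[where P = "\<lambda>e. e \<in> carrier A"])
    (use assms in \<open>auto intro!: A.a_lcomm\<close>)

lemma comm_component:
  assumes "u \<in> C g" "g \<in> carrier A" "set ps \<subseteq> Sigma (carrier A) C"
  shows "comm u (map snd ps) \<in> C (degree_sum (map fst ps) g)"
  using assms
proof (induction ps arbitrary: u g)
  case (Cons p ps)
  obtain a x where p: "p = (a, x)" "a \<in> carrier A" "x \<in> C a"
    using Cons.prems(3) by (cases p) auto
  have "u \<bullet> x \<in> C (a \<oplus>\<^bsub>A\<^esub> g)"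
    using component_br[OF Cons.prems(2) p(2) Cons.prems(1) p(3)] A.a_comm[OF p(2) Cons.prems(2)] by simp
  then have "comm (u \<bullet> x) (map snd ps) \<in> C (degree_sum (map fst ps) (a \<oplus>\<^bsub>A\<^esub> g))"
    using Cons.prems p(2) by (intro Cons.IH) auto
  then show ?case
    by (simp add: p(1))
qed simp

lemma labelled_carrier: "set ps \<subseteq> Sigma (carrier A) C \<Longrightarrow> snd ` set ps \<subseteq> carrier L"
proof
  fix x assume "set ps \<subseteq> Sigma (carrier A) C" "x \<in> snd ` set ps"
  then obtain p where "p \<in> Sigma (carrier A) C" "x = snd p"
    by blast
  then show "x \<in> carrier L"
    using component_carrier by (cases p) auto
qed

text \<open>
  Words are shortened without changing their degree: modulo shorter words of the same degree, a
  word that is too long or has a letter of degree outside \<open>D\<close> vanishes. What survives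
  are the words with at most \<open>card D * k\<close> letters, all of degree in \<open>D\<close>,
  and these have other degrees.
\<close>

lemma comm_degree_outside:
  assumes Z: "ideal_of Z" and D: "finite D" "D \<subseteq> carrier A" and g: "g \<in> carrier A" and u: "u \<in> C g"
    and kill: "\<And>b x. \<lbrakk>b \<in> carrier A; b \<notin> D; x \<in> C b\<rbrakk> \<Longrightarrow> u \<bullet> x \<in> Z"
    and ps: "set ps \<subseteq> Sigma (carrier A) C"
    and deg: "degree_sum (map fst ps) g \<notin> (\<lambda>ds. degree_sum ds g) ` {ds. set ds \<subseteq> D \<and> length ds \<le> card D * k}"
  shows "comm u (map snd ps) \<in> Z"
  using ps deg
proof (induction "length ps" arbitrary: ps rule: less_induct)
  case less
  note ps = less.prems(1)
  have Zs: "addsub Z"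
    using ideal_ofD(1)[OF Z] .
  have uc: "u \<in> carrier L"
    using component_carrier g u by blast
  have psc: "snd ` set ps \<subseteq> carrier L"
    using labelled_carrier[OF ps] .
  have swap: "comm u (map snd xs @ (snd p \<bullet> snd q) # map snd zs) \<in> Z"
    if eq: "mset (xs @ p # q # zs) = mset ps" for xs p q zs
  proof -
    let ?pq = "(fst p \<oplus>\<^bsub>A\<^esub> fst q, snd p \<bullet> snd q)"
    have "set (xs @ p # q # zs) \<subseteq> Sigma (carrier A) C"
      using mset_eq_setD[OF eq] ps by simp
    then have sub: "set xs \<subseteq> Sigma (carrier A) C" "set zs \<subseteq> Sigma (carrier A) C"
      "p \<in> Sigma (carrier A) C" "q \<in> Sigma (carrier A) C"
      by auto
    then have pq: "?pq \<in> Sigma (carrier A) C"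
      using component_br by (cases p; cases q) auto
    have cl: "set (map fst xs) \<subseteq> carrier A" "fst p \<in> carrier A" "fst q \<in> carrier A"
      using sub by auto
    have dx: "degree_sum (map fst xs) g \<in> carrier A"
      by (rule degree_sum_closed[OF cl(1) g])
    have "degree_sum (map fst (xs @ ?pq # zs)) g = degree_sum (map fst (xs @ p # q # zs)) g"
      using cl dx by (simp add: A.a_ac)
    also have "\<dots> = degree_sum (map fst ps) g"
    proof (rule degree_sum_permute[OF _ _ g])
      show "mset (map fst (xs @ p # q # zs)) = mset (map fst ps)"
        using eq by (metis mset_map)
      show "set (map fst (xs @ p # q # zs)) \<subseteq> carrier A"
        using sub by auto
    qed
    finally have deg: "degree_sum (map fst (xs @ ?pq # zs)) g = degree_sum (map fst ps) g" .
    have "comm u (map snd (xs @ ?pq # zs)) \<in> Z"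
    proof (rule less.hyps)
      show "length (xs @ ?pq # zs) < length ps"
        using mset_eq_length[OF eq] by simp
      show "set (xs @ ?pq # zs) \<subseteq> Sigma (carrier A) C"
        using sub pq by auto
      show "degree_sum (map fst (xs @ ?pq # zs)) g \<notin> (\<lambda>ds. degree_sum ds g) ` {ds. set ds \<subseteq> D \<and> length ds \<le> card D * k}"
        unfolding deg by (rule less.prems(2))
    qed
    then show ?thesis
      by simp
  qed
  show ?case
  proof (cases "fst ` set ps \<subseteq> D")
    case True
    show ?thesis
    proof (rule comm_collect_letters[OF Zs uc D(1) True _ psc swap])
      show "card D * k < length ps"
      proof (rule ccontr)
        assume "\<not> card D * k < length ps"
        then have "map fst ps \<in> {ds. set ds \<subseteq> D \<and> length ds \<le> card D * k}"
          using True by simp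
        then show False
          using less.prems(2) by (rule notE[OF _ imageI, rotated])
      qed
      fix a qs rs assume *: "a \<in> D" "fst ` set qs \<subseteq> {a}" "length qs = k" "mset (qs @ rs) = mset ps"
      have "set (qs @ rs) \<subseteq> Sigma (carrier A) C"
        using mset_eq_setD[OF *(4)] ps by simp
      then have qs: "set qs \<subseteq> Sigma (carrier A) C" and rs: "set (map snd rs) \<subseteq> carrier L"
        using labelled_carrier[of rs] by auto
      have "set (map snd qs) \<subseteq> C a"
        using qs *(2) by force
      then have "comm u (map snd qs) = \<zero>"
        using * D(2) uc by (intro component_nil[of a]) auto
      then show "comm u (map snd (qs @ rs)) \<in> Z"
        using comm_zero[OF rs] addsubD(2)[OF Zs] by simp
    qed
  next
    case False
    then obtain p where p: "p \<in> set ps" "fst p \<notin> D"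
      by blast
    show ?thesis
    proof (rule comm_permute[OF Zs uc swap psc])
      show "mset (p # remove1 p ps) = mset ps"
        using p(1) by simp
      have "p \<in> Sigma (carrier A) C"
        using p(1) ps by blast
      then have "u \<bullet> snd p \<in> Z"
        using kill p(2) by (cases p) auto
      then have "comm (u \<bullet> snd p) (map snd (remove1 p ps)) \<in> Z"
        by (rule comm_ideal[OF Z]) (use psc set_remove1_subset[of p ps] in auto)
      then show "comm u (map snd (p # remove1 p ps)) \<in> Z"
        by simp
    qed
  qed
qed

text \<open>
  The subgroup \<open>F\<close> generated by \<open>Z\<close> and all commutators that start with
  \<open>u\<close> lives, modulo \<open>Z\<close>, in the finite set \<open>E\<close> of degrees.
  Therefore a component acts nontrivially on \<open>F/Z\<close> only if its degree is a difference
  of elements of \<open>E\<close>, and modulo the kernel \<open>K\<close> of the action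
  \<open>L\<close> has finite support.
\<close>

theorem absorption:
  assumes Z: "ideal_of Z" and D: "finite D" "D \<subseteq> carrier A" "card D \<le> d"
    and g: "g \<in> carrier A" and u: "u \<in> C g"
    and kill: "\<And>b x. \<lbrakk>b \<in> carrier A; b \<notin> D; x \<in> C b\<rbrakk> \<Longrightarrow> u \<bullet> x \<in> Z"
    and xs: "set xs \<subseteq> carrier L" "length xs = absorption_bound k d"
  shows "comm u xs \<in> Z"
proof -
  have Zs: "addsub Z" and Zc: "Z \<subseteq> carrier L"
    using ideal_ofD[OF Z] by auto
  have uc: "u \<in> carrier L"
    using component_carrier g u by blast
  define E where "E = (\<lambda>ds. degree_sum ds g) ` {ds. set ds \<subseteq> D \<and> length ds \<le> card D * k}"
  define D' where "D' = (\<lambda>(e', e). e' \<ominus>\<^bsub>A\<^esub> e) ` (E \<times> E)"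
  have E: "finite E" "E \<subseteq> carrier A"
    using D degree_sum_closed[OF _ g] by (auto simp: E_def finite_lists_length_le)
  have "card E \<le> card {ds. set ds \<subseteq> D \<and> length ds \<le> card D * k}"
    unfolding E_def by (rule card_image_le) (rule finite_lists_length_le[OF D(1)])
  also have "\<dots> = (\<Sum>i\<le>card D * k. card D ^ i)"
    by (rule card_lists_length_le[OF D(1)])
  also have "\<dots> \<le> (\<Sum>i\<le>d * k. d ^ i)"
  proof (rule order_trans)
    show "(\<Sum>i\<le>card D * k. card D ^ i) \<le> (\<Sum>i\<le>card D * k. d ^ i)"
      using D(3) by (intro sum_mono power_mono) auto
    show "(\<Sum>i\<le>card D * k. d ^ i) \<le> (\<Sum>i\<le>d * k. d ^ i)"
      using D(3) by (intro sum_mono2) (auto intro: order_trans)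
  qed
  finally have cE: "card E \<le> (\<Sum>i\<le>d * k. d ^ i)" .
  define d' where "d' = (\<Sum>i\<le>d * k. d ^ i)\<^sup>2"
  have D': "D' \<subseteq> carrier A" "finite D'" "card D' \<le> d'"
  proof -
    show "D' \<subseteq> carrier A" "finite D'"
      using E by (auto simp: D'_def)
    have "card D' \<le> card (E \<times> E)"
      unfolding D'_def using E by (intro card_image_le) auto
    also have "\<dots> \<le> d'"
      using cE by (simp add: d'_def card_cartesian_product power2_eq_square mult_mono)
    finally show "card D' \<le> d'" .
  qed
  define W where "W = {comm u (map snd ps) |ps. set ps \<subseteq> Sigma (carrier A) C}"
  define F where "F = aspan (Z \<union> W)"
  have Fs: "addsub F" "Z \<subseteq> F"
    using Zc by (auto simp: F_def addsub_aspan intro: aspan_base)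
  have W_F: "w \<in> F" if "w \<in> W" for w
  proof -
    obtain ps where ps: "w = comm u (map snd ps)" "set ps \<subseteq> Sigma (carrier A) C"
      using \<open>w \<in> W\<close> unfolding W_def by blast
    then have "w \<in> carrier L"
      using labelled_carrier[OF ps(2)] uc by (auto intro!: comm_closed)
    then show ?thesis
      unfolding F_def using that by (intro aspan_base) auto
  qed
  have WC: "w \<bullet> x \<in> W" if w: "w \<in> W" and b: "b \<in> carrier A" "x \<in> C b" for w b x
  proof -
    obtain ps where ps: "w = comm u (map snd ps)" "set ps \<subseteq> Sigma (carrier A) C"
      using w unfolding W_def by blast
    have "w \<bullet> x = comm u (map snd (ps @ [(b, x)]))" "set (ps @ [(b, x)]) \<subseteq> Sigma (carrier A) C"
      using ps b by auto
    then show ?thesis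
      unfolding W_def by blast
  qed
  have FC: "f \<bullet> x \<in> F" if f: "f \<in> F" and b: "b \<in> carrier A" "x \<in> C b" for f b x
  proof (rule br_aspan_left[OF Fs(1) _ f[unfolded F_def]])
    show xc: "x \<in> carrier L"
      using b component_carrier by blast
    show "w \<bullet> x \<in> F" if "w \<in> Z \<union> W" for w
      using that WC[OF _ b] W_F ideal_ofD(3)[OF Z _ xc] Fs(2) by blast
  qed
  have FL: "f \<bullet> y \<in> F" if "f \<in> F" "y \<in> carrier L" for f y
  proof (rule br_aspan_right[OF Fs(1)])
    show "y \<in> aspan (\<Union>a\<in>carrier A. C a)"
      using that component_span by blast
    show "f \<in> carrier L"
      using that Fs(1) addsubD(1) by blast
    show "f \<bullet> x \<in> F" if "x \<in> (\<Union>a\<in>carrier A. C a)" for x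
      using that \<open>f \<in> F\<close> FC by blast
  qed
  have FZ: "f \<bullet> x \<in> Z" if f: "f \<in> F" and b: "b \<in> carrier A" "b \<notin> D'" "x \<in> C b" for f b x
  proof (rule br_aspan_left[OF Zs _ f[unfolded F_def]])
    show xc: "x \<in> carrier L"
      using b component_carrier by blast
    fix w assume "w \<in> Z \<union> W"
    then consider "w \<in> Z" | ps where "w = comm u (map snd ps)" "set ps \<subseteq> Sigma (carrier A) C"
      unfolding W_def by blast
    then show "w \<bullet> x \<in> Z"
    proof cases
      case 1
      then show ?thesis
        using ideal_ofD(3)[OF Z _ xc] by blast
    next
      case (2 ps)
      define e where "e = degree_sum (map fst ps) g"
      have psb: "set (ps @ [(b, x)]) \<subseteq> Sigma (carrier A) C"
        using 2 b by auto
      have ec: "e \<in> carrier A"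
        unfolding e_def using 2(2) by (intro degree_sum_closed[OF _ g]) auto
      show ?thesis
      proof (cases "e \<in> E")
        case True
        have "b \<oplus>\<^bsub>A\<^esub> e \<notin> E"
        proof
          assume "b \<oplus>\<^bsub>A\<^esub> e \<in> E"
          then have "(b \<oplus>\<^bsub>A\<^esub> e) \<ominus>\<^bsub>A\<^esub> e \<in> D'"
            unfolding D'_def using True by (intro image_eqI[of _ _ "(b \<oplus>\<^bsub>A\<^esub> e, e)"]) auto
          moreover have "(b \<oplus>\<^bsub>A\<^esub> e) \<ominus>\<^bsub>A\<^esub> e = b"
            using b ec by (simp add: A.minus_eq A.a_assoc A.r_neg)
          ultimately show False
            using b by simp
        qed
        then have "comm u (map snd (ps @ [(b, x)])) \<in> Z"
          unfolding E_def e_def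
          by (intro comm_degree_outside[OF Z D(1,2) g u kill psb]) auto
        then show ?thesis
          using 2 by simp
      next
        case False
        then have "w \<in> Z"
          unfolding 2(1) E_def e_def by (intro comm_degree_outside[OF Z D(1,2) g u kill 2(2)]) auto
        then show ?thesis
          using ideal_ofD(3)[OF Z _ xc] by blast
      qed
    qed
  qed
  have Fc: "F \<subseteq> carrier L"
    using Fs(1) by (simp add: addsub_def)
  define K where "K = {x \<in> carrier L. \<forall>f\<in>F. f \<bullet> x \<in> Z}"
  have K: "ideal_of K"
  proof (rule ideal_ofI)
    have "K = {x \<in> carrier L. \<forall>f\<in>F. x \<in> {x \<in> carrier L. f \<bullet> x \<in> Z}}"
      by (auto simp: K_def)
    moreover have "addsub {x \<in> carrier L. \<forall>f\<in>F. x \<in> {x \<in> carrier L. f \<bullet> x \<in> Z}}"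
      using Fc by (intro addsub_Inter addsub_vimage_right Zs) auto
    ultimately show "addsub K"
      by simp
    fix x y assume x: "x \<in> K" and y: "y \<in> carrier L"
    have xc: "x \<in> carrier L"
      using x by (simp add: K_def)
    have "f \<bullet> (x \<bullet> y) \<in> Z" if f: "f \<in> F" for f
    proof (rule addsub_br_right[OF Zs])
      show "f \<bullet> x \<bullet> y \<in> Z"
        using x f y ideal_ofD(3)[OF Z] by (simp add: K_def)
      show "f \<bullet> y \<bullet> x \<in> Z"
        using x FL[OF f y] by (simp add: K_def)
    qed (use f Fc xc y in auto)
    then show "x \<bullet> y \<in> K"
      using xc y by (simp add: K_def)
  qed
  have out: "x \<bullet> y \<in> K" if "a \<in> D'" "b \<in> D'" "a \<oplus>\<^bsub>A\<^esub> b \<notin> D'" "x \<in> C a" "y \<in> C b" for a b x y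
  proof -
    have ab: "a \<in> carrier A" "b \<in> carrier A"
      using that D' by auto
    then have "x \<bullet> y \<in> C (a \<oplus>\<^bsub>A\<^esub> b)"
      using component_br that by blast
    then show ?thesis
      using FZ[of _ "a \<oplus>\<^bsub>A\<^esub> b"] ab that component_carrier[of "a \<oplus>\<^bsub>A\<^esub> b"] by (auto simp: K_def)
  qed
  have solv: "derived_component D' (support_solv_bound k d') a \<subseteq> K" if "a \<in> D'" for a
    by (rule finite_support_solvable[OF K D' _ that]) (rule out)
  define N where "N = absorption_bound k d"
  have N: "N = Suc (d' * k) ^ support_solv_bound k d'"
    by (simp add: N_def absorption_bound_def d'_def Let_def)
  have inside: "comm f ys \<in> Z" if "f \<in> F" "set ys \<subseteq> (\<Union>a\<in>D'. C a)" "length ys = N" for f ys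
  proof (rule nilpotent_action[OF D' Fs(1) Zs Fs(2) _ _ _ _ _ that(1,2)])
    have Dc: "x \<in> carrier L" if "a \<in> D'" "x \<in> C a" for a x
      using that D'(1) component_carrier by blast
    show "f \<bullet> x \<in> F" if "f \<in> F" "a \<in> D'" "x \<in> C a" for f a x
      using FL that Dc by blast
    show "f \<bullet> x \<in> Z" if "f \<in> Z" "a \<in> D'" "x \<in> C a" for f a x
      using ideal_ofD(3)[OF Z] that Dc by blast
    show "f \<bullet> (x \<bullet> y) \<in> Z" if "f \<in> F" "a \<in> D'" "b \<in> D'" "a \<oplus>\<^bsub>A\<^esub> b \<notin> D'" "x \<in> C a" "y \<in> C b" for f a b x y
      using out[OF that(2-)] that(1) by (simp add: K_def)
    show "comm f xs \<in> Z" if "f \<in> F" "a \<in> D'" "set xs \<subseteq> C a" "length xs = k" for f a xs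
    proof -
      have "comm f xs = \<zero>"
        using that D'(1) Fc by (intro component_nil[of a]) auto
      then show ?thesis
        using addsubD(2)[OF Zs] by simp
    qed
    show "f \<bullet> x \<in> Z" if "f \<in> F" "a \<in> D'" "x \<in> derived_component D' (support_solv_bound k d') a" for f a x
      using solv[OF that(2)] that unfolding K_def by blast
    show "Suc (d' * k) ^ support_solv_bound k d' \<le> length ys"
      using that(3) N by simp
  qed
  have homog: "comm f ys \<in> Z" if "f \<in> F" "set ys \<subseteq> (\<Union>a\<in>carrier A. C a)" "length ys = N" for f ys
  proof (cases "set ys \<subseteq> (\<Union>a\<in>D'. C a)")
    case True
    then show ?thesis
      using inside that by blast
  next
    case False
    then obtain y where y: "y \<in> set ys" "y \<notin> (\<Union>a\<in>D'. C a)"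
      by blast
    then obtain ys1 ys2 where ys: "ys = ys1 @ y # ys2"
      by (auto dest: split_list)
    obtain b where b: "b \<in> carrier A" "y \<in> C b"
      using \<open>set ys \<subseteq> (\<Union>a\<in>carrier A. C a)\<close> y(1) by blast
    then have "b \<notin> D'"
      using y(2) by blast
    have c: "set ys \<subseteq> carrier L"
      using that(2) component_carrier by blast
    have "comm f ys1 \<in> F"
      by (rule comm_invariant[of F "carrier L", OF FL \<open>f \<in> F\<close>]) (use c ys in auto)
    then have "comm f ys1 \<bullet> y \<in> Z"
      using FZ b \<open>b \<notin> D'\<close> by blast
    then have "comm (comm f ys1 \<bullet> y) ys2 \<in> Z"
      by (rule comm_ideal[OF Z]) (use c ys in auto)
    then show ?thesis
      by (simp add: ys)
  qed
  have Vc: "(\<Union>a\<in>carrier A. C a) \<subseteq> carrier L"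
    using component_carrier by blast
  show ?thesis
  proof (rule comm_aspan_letters[where F = F and F' = Z and K = "{}" and n = N, OF Fs(1) Zs Fs(2) Vc])
    show "f \<bullet> x \<in> F" if "f \<in> F" "x \<in> (\<Union>a\<in>carrier A. C a)" for f x
      using FC that by blast
    show "f \<bullet> x \<in> Z" if "f \<in> Z" "x \<in> (\<Union>a\<in>carrier A. C a)" for f x
      using ideal_ofD(3)[OF Z] that Vc by blast
    show "u \<in> F"
      using W_F[of u] unfolding W_def by (intro W_F) (auto simp: W_def intro!: exI[of _ "[]"])
    show "set xs \<subseteq> aspan ({} \<union> (\<Union>a\<in>carrier A. C a))"
      using xs(1) component_span by auto
    show "length xs = N"
      using xs(2) by (simp add: N_def)
  qed (use homog in auto)
qed

end

section \<open>Independent sequences of degrees\<close>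

text \<open>
  The induction over the length of independent sequences takes \<open>c\<close> steps down to
  length 1; the sets of dependent degrees never exceed \<open>q ^ Suc c\<close>.
\<close>

definition class_bound :: "nat \<Rightarrow> nat \<Rightarrow> nat \<Rightarrow> nat" where
  "class_bound q k c = k + c * absorption_bound k (q ^ Suc c)"

context lie_ring
begin

text \<open>
  The \<open>n\<close>-th term of the upper central series.
\<close>

definition upper_central :: "nat \<Rightarrow> 'l set" where
  "upper_central n = {x \<in> carrier L. \<forall>ys. set ys \<subseteq> carrier L \<and> length ys = n \<longrightarrow> comm x ys = \<zero>}"

lemma upper_centralD:
  "\<lbrakk>x \<in> upper_central n; set ys \<subseteq> carrier L; length ys = n\<rbrakk> \<Longrightarrow> comm x ys = \<zero>"
  by (simp add: upper_central_def)

lemma ideal_upper_central: "ideal_of (upper_central n)"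
proof (rule ideal_ofI)
  let ?I = "{ys. set ys \<subseteq> carrier L \<and> length ys = n}"
  have "addsub {x \<in> carrier L. \<forall>ys\<in>?I. x \<in> {x \<in> carrier L. comm x ys \<in> {\<zero>}}}"
    by (intro addsub_Inter addsub_vimage_comm addsub_zero) auto
  moreover have "{x \<in> carrier L. \<forall>ys\<in>?I. x \<in> {x \<in> carrier L. comm x ys \<in> {\<zero>}}} = upper_central n"
    by (auto simp: upper_central_def)
  ultimately show "addsub (upper_central n)"
    by simp
  fix x y assume x: "x \<in> upper_central n" and y: "y \<in> carrier L"
  have xc: "x \<in> carrier L"
    using x by (simp add: upper_central_def)
  have "comm (x \<bullet> y) ys = \<zero>" if ys: "set ys \<subseteq> carrier L" "length ys = n" for ys
  proof -
    define zs where "zs = y # ys"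
    have zs: "set zs \<subseteq> carrier L" "length (take n zs) = n"
      using ys y by (auto simp: zs_def)
    then have "set (take n zs) \<subseteq> carrier L" "set (drop n zs) \<subseteq> carrier L"
      using set_take_subset[of n zs] set_drop_subset[of n zs] by auto
    then have "comm (comm x (take n zs)) (drop n zs) = \<zero>"
      using upper_centralD[OF x _ zs(2)] comm_zero by simp
    then have "comm x zs = \<zero>"
      by (metis append_take_drop_id foldl_append)
    then show ?thesis
      by (simp add: zs_def)
  qed
  then show "x \<bullet> y \<in> upper_central n"
    using xc y by (simp add: upper_central_def)
qed

lemma upper_central_add:
  assumes "x \<in> carrier L" "\<And>ys. \<lbrakk>set ys \<subseteq> carrier L; length ys = m\<rbrakk> \<Longrightarrow> comm x ys \<in> upper_central n"
  shows "x \<in> upper_central (m + n)"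
proof -
  have "comm x ys = \<zero>" if ys: "set ys \<subseteq> carrier L" "length ys = m + n" for ys
  proof -
    have "set (take m ys) \<subseteq> carrier L" "set (drop m ys) \<subseteq> carrier L"
      using set_take_subset[of m ys] set_drop_subset[of m ys] ys by auto
    then have "comm (comm x (take m ys)) (drop m ys) = \<zero>"
      using ys(2) by (intro upper_centralD[OF assms(2)]) auto
    then show ?thesis
      by (metis append_take_drop_id foldl_append)
  qed
  then show ?thesis
    using assms(1) by (simp add: upper_central_def)
qed

end

text \<open>
  What the proof uses of the double automorphisms: their action on degrees, with \<open>e\<close>
  the identity, and the set \<open>Y\<close> of fixed elements. For homogeneous \<open>x\<close>,
  it contains the orbit sum of \<open>x\<close>, whose other summands have the nontrivial
  conjugates of the degree of \<open>x\<close> as degrees.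
\<close>

locale semiregular_graded_lie_ring = nil_graded_lie_ring L br A C k
  for L :: "('l, 'm) ring_scheme" (structure) and br :: "'l \<Rightarrow> 'l \<Rightarrow> 'l"  (infixl \<open>\<bullet>\<close> 70)
    and A :: "('a, 'n) ring_scheme" and C :: "'a \<Rightarrow> 'l set" and k :: nat +
  fixes H :: "'h set" and e :: 'h and act :: "'h \<Rightarrow> 'a \<Rightarrow> 'a" and Y :: "'l set" and c :: nat
  assumes H_finite: "finite H" and e_in_H: "e \<in> H"
    and act_closed: "\<lbrakk>h \<in> H; a \<in> carrier A\<rbrakk> \<Longrightarrow> act h a \<in> carrier A"
    and act_add: "\<lbrakk>h \<in> H; a \<in> carrier A; b \<in> carrier A\<rbrakk> \<Longrightarrow> act h (a \<oplus>\<^bsub>A\<^esub> b) = act h a \<oplus>\<^bsub>A\<^esub> act h b"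
    and act_e: "a \<in> carrier A \<Longrightarrow> act e a = a"
    and act_free: "\<lbrakk>h \<in> H; h \<noteq> e; a \<in> carrier A; act h a = a\<rbrakk> \<Longrightarrow> a = \<zero>\<^bsub>A\<^esub>"
    and Y_carrier: "Y \<subseteq> carrier L"
    and Y_orbit_sum: "\<lbrakk>a \<in> carrier A; x \<in> C a\<rbrakk> \<Longrightarrow> \<exists>s \<in> aspan (\<Union>h\<in>H - {e}. C (act h a)). x \<oplus> s \<in> Y"
    and Y_nilpotent: "\<lbrakk>y \<in> Y; set ys \<subseteq> Y; length ys = c\<rbrakk> \<Longrightarrow> comm y ys = \<zero>"
begin

lemma act_neg:
  assumes "h \<in> H" "a \<in> carrier A"
  shows "act h (\<ominus>\<^bsub>A\<^esub> a) = \<ominus>\<^bsub>A\<^esub> act h a"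
proof -
  have "act h \<zero>\<^bsub>A\<^esub> = \<zero>\<^bsub>A\<^esub>"
    using act_add[OF assms(1), of "\<zero>\<^bsub>A\<^esub>" "\<zero>\<^bsub>A\<^esub>"] act_closed[OF assms(1), of "\<zero>\<^bsub>A\<^esub>"]
    by (simp add: A.add.l_cancel_one')
  then have "act h (\<ominus>\<^bsub>A\<^esub> a) \<oplus>\<^bsub>A\<^esub> act h a = \<zero>\<^bsub>A\<^esub>"
    using act_add[OF assms(1), of "\<ominus>\<^bsub>A\<^esub> a" a] assms by (simp add: A.l_neg)
  then show ?thesis
    using assms act_closed by (simp add: A.minus_equality)
qed

text \<open>
  Here freeness enters: the difference of two solutions is fixed by \<open>h\<close>.
\<close>

lemma act_equation_unique:
  assumes h: "h \<in> H" "h \<noteq> e" and c: "a \<in> carrier A" "d \<in> carrier A" "b \<in> carrier A" "b' \<in> carrier A"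
    and eq: "act h b \<oplus>\<^bsub>A\<^esub> a = b \<oplus>\<^bsub>A\<^esub> d" "act h b' \<oplus>\<^bsub>A\<^esub> a = b' \<oplus>\<^bsub>A\<^esub> d"
  shows "b = b'"
proof -
  note ac = act_closed[OF h(1) c(3)] act_closed[OF h(1) c(4)]
  have diff: "(u \<oplus>\<^bsub>A\<^esub> v) \<oplus>\<^bsub>A\<^esub> \<ominus>\<^bsub>A\<^esub> (u' \<oplus>\<^bsub>A\<^esub> v) = u \<oplus>\<^bsub>A\<^esub> \<ominus>\<^bsub>A\<^esub> u'"
    if "u \<in> carrier A" "v \<in> carrier A" "u' \<in> carrier A" for u v u'
  proof -
    have "v \<oplus>\<^bsub>A\<^esub> (\<ominus>\<^bsub>A\<^esub> u' \<oplus>\<^bsub>A\<^esub> \<ominus>\<^bsub>A\<^esub> v) = \<ominus>\<^bsub>A\<^esub> u'"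
      using that A.a_comm[of "\<ominus>\<^bsub>A\<^esub> u'" "\<ominus>\<^bsub>A\<^esub> v"] by (simp add: A.r_neg2)
    then show ?thesis
      using that by (simp add: A.minus_add A.a_assoc)
  qed
  have "act h (b \<oplus>\<^bsub>A\<^esub> \<ominus>\<^bsub>A\<^esub> b') = act h b \<oplus>\<^bsub>A\<^esub> \<ominus>\<^bsub>A\<^esub> act h b'"
    using h c by (simp add: act_add act_neg)
  also have "\<dots> = (act h b \<oplus>\<^bsub>A\<^esub> a) \<oplus>\<^bsub>A\<^esub> \<ominus>\<^bsub>A\<^esub> (act h b' \<oplus>\<^bsub>A\<^esub> a)"
    using diff[OF ac(1) c(1) ac(2)] by simp
  also have "\<dots> = b \<oplus>\<^bsub>A\<^esub> \<ominus>\<^bsub>A\<^esub> b'"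
    unfolding eq by (rule diff[OF c(3,2,4)])
  finally have "b \<oplus>\<^bsub>A\<^esub> \<ominus>\<^bsub>A\<^esub> b' = \<zero>\<^bsub>A\<^esub>"
    using c by (intro act_free[OF h]) auto
  then show ?thesis
    using c by (metis A.a_inv_closed A.minus_equality A.minus_minus)
qed

definition twist :: "'h list \<Rightarrow> 'a list \<Rightarrow> 'a" where
  "twist hs as = degree_sum (map2 act hs as) \<zero>\<^bsub>A\<^esub>"

text \<open>
  Independence says that the degree of a commutator of elements with these degrees is changed by
  every nontrivial choice of conjugates of its entries.
\<close>

definition indep :: "'a list \<Rightarrow> bool" where
  "indep as \<longleftrightarrow> (\<forall>hs. set hs \<subseteq> H \<and> length hs = length as \<and> twist hs as = degree_sum as \<zero>\<^bsub>A\<^esub>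
     \<longrightarrow> set hs \<subseteq> {e})"

lemma twist_closed:
  assumes "set hs \<subseteq> H" "set as \<subseteq> carrier A"
  shows "twist hs as \<in> carrier A"
proof -
  have "set (map2 act hs as) \<subseteq> carrier A"
    using assms by (auto intro!: act_closed dest: set_zip_leftD set_zip_rightD)
  then show ?thesis
    unfolding twist_def by (intro degree_sum_closed) auto
qed

lemma twist_snoc: "length hs = length as \<Longrightarrow> twist (hs @ [h]) (as @ [a]) = act h a \<oplus>\<^bsub>A\<^esub> twist hs as"
  by (simp add: twist_def)

text \<open>
  A degree that makes the sequence dependent solves an equation as in
  \<open>act_equation_unique\<close>, in which the last conjugation is nontrivial as the shorter
  sequence is independent. So it is determined by the list of conjugations, and these lists are
  counted.
\<close>

lemma dependent_letters:
  assumes as: "set as \<subseteq> carrier A" "indep as"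
  defines "B \<equiv> {b \<in> carrier A. \<not> indep (as @ [b])}"
  shows "finite B \<and> card B \<le> card H ^ Suc (length as)"
proof -
  let ?T = "{hs. set hs \<subseteq> H \<and> length hs = Suc (length as)}"
  have sc: "degree_sum as \<zero>\<^bsub>A\<^esub> \<in> carrier A"
    using as by (intro degree_sum_closed) auto
  define P where "P b h hs \<longleftrightarrow> h \<in> H \<and> h \<noteq> e \<and> set hs \<subseteq> H \<and> length hs = length as \<and>
      act h b \<oplus>\<^bsub>A\<^esub> twist hs as = b \<oplus>\<^bsub>A\<^esub> degree_sum as \<zero>\<^bsub>A\<^esub>" for b h hs
  have ex: "\<exists>h hs. P b h hs" if "b \<in> B" for b
  proof -
    have b: "b \<in> carrier A"
      using that by (simp add: B_def)
    have "\<exists>hs. set hs \<subseteq> H \<and> length hs = length (as @ [b]) \<and> twist hs (as @ [b]) = degree_sum (as @ [b]) \<zero>\<^bsub>A\<^esub>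
        \<and> \<not> set hs \<subseteq> {e}"
      using that by (simp add: B_def indep_def)
    then obtain gs where gs: "set gs \<subseteq> H" "length gs = length (as @ [b])"
      "twist gs (as @ [b]) = degree_sum (as @ [b]) \<zero>\<^bsub>A\<^esub>" "\<not> set gs \<subseteq> {e}"
      by (elim exE conjE)
    define hs where "hs = butlast gs"
    define h where "h = last gs"
    have "gs \<noteq> []"
      using gs(2) by auto
    then have g: "gs = hs @ [h]"
      by (simp add: hs_def h_def)
    have len: "length hs = length as" and H: "set hs \<subseteq> H" "h \<in> H"
      using gs(1,2) by (auto simp: g)
    have eq: "act h b \<oplus>\<^bsub>A\<^esub> twist hs as = b \<oplus>\<^bsub>A\<^esub> degree_sum as \<zero>\<^bsub>A\<^esub>"
      using gs(3) len by (simp add: g twist_snoc)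
    have "h \<noteq> e"
    proof
      assume h: "h = e"
      then have "twist hs as = degree_sum as \<zero>\<^bsub>A\<^esub>"
        using eq b sc twist_closed[OF H(1) as(1)] by (simp add: act_e)
      then have "set hs \<subseteq> {e}"
        using as(2) H(1) len by (simp add: indep_def)
      then show False
        using gs(4) h by (simp add: g)
    qed
    then show ?thesis
      unfolding P_def using H len eq by (intro exI conjI)
  qed
  obtain w ws where "\<And>b. b \<in> B \<Longrightarrow> P b (w b) (ws b)"
    using ex by metis
  note ws = this[unfolded P_def]
  have inj: "inj_on (\<lambda>b. w b # ws b) B"
  proof (rule inj_onI)
    fix b b' assume b: "b \<in> B" "b' \<in> B" and eq: "w b # ws b = w b' # ws b'"
    have "b \<in> carrier A" "b' \<in> carrier A"
      using b by (simp_all add: B_def)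
    moreover have "twist (ws b) as \<in> carrier A"
      using ws[OF b(1)] as(1) by (intro twist_closed) auto
    moreover have "w b' = w b" "ws b' = ws b"
      using eq by simp_all
    note ws[OF b(1)] ws[OF b(2), unfolded this]
    ultimately show "b = b'"
      using sc by (elim conjE) (rule act_equation_unique)
  qed
  have img: "(\<lambda>b. w b # ws b) ` B \<subseteq> ?T"
  proof (rule image_subsetI)
    fix b assume "b \<in> B"
    from ws[OF this] show "w b # ws b \<in> ?T"
      by simp
  qed
  have "finite ?T" "card ?T = card H ^ Suc (length as)"
    using finite_lists_length_eq[OF H_finite] card_lists_length_eq[OF H_finite] by auto
  then show ?thesis
    using inj_on_finite[OF inj img] card_inj_on_le[OF inj img] by simp
qed

text \<open>
  Where the commutators of conjugates of homogeneous elements with degrees \<open>as\<close> lie,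
  apart from the commutator of the elements themselves.
\<close>

definition twisted_span :: "'a list \<Rightarrow> 'l set" where
  "twisted_span as = aspan (\<Union>hs\<in>{hs. set hs \<subseteq> H \<and> length hs = length as \<and> \<not> set hs \<subseteq> {e}}. C (twist hs as))"

text \<open>
  The commutator of the orbit sums is expanded letter by letter; a term is twisted as soon as one
  of its entries is a nontrivial conjugate.
\<close>

lemma orbit_sum_expansion:
  assumes "a \<in> carrier A" "x \<in> C a" "set ps \<subseteq> Sigma (carrier A) C"
  shows "\<exists>y ys t. y \<in> Y \<and> set ys \<subseteq> Y \<and> length ys = length ps \<and> t \<in> twisted_span (a # map fst ps) \<and>
    comm y ys = comm x (map snd ps) \<oplus> t"
  using assms(3)
proof (induction ps rule: rev_induct)
  case Nil
  obtain s where s: "s \<in> aspan (\<Union>h\<in>H - {e}. C (act h a))" "x \<oplus> s \<in> Y"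
    using Y_orbit_sum[OF assms(1,2)] by blast
  have "s \<in> twisted_span [a]"
    unfolding twisted_span_def
  proof (rule aspan_least[OF addsub_aspan _ s(1)])
    fix z assume "z \<in> (\<Union>h\<in>H - {e}. C (act h a))" and zc: "z \<in> carrier L"
    then obtain h where h: "h \<in> H" "h \<noteq> e" "z \<in> C (act h a)"
      by blast
    then have "z \<in> C (twist [h] [a])"
      using act_closed[OF h(1) assms(1)] by (simp add: twist_def)
    then show "z \<in> aspan (\<Union>hs\<in>{hs. set hs \<subseteq> H \<and> length hs = length [a] \<and> \<not> set hs \<subseteq> {e}}. C (twist hs [a]))"
      using h(1,2) zc by (intro aspan_base UN_I[of "[h]"]) auto
  qed
  then show ?case
    using s(2) by (intro exI[of _ "x \<oplus> s"] exI[of _ "[]"] exI[of _ s]) simp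
next
  case (snoc p ps)
  obtain b z where p: "p = (b, z)" "b \<in> carrier A" "z \<in> C b"
    using snoc.prems by (cases p) auto
  let ?as = "a # map fst ps" and ?w = "comm x (map snd ps)"
  have ps: "set ps \<subseteq> Sigma (carrier A) C"
    using snoc.prems by simp
  have as: "set ?as \<subseteq> carrier A"
    using ps assms(1) by auto
  obtain y ys t where IH: "y \<in> Y" "set ys \<subseteq> Y" "length ys = length ps" "t \<in> twisted_span ?as"
    "comm y ys = ?w \<oplus> t"
    using snoc.IH[OF ps] by (elim exE conjE)
  obtain s where s: "s \<in> aspan (\<Union>h\<in>H - {e}. C (act h b))" "z \<oplus> s \<in> Y"
    using Y_orbit_sum[OF p(2,3)] by blast
  have xc: "x \<in> carrier L" and zc: "z \<in> carrier L"
    using component_carrier assms p by blast+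
  have wc: "?w \<in> carrier L"
    using labelled_carrier[OF ps] xc by (auto intro!: comm_closed)
  have sc: "s \<in> carrier L" and tc: "t \<in> carrier L"
    using s(1) IH(4) aspan_closed by (auto simp: twisted_span_def)
  have w_comp: "?w \<in> C (twist (replicate (length ?as) e) ?as)"
  proof -
    have "map2 act (replicate (length as) e) as = as" if "set as \<subseteq> carrier A" for as
      using that by (induction as) (auto simp: act_e)
    then have "twist (replicate (length ?as) e) ?as = degree_sum ?as \<zero>\<^bsub>A\<^esub>"
      using as unfolding twist_def by metis
    also have "\<dots> = degree_sum (map fst ps) a"
      using assms(1) by simp
    finally show ?thesis
      using comm_component[OF assms(2,1) ps] by simp
  qed
  have prod: "u \<bullet> v \<in> twisted_span (?as @ [b])"
    if hs: "set hs \<subseteq> H" "length hs = length ?as" "h \<in> H" "\<not> set (hs @ [h]) \<subseteq> {e}"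
      and uv: "u \<in> C (twist hs ?as)" "v \<in> C (act h b)" for hs h u v
  proof -
    note tw = twist_closed[OF hs(1) as] and ac = act_closed[OF hs(3) p(2)]
    have "u \<bullet> v \<in> C (twist hs ?as \<oplus>\<^bsub>A\<^esub> act h b)"
      using component_br[OF tw ac uv] .
    then have "u \<bullet> v \<in> C (twist (hs @ [h]) (?as @ [b]))"
      using twist_snoc[OF hs(2)] A.a_comm[OF tw ac] by simp
    moreover have "u \<bullet> v \<in> carrier L"
      using uv component_carrier[OF tw] component_carrier[OF ac] by blast
    ultimately show ?thesis
      unfolding twisted_span_def using hs by (intro aspan_base UN_I[of "hs @ [h]"]) auto
  qed
  have T: "addsub (twisted_span (?as @ [b]))"
    by (simp add: twisted_span_def addsub_aspan)
  have reps: "set (replicate (length ?as) e) \<subseteq> H" "length (replicate (length ?as) e) = length ?as"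
    using e_in_H by auto
  have ws: "?w \<bullet> s \<in> twisted_span (?as @ [b])"
  proof (rule br_aspan_right[OF T _ s(1) wc])
    fix v assume "v \<in> (\<Union>h\<in>H - {e}. C (act h b))"
    then obtain h where "h \<in> H" "h \<noteq> e" "v \<in> C (act h b)"
      by blast
    then show "?w \<bullet> v \<in> twisted_span (?as @ [b])"
      using w_comp by (intro prod[OF reps]) auto
  qed
  have tv: "t \<bullet> v \<in> twisted_span (?as @ [b])" if v: "h \<in> H" "v \<in> C (act h b)" for h v
  proof (rule br_aspan_left[OF T _ IH(4)[unfolded twisted_span_def]])
    fix u assume "u \<in> (\<Union>hs\<in>{hs. set hs \<subseteq> H \<and> length hs = length ?as \<and> \<not> set hs \<subseteq> {e}}. C (twist hs ?as))"
    then obtain hs where "set hs \<subseteq> H" "length hs = length ?as" "\<not> set hs \<subseteq> {e}" "u \<in> C (twist hs ?as)"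
      by blast
    then show "u \<bullet> v \<in> twisted_span (?as @ [b])"
      using v by (intro prod[of hs h]) auto
  next
    show "v \<in> carrier L"
      using v act_closed[OF _ p(2)] component_carrier by blast
  qed
  have ts: "t \<bullet> s \<in> twisted_span (?as @ [b])"
    by (rule br_aspan_right[OF T _ s(1) tc]) (use tv in blast)
  have tz: "t \<bullet> z \<in> twisted_span (?as @ [b])"
    using tv[OF e_in_H, of z] act_e[OF p(2)] p(3) by simp
  have "comm y (ys @ [z \<oplus> s]) = (?w \<oplus> t) \<bullet> (z \<oplus> s)"
    by (simp add: IH(5))
  also have "\<dots> = ?w \<bullet> z \<oplus> (?w \<bullet> s \<oplus> (t \<bullet> z \<oplus> t \<bullet> s))"
    using wc zc sc tc by (simp add: br_add_left br_add_right a_ac)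
  finally have "comm y (ys @ [z \<oplus> s]) = comm x (map snd (ps @ [p])) \<oplus> (?w \<bullet> s \<oplus> (t \<bullet> z \<oplus> t \<bullet> s))"
    by (simp add: p(1))
  moreover have "?w \<bullet> s \<oplus> (t \<bullet> z \<oplus> t \<bullet> s) \<in> twisted_span (a # map fst (ps @ [p]))"
    using addsubD(3)[OF T ws addsubD(3)[OF T tz ts]] by (simp add: p(1))
  moreover have "set (ys @ [z \<oplus> s]) \<subseteq> Y" "length (ys @ [z \<oplus> s]) = length (ps @ [p])"
    using IH s(2) by auto
  ultimately show ?case
    using IH(1) by (intro exI conjI)
qed

text \<open>
  By independence, the unwanted terms of \<open>orbit_sum_expansion\<close> have other degrees
  than the commutator itself, so the commutator is a component of zero.
\<close>

lemma comm_indep_zero: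
  assumes "a \<in> carrier A" "x \<in> C a" "set ps \<subseteq> Sigma (carrier A) C" "length ps = c"
    and ind: "indep (a # map fst ps)"
  shows "comm x (map snd ps) = \<zero>"
proof -
  let ?as = "a # map fst ps" and ?w = "comm x (map snd ps)"
  define g where "g = degree_sum ?as \<zero>\<^bsub>A\<^esub>"
  have as: "set ?as \<subseteq> carrier A"
    using assms by auto
  have g: "g \<in> carrier A"
    unfolding g_def by (rule degree_sum_closed[OF as]) simp
  have w: "?w \<in> C g"
    using comm_component[OF assms(2,1,3)] assms(1) by (simp add: g_def)
  obtain y ys t where *: "y \<in> Y" "set ys \<subseteq> Y" "length ys = length ps" "t \<in> twisted_span ?as"
    "comm y ys = ?w \<oplus> t"
    using orbit_sum_expansion[OF assms(1-3)] by (elim exE conjE)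
  have sub: "twisted_span ?as \<subseteq> aspan (\<Union>b\<in>carrier A - {g}. C b)"
    unfolding twisted_span_def
  proof (rule aspan_mono, rule UN_least)
    fix hs assume hs: "hs \<in> {hs. set hs \<subseteq> H \<and> length hs = length ?as \<and> \<not> set hs \<subseteq> {e}}"
    then have "twist hs ?as \<noteq> g"
      using ind unfolding indep_def g_def by blast
    moreover have "twist hs ?as \<in> carrier A"
      using hs by (intro twist_closed[OF _ as]) simp
    ultimately show "C (twist hs ?as) \<subseteq> (\<Union>b\<in>carrier A - {g}. C b)"
      by blast
  qed
  have c: "?w \<in> carrier L" "t \<in> carrier L"
    using component_carrier[OF g w] aspan_closed *(4) by (auto simp: twisted_span_def)
  have "?w \<oplus> t = \<zero>"
    using Y_nilpotent[OF *(1,2)] *(3,5) assms(4) by simp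
  then have "?w = \<ominus> t"
    using c by (simp add: minus_equality)
  then have "?w \<in> aspan (\<Union>b\<in>carrier A - {g}. C b)"
    using sub *(4) by (auto intro: aspan_neg)
  then show ?thesis
    by (rule component_independent[OF g w])
qed

text \<open>
  Appending a letter keeps the sequence independent except for boundedly many degrees; for the
  other degrees the induction hypothesis puts the longer commutator into the ideal, and
  \<open>absorption\<close> deals with the exceptions.
\<close>

lemma comm_indep_upper_central:
  assumes "j \<le> c" "a \<in> carrier A" "x \<in> C a" "set ps \<subseteq> Sigma (carrier A) C" "length ps = c - j"
    and "indep (a # map fst ps)"
  shows "comm x (map snd ps) \<in> upper_central (j * absorption_bound k (card H ^ Suc c))"
  using assms
proof (induction j arbitrary: ps)
  case 0
  then have "comm x (map snd ps) = \<zero>"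
    by (intro comm_indep_zero) auto
  then show ?case
    by (simp add: upper_central_def)
next
  case (Suc j)
  let ?N = "absorption_bound k (card H ^ Suc c)" and ?as = "a # map fst ps" and ?u = "comm x (map snd ps)"
  note ps = Suc.prems(4)
  have as: "set ?as \<subseteq> carrier A"
    using ps Suc.prems(2) by auto
  define B where "B = {b \<in> carrier A. \<not> indep (?as @ [b])}"
  have B: "finite B \<and> card B \<le> card H ^ Suc (length ?as)"
    unfolding B_def by (rule dependent_letters[OF as Suc.prems(6)])
  have "0 < card H"
    using H_finite e_in_H card_gt_0_iff by blast
  then have "card H ^ Suc (length ?as) \<le> card H ^ Suc c"
    using Suc.prems(1,5) by (intro power_increasing) auto
  then have cB: "card B \<le> card H ^ Suc c"
    using B by linarith
  have "comm ?u ys \<in> upper_central (j * ?N)" if ys: "set ys \<subseteq> carrier L" "length ys = ?N" for ys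
  proof (rule absorption[OF ideal_upper_central _ _ cB _ _ _ ys])
    show "finite B" "B \<subseteq> carrier A"
      using B by (auto simp: B_def)
    show "degree_sum (map fst ps) a \<in> carrier A"
      using as by (intro degree_sum_closed) auto
    show "?u \<in> C (degree_sum (map fst ps) a)"
      by (rule comm_component[OF Suc.prems(3,2) ps])
    fix b y assume b: "b \<in> carrier A" "b \<notin> B" "y \<in> C b"
    have "comm x (map snd (ps @ [(b, y)])) \<in> upper_central (j * ?N)"
    proof (rule Suc.IH[OF _ Suc.prems(2,3)])
      show "indep (a # map fst (ps @ [(b, y)]))"
        using b by (simp add: B_def)
    qed (use Suc.prems b in auto)
    then show "?u \<bullet> y \<in> upper_central (j * ?N)"
      by simp
  qed
  moreover have "?u \<in> carrier L"
    using labelled_carrier[OF ps] component_carrier[OF Suc.prems(2,3)] by (auto intro!: comm_closed)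
  ultimately show ?case
    using upper_central_add by simp
qed

text \<open>
  A single nonzero degree is independent, so all components of nonzero degree lie in the same term
  of the upper central series. Modulo that term only the component of degree 0 remains.
\<close>

theorem comm_class_bound:
  assumes "x \<in> carrier L" "set xs \<subseteq> carrier L" "length xs = class_bound (card H) k c"
  shows "comm x xs = \<zero>"
proof -
  define N where "N = c * absorption_bound k (card H ^ Suc c)"
  let ?Z = "upper_central N"
  have Z: "ideal_of ?Z"
    by (rule ideal_upper_central)
  have comp: "y \<in> ?Z" if a: "a \<in> carrier A" "a \<noteq> \<zero>\<^bsub>A\<^esub>" and y: "y \<in> C a" for a y
  proof -
    have "indep [a]"
      unfolding indep_def
    proof (intro allI impI, elim conjE)
      fix hs assume hs: "set hs \<subseteq> H" "length hs = length [a]" "twist hs [a] = degree_sum [a] \<zero>\<^bsub>A\<^esub>"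
      then obtain h where h: "hs = [h]" "h \<in> H"
        by (cases hs) auto
      then have "act h a = a"
        using hs(3) a act_closed[OF h(2) a(1)] by (simp add: twist_def)
      then have "h = e"
        using act_free[OF h(2) _ a(1)] a(2) by blast
      then show "set hs \<subseteq> {e}"
        by (simp add: h(1))
    qed
    then show ?thesis
      using comm_indep_upper_central[OF order_refl a(1) y, of "[]"] by (simp add: N_def)
  qed
  have C0: "C \<zero>\<^bsub>A\<^esub> \<subseteq> carrier L"
    using component_carrier[of "\<zero>\<^bsub>A\<^esub>"] by auto
  have nil: "comm x ys \<in> ?Z" if ys: "set ys \<subseteq> carrier L" "length ys = k" for ys
  proof (rule comm_aspan_letters[OF addsub_carrier ideal_ofD(1)[OF Z] _ C0 _ _ _ _ _ assms(1) _ ys(2)])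
    show "?Z \<subseteq> carrier L" "?Z \<subseteq> carrier L"
      by (auto simp: upper_central_def)
    show "u \<bullet> y \<in> carrier L" if "u \<in> carrier L" "y \<in> C \<zero>\<^bsub>A\<^esub>" for u y
      using that C0 by auto
    show "u \<bullet> y \<in> ?Z" if "u \<in> ?Z" "y \<in> C \<zero>\<^bsub>A\<^esub>" for u y
      using that C0 ideal_ofD(3)[OF Z] by auto
    show "u \<bullet> y \<in> ?Z" if "u \<in> carrier L" "y \<in> ?Z" for u y
      using that ideal_ofD(4)[OF Z] by auto
    show "comm u zs \<in> ?Z" if "u \<in> carrier L" "set zs \<subseteq> C \<zero>\<^bsub>A\<^esub>" "length zs = k" for u zs
      using component_nil[OF _ that] addsubD(2)[OF ideal_ofD(1)[OF Z]] by simp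
    have "(\<Union>a\<in>carrier A. C a) \<subseteq> ?Z \<union> C \<zero>\<^bsub>A\<^esub>"
      using comp by blast
    then show "set ys \<subseteq> aspan (?Z \<union> C \<zero>\<^bsub>A\<^esub>)"
      using ys(1) component_span aspan_mono by blast
  qed
  have "x \<in> upper_central (k + N)"
    by (rule upper_central_add[OF assms(1) nil])
  then show ?thesis
    using assms(2,3) by (intro upper_centralD) (auto simp: class_bound_def N_def)
qed

end

section \<open>Graded Lie algebras with double automorphisms\<close>

context lie_algebra
begin

lemma lin_span_eq_zero_iff:
  assumes "S \<subseteq> carrier L"
  shows "lin_span R L S = {\<zero>\<^bsub>L\<^esub>} \<longleftrightarrow> S \<subseteq> {\<zero>\<^bsub>L\<^esub>}"
proof
  assume "lin_span R L S = {\<zero>\<^bsub>L\<^esub>}"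
  moreover have "S \<subseteq> lin_span R L S"
    by (auto simp: lin_span_def)
  ultimately show "S \<subseteq> {\<zero>\<^bsub>L\<^esub>}"
    by blast
next
  assume "S \<subseteq> {\<zero>\<^bsub>L\<^esub>}"
  moreover have "submodule {\<zero>\<^bsub>L\<^esub>} R L"
    by (rule submoduleI) auto
  ultimately have "lin_span R L S \<subseteq> {\<zero>\<^bsub>L\<^esub>}"
    unfolding lin_span_def by blast
  moreover have "\<zero>\<^bsub>L\<^esub> \<in> lin_span R L S"
    using subgroup.one_closed submodule.axioms(1) by (fastforce simp: lin_span_def)
  ultimately show "lin_span R L S = {\<zero>\<^bsub>L\<^esub>}"
    by blast
qed

lemma foldl_bracket_closed:
  "\<lbrakk>u \<in> carrier L; set ys \<subseteq> carrier L\<rbrakk> \<Longrightarrow> foldl (bracket L) u ys \<in> carrier L"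
  by (induction ys arbitrary: u) (auto intro: bracket_closed)

lemma comm_span_eq_zero_iff:
  assumes "U \<subseteq> carrier L" "K \<subseteq> carrier L"
  shows "comm_span R L U K n = {\<zero>\<^bsub>L\<^esub>} \<longleftrightarrow>
    (\<forall>u\<in>U. \<forall>ys. set ys \<subseteq> K \<longrightarrow> length ys = n \<longrightarrow> foldl (bracket L) u ys = \<zero>\<^bsub>L\<^esub>)"
proof -
  have "{foldl (bracket L) u ys |u ys. u \<in> U \<and> set ys \<subseteq> K \<and> length ys = n} \<subseteq> carrier L"
    using assms foldl_bracket_closed by blast
  from lin_span_eq_zero_iff[OF this] show ?thesis
    unfolding comm_span_def by (auto simp: subset_iff)
qed

lemma lie_ring: "lie_ring L (bracket L)"
  by unfold_locales
    (auto intro: bracket_closed bracket_add_left bracket_add_right bracket_self jacobi)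

end

sublocale lie_algebra \<subseteq> LR: lie_ring L "bracket L"
  by (rule lie_ring)

text \<open>
  A family of submodules without any condition on their sum: the existence and the uniqueness of
  decompositions are studied separately.
\<close>

locale component_family = lie_algebra R L
  for R :: "'r ring" and L :: "('r, 'l) lie_algebra" +
  fixes I :: "'a set" and C :: "'a \<Rightarrow> 'l set"
  assumes component_submodule: "a \<in> I \<Longrightarrow> submodule (C a) R L"
begin

lemma component_subset: "\<lbrakk>a \<in> I; x \<in> C a\<rbrakk> \<Longrightarrow> x \<in> carrier L"
  using submoduleE(1)[OF component_submodule] by blast

lemma component_is_addsub: "a \<in> I \<Longrightarrow> LR.addsub (C a)"
  using submoduleE[OF component_submodule] subgroup.one_closed[OF submodule.axioms(1)[OF component_submodule]]
  by (intro LR.addsubI) auto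

text \<open>
  The formula of the axiom \<open>direct_sum\<close>.
\<close>

definition decomposition :: "('a \<Rightarrow> 'l) \<Rightarrow> 'l \<Rightarrow> bool" where
  "decomposition f x \<longleftrightarrow> f \<in> (\<Pi>\<^sub>E a\<in>I. C a) \<and> finite {a \<in> I. f a \<noteq> \<zero>\<^bsub>L\<^esub>} \<and>
     x = (\<Oplus>\<^bsub>L\<^esub>a\<in>{a \<in> I. f a \<noteq> \<zero>\<^bsub>L\<^esub>}. f a)"

lemma decomposition_finsum:
  assumes "f \<in> (\<Pi>\<^sub>E a\<in>I. C a)" "finite S" "S \<subseteq> I" "\<And>a. a \<in> I - S \<Longrightarrow> f a = \<zero>\<^bsub>L\<^esub>"
  shows "decomposition f (\<Oplus>\<^bsub>L\<^esub>a\<in>S. f a)"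
proof -
  have fC: "f a \<in> carrier L" if "a \<in> I" for a
    using assms(1) that component_subset by blast
  have sub: "{a \<in> I. f a \<noteq> \<zero>\<^bsub>L\<^esub>} \<subseteq> S"
    using assms(4) by blast
  have "(\<Oplus>\<^bsub>L\<^esub>a\<in>{a \<in> I. f a \<noteq> \<zero>\<^bsub>L\<^esub>}. f a) = (\<Oplus>\<^bsub>L\<^esub>a\<in>S. f a)"
    by (rule M.add.finprod_mono_neutral_cong_left) (use assms sub fC in auto)
  then show ?thesis
    unfolding decomposition_def using assms(1) finite_subset[OF sub assms(2)] by simp
qed

lemma decomposition_sum_over:
  assumes "decomposition f x" "finite S" "S \<subseteq> I" "{a \<in> I. f a \<noteq> \<zero>\<^bsub>L\<^esub>} \<subseteq> S"
  shows "x = (\<Oplus>\<^bsub>L\<^esub>a\<in>S. f a)"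
proof -
  have "f a \<in> carrier L" if "a \<in> I" for a
    using assms(1) that component_subset unfolding decomposition_def by blast
  then have "(\<Oplus>\<^bsub>L\<^esub>a\<in>{a \<in> I. f a \<noteq> \<zero>\<^bsub>L\<^esub>}. f a) = (\<Oplus>\<^bsub>L\<^esub>a\<in>S. f a)"
    by (intro M.add.finprod_mono_neutral_cong_left) (use assms in auto)
  then show ?thesis
    using assms(1) unfolding decomposition_def by simp
qed

lemma decomposition_add:
  assumes "decomposition f x" "decomposition g y"
  shows "decomposition (\<lambda>a\<in>I. f a \<oplus>\<^bsub>L\<^esub> g a) (x \<oplus>\<^bsub>L\<^esub> y)"
proof -
  let ?S = "{a \<in> I. f a \<noteq> \<zero>\<^bsub>L\<^esub>} \<union> {a \<in> I. g a \<noteq> \<zero>\<^bsub>L\<^esub>}"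
  have S: "finite ?S" "?S \<subseteq> I"
    using assms by (auto simp: decomposition_def)
  have C: "f a \<in> C a" "g a \<in> C a" if "a \<in> I" for a
    using assms that by (auto simp: decomposition_def)
  have Cc: "f a \<in> carrier L" "g a \<in> carrier L" if "a \<in> I" for a
    using C component_subset that by blast+
  then have fg: "f \<in> ?S \<rightarrow> carrier L" "g \<in> ?S \<rightarrow> carrier L"
    by auto
  have "x \<oplus>\<^bsub>L\<^esub> y = (\<Oplus>\<^bsub>L\<^esub>a\<in>?S. f a) \<oplus>\<^bsub>L\<^esub> (\<Oplus>\<^bsub>L\<^esub>a\<in>?S. g a)"
    using decomposition_sum_over[OF assms(1) S] decomposition_sum_over[OF assms(2) S] by auto
  also have "\<dots> = (\<Oplus>\<^bsub>L\<^esub>a\<in>?S. f a \<oplus>\<^bsub>L\<^esub> g a)"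
    by (rule M.finsum_addf[OF fg, symmetric])
  also have "\<dots> = (\<Oplus>\<^bsub>L\<^esub>a\<in>?S. (\<lambda>a\<in>I. f a \<oplus>\<^bsub>L\<^esub> g a) a)"
    using Cc by (intro M.finsum_cong') auto
  finally have eq: "x \<oplus>\<^bsub>L\<^esub> y = (\<Oplus>\<^bsub>L\<^esub>a\<in>?S. (\<lambda>a\<in>I. f a \<oplus>\<^bsub>L\<^esub> g a) a)" .
  show ?thesis
    unfolding eq
  proof (rule decomposition_finsum[OF _ S])
    show "(\<lambda>a\<in>I. f a \<oplus>\<^bsub>L\<^esub> g a) \<in> (\<Pi>\<^sub>E a\<in>I. C a)"
      using C LR.addsubD(3)[OF component_is_addsub] by auto
  qed auto
qed

lemma decomposition_neg:
  assumes "decomposition f x"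
  shows "decomposition (\<lambda>a\<in>I. \<ominus>\<^bsub>L\<^esub> f a) (\<ominus>\<^bsub>L\<^esub> x)"
proof -
  let ?S = "{a \<in> I. f a \<noteq> \<zero>\<^bsub>L\<^esub>}"
  have S: "finite ?S" "?S \<subseteq> I"
    using assms by (auto simp: decomposition_def)
  have C: "f a \<in> C a" if "a \<in> I" for a
    using assms that by (auto simp: decomposition_def)
  have Cc: "f a \<in> carrier L" if "a \<in> I" for a
    using C component_subset that by blast
  then have f: "f \<in> ?S \<rightarrow> carrier L"
    by auto
  have x: "x = (\<Oplus>\<^bsub>L\<^esub>a\<in>?S. f a)" "x \<in> carrier L"
    using assms f by (auto simp: decomposition_def intro: M.finsum_closed)
  have "(\<Oplus>\<^bsub>L\<^esub>a\<in>?S. \<ominus>\<^bsub>L\<^esub> f a) \<oplus>\<^bsub>L\<^esub> x = (\<Oplus>\<^bsub>L\<^esub>a\<in>?S. \<ominus>\<^bsub>L\<^esub> f a \<oplus>\<^bsub>L\<^esub> f a)"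
    unfolding x(1) using Cc by (intro M.finsum_addf[symmetric]) auto
  also have "\<dots> = (\<Oplus>\<^bsub>L\<^esub>a\<in>?S. \<zero>\<^bsub>L\<^esub>)"
    using Cc by (intro M.finsum_cong') (auto simp: M.l_neg)
  finally have "(\<Oplus>\<^bsub>L\<^esub>a\<in>?S. \<ominus>\<^bsub>L\<^esub> f a) \<oplus>\<^bsub>L\<^esub> x = \<zero>\<^bsub>L\<^esub>"
    by simp
  then have "\<ominus>\<^bsub>L\<^esub> x = (\<Oplus>\<^bsub>L\<^esub>a\<in>?S. \<ominus>\<^bsub>L\<^esub> f a)"
    using x(2) Cc by (intro M.minus_equality) (auto intro!: M.finsum_closed)
  also have "\<dots> = (\<Oplus>\<^bsub>L\<^esub>a\<in>?S. (\<lambda>a\<in>I. \<ominus>\<^bsub>L\<^esub> f a) a)"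
    using Cc by (intro M.finsum_cong') auto
  finally have eq: "\<ominus>\<^bsub>L\<^esub> x = (\<Oplus>\<^bsub>L\<^esub>a\<in>?S. (\<lambda>a\<in>I. \<ominus>\<^bsub>L\<^esub> f a) a)" .
  show ?thesis
    unfolding eq
  proof (rule decomposition_finsum[OF _ S])
    show "(\<lambda>a\<in>I. \<ominus>\<^bsub>L\<^esub> f a) \<in> (\<Pi>\<^sub>E a\<in>I. C a)"
      using C LR.addsubD(4)[OF component_is_addsub] by auto
  qed auto
qed

lemma decomposition_single:
  assumes "a \<in> I" "x \<in> C a"
  shows "decomposition (\<lambda>b\<in>I. if b = a then x else \<zero>\<^bsub>L\<^esub>) x"
proof -
  let ?f = "\<lambda>b\<in>I. if b = a then x else \<zero>\<^bsub>L\<^esub>"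
  have x: "x \<in> carrier L"
    using assms component_subset by blast
  have "decomposition ?f (\<Oplus>\<^bsub>L\<^esub>b\<in>{a}. ?f b)"
    using assms LR.addsubD(2)[OF component_is_addsub] by (intro decomposition_finsum) auto
  then show ?thesis
    using x assms(1) by (simp add: M.finsum_insert)
qed

lemma aspan_decomposition:
  assumes B: "B \<subseteq> I" and x: "x \<in> LR.aspan (\<Union>b\<in>B. C b)"
  shows "\<exists>f. decomposition f x \<and> (\<forall>a\<in>I - B. f a = \<zero>\<^bsub>L\<^esub>)"
  using x
proof induction
  case aspan_zero
  have "decomposition (\<lambda>a\<in>I. \<zero>\<^bsub>L\<^esub>) (\<Oplus>\<^bsub>L\<^esub>a\<in>{}. (\<lambda>a\<in>I. \<zero>\<^bsub>L\<^esub>) a)"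
    using LR.addsubD(2)[OF component_is_addsub] by (intro decomposition_finsum) auto
  then have "decomposition (\<lambda>a\<in>I. \<zero>\<^bsub>L\<^esub>) \<zero>\<^bsub>L\<^esub>"
    by simp
  then show ?case
    by (intro exI conjI) auto
next
  case (aspan_base x)
  then obtain b where "b \<in> B" "x \<in> C b"
    by blast
  then show ?case
    using decomposition_single[of b x] B by (intro exI conjI) auto
next
  case (aspan_add x y)
  then obtain f g where "decomposition f x \<and> (\<forall>a\<in>I - B. f a = \<zero>\<^bsub>L\<^esub>)"
    "decomposition g y \<and> (\<forall>a\<in>I - B. g a = \<zero>\<^bsub>L\<^esub>)"
    by (elim exE)
  then show ?case
    by (intro exI[of _ "\<lambda>a\<in>I. f a \<oplus>\<^bsub>L\<^esub> g a"] conjI decomposition_add) auto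
next
  case (aspan_neg x)
  then obtain f where "decomposition f x \<and> (\<forall>a\<in>I - B. f a = \<zero>\<^bsub>L\<^esub>)"
    by (elim exE)
  then show ?case
    by (intro exI[of _ "\<lambda>a\<in>I. \<ominus>\<^bsub>L\<^esub> f a"] conjI decomposition_neg) auto
qed

lemma finsum_in_addsub:
  assumes "LR.addsub S" "finite J" "\<And>i. i \<in> J \<Longrightarrow> f i \<in> S"
  shows "(\<Oplus>\<^bsub>L\<^esub>i\<in>J. f i) \<in> S"
  using assms(2,3)
proof (induction J rule: finite_induct)
  case empty
  then show ?case
    using LR.addsubD(2)[OF assms(1)] by simp
next
  case (insert i J)
  then have "f \<in> J \<rightarrow> carrier L" "f i \<in> carrier L"
    using LR.addsubD(1)[OF assms(1)] by auto
  then show ?case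
    using insert LR.addsubD(3)[OF assms(1)] by (simp add: M.finsum_insert)
qed

text \<open>
  The difference of two decompositions decomposes zero, so each of its terms is minus the sum of
  the others.
\<close>

lemma independent_imp_decomposition_unique:
  assumes ind: "\<And>a x. \<lbrakk>a \<in> I; x \<in> C a; x \<in> LR.aspan (\<Union>b\<in>I - {a}. C b)\<rbrakk> \<Longrightarrow> x = \<zero>\<^bsub>L\<^esub>"
    and f: "decomposition f x" and g: "decomposition g x"
  shows "f = g"
proof -
  let ?d = "\<lambda>a\<in>I. f a \<oplus>\<^bsub>L\<^esub> (\<lambda>a\<in>I. \<ominus>\<^bsub>L\<^esub> g a) a"
  have C: "f a \<in> C a" "g a \<in> C a" if "a \<in> I" for a
    using f g that by (auto simp: decomposition_def)
  have x: "x \<in> carrier L"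
  proof -
    have "(\<Oplus>\<^bsub>L\<^esub>a\<in>{a \<in> I. f a \<noteq> \<zero>\<^bsub>L\<^esub>}. f a) \<in> carrier L"
      using C component_subset by (intro M.finsum_closed) auto
    then show ?thesis
      using f by (simp add: decomposition_def)
  qed
  have d: "decomposition ?d \<zero>\<^bsub>L\<^esub>"
    using decomposition_add[OF f decomposition_neg[OF g]] x by (simp only: M.r_neg)
  define S where "S = {a \<in> I. ?d a \<noteq> \<zero>\<^bsub>L\<^esub>}"
  have S: "finite S" "S \<subseteq> I" and sum: "\<zero>\<^bsub>L\<^esub> = (\<Oplus>\<^bsub>L\<^esub>a\<in>S. ?d a)"
    using d unfolding S_def decomposition_def by blast+
  have dC: "?d a \<in> C a" if "a \<in> I" for a
    using d that unfolding decomposition_def by (intro PiE_mem[of ?d I C]) blast+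
  have zero: "?d a = \<zero>\<^bsub>L\<^esub>" if a: "a \<in> I" for a
  proof (rule ccontr)
    assume "?d a \<noteq> \<zero>\<^bsub>L\<^esub>"
    then have aS: "a \<in> S"
      using a by (simp add: S_def)
    have dc: "?d b \<in> carrier L" if "b \<in> I" for b
      using dC[OF that] component_subset that by blast
    let ?r = "\<Oplus>\<^bsub>L\<^esub>b\<in>S - {a}. ?d b"
    have "?r \<in> LR.aspan (\<Union>b\<in>I - {a}. C b)"
    proof (rule finsum_in_addsub[OF LR.addsub_aspan])
      fix b assume "b \<in> S - {a}"
      then have "b \<in> I - {a}"
        using S by blast
      then show "?d b \<in> LR.aspan (\<Union>b\<in>I - {a}. C b)"
        using dC[of b] dc[of b] by (intro LR.aspan_base UN_I) auto
    qed (use S in simp)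
    then have r: "\<ominus>\<^bsub>L\<^esub> ?r \<in> LR.aspan (\<Union>b\<in>I - {a}. C b)" "?r \<in> carrier L"
      by (auto intro: LR.aspan_neg LR.aspan_closed)
    have "(\<Oplus>\<^bsub>L\<^esub>b\<in>insert a (S - {a}). ?d b) = ?d a \<oplus>\<^bsub>L\<^esub> ?r"
      using S dc a by (intro M.finsum_insert) (auto simp del: restrict_apply)
    then have "?d a \<oplus>\<^bsub>L\<^esub> ?r = \<zero>\<^bsub>L\<^esub>"
      using sum aS by (simp only: insert_Diff)
    then have "?d a = \<ominus>\<^bsub>L\<^esub> ?r"
      using dc[OF a] r(2) by (simp only: M.minus_equality)
    then have "?d a \<in> LR.aspan (\<Union>b\<in>I - {a}. C b)"
      using r(1) by (simp only:)
    then show False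
      using ind[OF a dC[OF a]] \<open>?d a \<noteq> \<zero>\<^bsub>L\<^esub>\<close> by blast
  qed
  show "f = g"
  proof (rule extensionalityI)
    show "f \<in> extensional I" "g \<in> extensional I"
      using f g by (auto simp: decomposition_def PiE_def)
    fix a assume a: "a \<in> I"
    then have "f a \<oplus>\<^bsub>L\<^esub> \<ominus>\<^bsub>L\<^esub> g a = \<zero>\<^bsub>L\<^esub>"
      using zero[OF a] by simp
    moreover have "f a \<in> carrier L" "g a \<in> carrier L"
      using C a component_subset by blast+
    ultimately show "f a = g a"
      using M.minus_equality[of "f a" "\<ominus>\<^bsub>L\<^esub> g a"] by simp
  qed
qed

end

sublocale graded_lie_algebra \<subseteq> component_family R L "carrier A" C
  by (intro component_family.intro component_family_axioms.intro lie_algebra_axioms)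
    (rule component_submodule)

context graded_lie_algebra
begin

lemma decomposition_unique: "\<lbrakk>decomposition f x; decomposition g x; x \<in> carrier L\<rbrakk> \<Longrightarrow> f = g"
  using direct_sum[of x] unfolding decomposition_def by blast

lemma graded_lie_ring: "graded_lie_ring L (bracket L) A C"
proof unfold_locales
  show "LR.addsub (C a)" if "a \<in> carrier A" for a
    using that by (rule component_is_addsub)
  show "bracket L x y \<in> C (a \<oplus>\<^bsub>A\<^esub> b)" if "a \<in> carrier A" "b \<in> carrier A" "x \<in> C a" "y \<in> C b" for a b x y
    using that by (rule bracket_component)
  show "carrier L \<subseteq> LR.aspan (\<Union>a\<in>carrier A. C a)"
  proof
    fix x assume "x \<in> carrier L"
    then obtain f where f: "decomposition f x"
      using direct_sum[of x] unfolding decomposition_def by blast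
    have "(\<Oplus>\<^bsub>L\<^esub>a\<in>{a \<in> carrier A. f a \<noteq> \<zero>\<^bsub>L\<^esub>}. f a) \<in> LR.aspan (\<Union>a\<in>carrier A. C a)"
    proof (rule finsum_in_addsub[OF LR.addsub_aspan])
      show "finite {a \<in> carrier A. f a \<noteq> \<zero>\<^bsub>L\<^esub>}"
        using f by (simp add: decomposition_def)
      fix a assume "a \<in> {a \<in> carrier A. f a \<noteq> \<zero>\<^bsub>L\<^esub>}"
      then have "a \<in> carrier A" "f a \<in> C a"
        using f by (auto simp: decomposition_def)
      then show "f a \<in> LR.aspan (\<Union>a\<in>carrier A. C a)"
        using component_subset by (intro LR.aspan_base) auto
    qed
    then show "x \<in> LR.aspan (\<Union>a\<in>carrier A. C a)"
      using f by (simp add: decomposition_def)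
  qed
  show "x = \<zero>\<^bsub>L\<^esub>" if a: "a \<in> carrier A" "x \<in> C a" and x: "x \<in> LR.aspan (\<Union>b\<in>carrier A - {a}. C b)" for a x
  proof -
    obtain f where f: "decomposition f x" "\<forall>b\<in>carrier A - (carrier A - {a}). f b = \<zero>\<^bsub>L\<^esub>"
      using aspan_decomposition[OF _ x] by auto
    have "f = (\<lambda>b\<in>carrier A. if b = a then x else \<zero>\<^bsub>L\<^esub>)"
      using decomposition_unique[OF f(1) decomposition_single[OF a]] component_subset[OF a] by simp
    then show ?thesis
      using f(2) a(1) by auto
  qed
qed

end

text \<open>
  The converse of the previous lemma, by which direct sums can be recognised without handling
  families of components.
\<close>

lemma graded_lie_algebraI:
  fixes A :: "'a ring"
  assumes "component_family R L (carrier A) C" "abelian_group A"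
    and br: "\<And>a b x y. \<lbrakk>a \<in> carrier A; b \<in> carrier A; x \<in> C a; y \<in> C b\<rbrakk> \<Longrightarrow> bracket L x y \<in> C (a \<oplus>\<^bsub>A\<^esub> b)"
    and span: "carrier L \<subseteq> lie_ring.aspan L (\<Union>a\<in>carrier A. C a)"
    and ind: "\<And>a x. \<lbrakk>a \<in> carrier A; x \<in> C a; x \<in> lie_ring.aspan L (\<Union>b\<in>carrier A - {a}. C b)\<rbrakk> \<Longrightarrow> x = \<zero>\<^bsub>L\<^esub>"
  shows "graded_lie_algebra R A L C"
proof -
  interpret F: component_family R L "carrier A" C
    by fact
  interpret A: abelian_group A
    by fact
  show ?thesis
  proof (intro graded_lie_algebra.intro graded_lie_algebra_axioms.intro F.lie_algebra_axioms
      assms(2))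
    show "submodule (C a) R L" if "a \<in> carrier A" for a
      using that by (rule F.component_submodule)
    show "bracket L x y \<in> C (a \<oplus>\<^bsub>A\<^esub> b)" if "a \<in> carrier A" "b \<in> carrier A" "x \<in> C a" "y \<in> C b" for a b x y
      using that by (rule br)
    fix x assume "x \<in> carrier L"
    then obtain f where "F.decomposition f x"
      using F.aspan_decomposition[OF order_refl] span by blast
    moreover have "g = f" if "F.decomposition g x" for g
      using F.independent_imp_decomposition_unique[OF ind that \<open>F.decomposition f x\<close>] .
    ultimately show "\<exists>!f. f \<in> (\<Pi>\<^sub>E a\<in>carrier A. C a) \<and> finite {a \<in> carrier A. f a \<noteq> \<zero>\<^bsub>L\<^esub>} \<and>
          x = (\<Oplus>\<^bsub>L\<^esub>a\<in>{a \<in> carrier A. f a \<noteq> \<zero>\<^bsub>L\<^esub>}. f a)"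
      unfolding F.decomposition_def by blast
  qed
qed

context double_automorphism_group
begin

lemma H_auto:
  assumes "h \<in> H"
  shows "h \<in> Bij (carrier L)" "x \<in> carrier L \<Longrightarrow> h x \<in> carrier L"
    "\<lbrakk>x \<in> carrier L; y \<in> carrier L\<rbrakk> \<Longrightarrow> h (x \<oplus>\<^bsub>L\<^esub> y) = h x \<oplus>\<^bsub>L\<^esub> h y"
    "\<lbrakk>x \<in> carrier L; y \<in> carrier L\<rbrakk> \<Longrightarrow> h (bracket L x y) = bracket L (h x) (h y)"
    "inj_on h (carrier L)" "h \<in> extensional (carrier L)"
proof -
  have "h \<in> lie_auto R L"
    using subgroup.subset[OF H_subgroup] assms by (auto simp: Lie_AutoGroup_def)
  then show "h \<in> Bij (carrier L)" "x \<in> carrier L \<Longrightarrow> h x \<in> carrier L"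
    "\<lbrakk>x \<in> carrier L; y \<in> carrier L\<rbrakk> \<Longrightarrow> h (x \<oplus>\<^bsub>L\<^esub> y) = h x \<oplus>\<^bsub>L\<^esub> h y"
    "\<lbrakk>x \<in> carrier L; y \<in> carrier L\<rbrakk> \<Longrightarrow> h (bracket L x y) = bracket L (h x) (h y)"
    "inj_on h (carrier L)" "h \<in> extensional (carrier L)"
    using Bij_imp_funcset by (auto simp: lie_auto_def Bij_def bij_betw_def)
qed

lemma H_compose: "\<lbrakk>g \<in> H; h \<in> H\<rbrakk> \<Longrightarrow> compose (carrier L) g h \<in> H"
  using subgroup.m_closed[OF H_subgroup, of g h] H_auto(1)
  by (simp add: Lie_AutoGroup_def BijGroup_def)

lemma one_eq: "\<one>\<^bsub>Lie_AutoGroup R L\<^esub> = (\<lambda>x\<in>carrier L. x)"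
  by (simp add: Lie_AutoGroup_def BijGroup_def)

lemma one_in_H: "(\<lambda>x\<in>carrier L. x) \<in> H"
  using subgroup.one_closed[OF H_subgroup] by (simp add: one_eq)

lemma act_auto:
  assumes "h \<in> H"
  shows "act h \<in> Bij (carrier A)" "a \<in> carrier A \<Longrightarrow> act h a \<in> carrier A"
    "\<lbrakk>a \<in> carrier A; b \<in> carrier A\<rbrakk> \<Longrightarrow> act h (a \<oplus>\<^bsub>A\<^esub> b) = act h a \<oplus>\<^bsub>A\<^esub> act h b"
    "inj_on (act h) (carrier A)" "act h \<in> extensional (carrier A)"
proof -
  have "act h \<in> auto (add_monoid A)"
    using act_hom assms by (auto simp: hom_def AutoGroup_def)
  then show "act h \<in> Bij (carrier A)" "a \<in> carrier A \<Longrightarrow> act h a \<in> carrier A"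
    "\<lbrakk>a \<in> carrier A; b \<in> carrier A\<rbrakk> \<Longrightarrow> act h (a \<oplus>\<^bsub>A\<^esub> b) = act h a \<oplus>\<^bsub>A\<^esub> act h b"
    "inj_on (act h) (carrier A)" "act h \<in> extensional (carrier A)"
    by (auto simp: auto_def hom_def Bij_def bij_betw_def)
qed

lemma act_compose:
  assumes "g \<in> H" "h \<in> H" "a \<in> carrier A"
  shows "act (compose (carrier L) g h) a = act g (act h a)"
proof -
  have "act (g \<otimes>\<^bsub>Lie_AutoGroup R L\<^esub> h) = act g \<otimes>\<^bsub>AutoGroup (add_monoid A)\<^esub> act h"
    using act_hom assms(1,2) by (simp add: hom_def)
  then show ?thesis
    using assms H_auto(1) act_auto(1)
    by (simp add: Lie_AutoGroup_def AutoGroup_def BijGroup_def compose_def)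
qed

text \<open>
  The identity is idempotent, so its action is an idempotent injection.
\<close>

lemma act_one: "a \<in> carrier A \<Longrightarrow> act (\<lambda>x\<in>carrier L. x) a = a"
proof -
  assume a: "a \<in> carrier A"
  let ?e = "\<lambda>x\<in>carrier L. x"
  have "compose (carrier L) ?e ?e = ?e"
    by (auto simp: compose_def)
  then have "act ?e (act ?e a) = act ?e a"
    using act_compose[OF one_in_H one_in_H a] by simp
  then show ?thesis
    using inj_onD[OF act_auto(4)[OF one_in_H]] act_auto(2)[OF one_in_H] a by blast
qed

lemma H_zero: "g \<in> H \<Longrightarrow> g \<zero>\<^bsub>L\<^esub> = \<zero>\<^bsub>L\<^esub>"
  using H_auto(3)[of g "\<zero>\<^bsub>L\<^esub>" "\<zero>\<^bsub>L\<^esub>"] H_auto(2)[of g "\<zero>\<^bsub>L\<^esub>"]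
  by (simp add: M.add.l_cancel_one')

lemma H_neg:
  assumes "g \<in> H" "x \<in> carrier L"
  shows "g (\<ominus>\<^bsub>L\<^esub> x) = \<ominus>\<^bsub>L\<^esub> g x"
proof -
  have "g (\<ominus>\<^bsub>L\<^esub> x) \<oplus>\<^bsub>L\<^esub> g x = \<zero>\<^bsub>L\<^esub>"
    using H_auto(3)[OF assms(1), of "\<ominus>\<^bsub>L\<^esub> x" x] H_zero[OF assms(1)] assms(2) by (simp add: M.l_neg)
  then show ?thesis
    using H_auto(2)[OF assms(1)] assms(2) by (simp add: M.minus_equality)
qed

lemma auto_finsum:
  assumes "g \<in> H" "finite I" "f \<in> I \<rightarrow> carrier L"
  shows "g (\<Oplus>\<^bsub>L\<^esub>i\<in>I. f i) = (\<Oplus>\<^bsub>L\<^esub>i\<in>I. g (f i))"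
  using assms(2,3)
proof (induction I rule: finite_induct)
  case empty
  with H_zero[OF assms(1)] show ?case
    by simp
next
  case (insert i I)
  then have f: "f \<in> I \<rightarrow> carrier L" "f i \<in> carrier L" "(\<lambda>i. g (f i)) \<in> I \<rightarrow> carrier L"
    using H_auto(2)[OF assms(1)] by auto
  then have "g (\<Oplus>\<^bsub>L\<^esub>i\<in>insert i I. f i) = g (f i) \<oplus>\<^bsub>L\<^esub> g (\<Oplus>\<^bsub>L\<^esub>i\<in>I. f i)"
    using insert H_auto(3)[OF assms(1)] by (simp add: M.finsum_closed)
  then show ?case
    using insert f H_auto(2)[OF assms(1)] by simp
qed

lemma compose_permutes:
  assumes "finite H" and g: "g \<in> H"
  shows "inj_on (compose (carrier L) g) H" "compose (carrier L) g ` H = H"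
proof -
  show inj: "inj_on (compose (carrier L) g) H"
  proof (rule inj_onI, rule extensionalityI)
    fix h h' assume h: "h \<in> H" "h' \<in> H" and eq: "compose (carrier L) g h = compose (carrier L) g h'"
    show "h \<in> extensional (carrier L)" "h' \<in> extensional (carrier L)"
      using H_auto(6) h by blast+
    fix y assume y: "y \<in> carrier L"
    have "g (h y) = g (h' y)"
      using fun_cong[OF eq, of y] y by (simp add: compose_def)
    then show "h y = h' y"
      using inj_onD[OF H_auto(5)[OF g]] H_auto(2) h y by blast
  qed
  have "compose (carrier L) g ` H \<subseteq> H"
    using H_compose[OF g] by blast
  then show "compose (carrier L) g ` H = H"
    using assms(1) inj by (intro endo_inj_surj)
qed

text \<open>
  Left multiplication permutes \<open>H\<close>.
\<close>

lemma orbit_sum_fixed: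
  assumes "finite H" "x \<in> carrier L"
  shows "(\<Oplus>\<^bsub>L\<^esub>h\<in>H. h x) \<in> fixed_subalgebra L H"
proof -
  have hx: "(\<lambda>h. h x) \<in> H \<rightarrow> carrier L"
    using H_auto(2) assms(2) by blast
  have "g (\<Oplus>\<^bsub>L\<^esub>h\<in>H. h x) = (\<Oplus>\<^bsub>L\<^esub>h\<in>H. h x)" if g: "g \<in> H" for g
  proof -
    note inj = compose_permutes(1)[OF assms(1) g] and img = compose_permutes(2)[OF assms(1) g]
    have "g (\<Oplus>\<^bsub>L\<^esub>h\<in>H. h x) = (\<Oplus>\<^bsub>L\<^esub>h\<in>H. compose (carrier L) g h x)"
      using auto_finsum[OF g assms(1) hx] assms(2) by (simp add: compose_def)
    also have "\<dots> = (\<Oplus>\<^bsub>L\<^esub>h\<in>compose (carrier L) g ` H. h x)"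
      using hx img inj by (intro M.finsum_reindex[symmetric]) auto
    finally show ?thesis
      by (simp add: img)
  qed
  then show ?thesis
    using hx by (simp add: fixed_subalgebra_def M.finsum_closed)
qed

end

text \<open>
  The orbit sum of \<open>x\<close> splits into \<open>x\<close> and the sum of the conjugates by
  nontrivial elements of \<open>H\<close>.
\<close>

theorem admissible_class_bound:
  fixes R :: "'r ring" and A :: "'a ring" and L :: "('r, 'l) lie_algebra"
  assumes adm: "admissible q k c R A L C H act"
  shows "nilpotent_class_le R L (carrier L) (class_bound q k c)"
proof -
  interpret D: double_automorphism_group R A L C H act
    using adm by (simp add: admissible_def)
  have H: "finite H" "card H = q"
    using adm by (simp_all add: admissible_def)
  let ?e = "\<lambda>x\<in>carrier L. x"
  have fixc: "fixed_subalgebra L H \<subseteq> carrier L"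
    by (auto simp: fixed_subalgebra_def)
  interpret G: graded_lie_ring L "bracket L" A C
    by (rule D.graded_lie_ring)
  interpret S: semiregular_graded_lie_ring L "bracket L" A C k H ?e act "fixed_subalgebra L H" c
  proof unfold_locales
    show "foldl (bracket L) x xs = \<zero>\<^bsub>L\<^esub>"
      if "a \<in> carrier A" "x \<in> carrier L" "set xs \<subseteq> C a" "length xs = k" for a x xs
    proof -
      have "comm_span R L (carrier L) (C a) k = {\<zero>\<^bsub>L\<^esub>}"
        using adm that(1) by (simp add: admissible_def ad_nilpotent_def)
      then show ?thesis
        using D.comm_span_eq_zero_iff[of "carrier L" "C a"] D.component_subset[OF that(1)] that by blast
    qed
    show "finite H" by fact
    show "?e \<in> H" by (rule D.one_in_H)
    show "act h a \<in> carrier A" if "h \<in> H" "a \<in> carrier A" for h a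
      using that by (rule D.act_auto)
    show "act h (a \<oplus>\<^bsub>A\<^esub> b) = act h a \<oplus>\<^bsub>A\<^esub> act h b" if "h \<in> H" "a \<in> carrier A" "b \<in> carrier A" for h a b
      using that by (rule D.act_auto)
    show "act ?e a = a" if "a \<in> carrier A" for a
      using that by (rule D.act_one)
    show "a = \<zero>\<^bsub>A\<^esub>" if "h \<in> H" "h \<noteq> ?e" "a \<in> carrier A" "act h a = a" for h a
    proof -
      have "{a \<in> carrier A. act h a = a} = {\<zero>\<^bsub>A\<^esub>}"
        using adm that(1,2) by (auto simp: admissible_def D.one_eq)
      then show ?thesis
        using that(3,4) by blast
    qed
    show "fixed_subalgebra L H \<subseteq> carrier L" by fact
    show "\<exists>s\<in>D.LR.aspan (\<Union>h\<in>H - {?e}. C (act h a)). x \<oplus>\<^bsub>L\<^esub> s \<in> fixed_subalgebra L H"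
      if a: "a \<in> carrier A" and x: "x \<in> C a" for a x
    proof -
      have xc: "x \<in> carrier L"
        using D.component_subset a x by blast
      let ?s = "\<Oplus>\<^bsub>L\<^esub>h\<in>H - {?e}. h x"
      have hx: "(\<lambda>h. h x) \<in> H - {?e} \<rightarrow> carrier L"
        using D.H_auto(2) xc by blast
      have "?s \<in> D.LR.aspan (\<Union>h\<in>H - {?e}. C (act h a))"
      proof (rule D.finsum_in_addsub[OF D.LR.addsub_aspan])
        fix h assume h: "h \<in> H - {?e}"
        then have "h x \<in> C (act h a)"
          using D.permutes_components[of h a] a x by blast
        then show "h x \<in> D.LR.aspan (\<Union>h\<in>H - {?e}. C (act h a))"
          using h D.H_auto(2) xc by (intro D.LR.aspan_base) auto
      qed (use H in simp)
      moreover have "(\<Oplus>\<^bsub>L\<^esub>h\<in>insert ?e (H - {?e}). h x) = ?e x \<oplus>\<^bsub>L\<^esub> ?s"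
        using hx xc H by (intro D.M.finsum_insert) auto
      then have "x \<oplus>\<^bsub>L\<^esub> ?s = (\<Oplus>\<^bsub>L\<^esub>h\<in>H. h x)"
        using xc D.one_in_H by (simp add: insert_absorb)
      then have "x \<oplus>\<^bsub>L\<^esub> ?s \<in> fixed_subalgebra L H"
        using D.orbit_sum_fixed[OF H(1) xc] by simp
      ultimately show ?thesis
        by blast
    qed
    show "foldl (bracket L) y ys = \<zero>\<^bsub>L\<^esub>"
      if "y \<in> fixed_subalgebra L H" "set ys \<subseteq> fixed_subalgebra L H" "length ys = c" for y ys
    proof -
      have "comm_span R L (fixed_subalgebra L H) (fixed_subalgebra L H) c = {\<zero>\<^bsub>L\<^esub>}"
        using adm by (simp add: admissible_def nilpotent_class_le_def)
      then show ?thesis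
        using D.comm_span_eq_zero_iff[OF fixc fixc] that by blast
    qed
  qed
  show ?thesis
    unfolding nilpotent_class_le_def using S.comm_class_bound H(2)
    by (subst D.comm_span_eq_zero_iff) auto
qed

lemma nilpotency_bound_int:
  fixes R :: "int ring" and A :: "int ring" and L :: "(int, int) lie_algebra"
  assumes "admissible q k c R A L C H act"
  shows "nilpotent_class_le R L (carrier L) (nilpotency_bound q k c)"
proof -
  have "\<exists>N. \<forall>(R :: int ring) (A :: int ring) (L :: (int, int) lie_algebra) C H act.
      admissible q k c R A L C H act \<longrightarrow> nilpotent_class_le R L (carrier L) N"
    using admissible_class_bound by blast
  from LeastI_ex[OF this] show ?thesis
    using assms unfolding nilpotency_bound_def by blast
qed

section \<open>Transport of a substructure to other carriers\<close>

context lie_ring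
begin

lemma int_multiple_step:
  assumes "x \<in> carrier L"
  shows "[(0::int)] \<cdot> x = \<zero>" "[(n + 1 :: int)] \<cdot> x = [n] \<cdot> x \<oplus> x" "[(n - 1 :: int)] \<cdot> x = [n] \<cdot> x \<oplus> \<ominus> x"
proof -
  have pow_add: "[(i + j)] \<cdot> x = [i] \<cdot> x \<oplus> [j] \<cdot> x" for i j :: int
    using assms by (rule add.int_pow_mult)
  have one: "[(1::int)] \<cdot> x = x"
    using assms by simp
  have neg_one: "[(- 1::int)] \<cdot> x = \<ominus> x"
    using add.int_pow_neg[OF assms, of 1] one by simp
  show "[(0::int)] \<cdot> x = \<zero>"
    using pow_add[of 0 0] assms by (simp add: add.l_cancel_one')
  show "[(n + 1 :: int)] \<cdot> x = [n] \<cdot> x \<oplus> x"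
    using pow_add[of n 1] one by simp
  show "[(n - 1 :: int)] \<cdot> x = [n] \<cdot> x \<oplus> \<ominus> x"
    using pow_add[of n "- 1"] neg_one by simp
qed

lemma addsub_int_multiple:
  assumes "addsub S" "x \<in> S"
  shows "[(n::int)] \<cdot> x \<in> S"
proof (induction n rule: int_induct[where k = 0])
  case base
  then show ?case
    using int_multiple_step(1)[OF addsubD(1)[OF assms]] addsubD(2)[OF assms(1)] by simp
next
  case (step1 i)
  then show ?case
    using int_multiple_step(2)[OF addsubD(1)[OF assms]] addsubD(3)[OF assms(1) _ assms(2)] by simp
next
  case (step2 i)
  then show ?case
    using int_multiple_step(3)[OF addsubD(1)[OF assms]] addsubD(3)[OF assms(1) _ addsubD(4)[OF assms]] by simp
qed

lemma br_int_multiple_left: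
  assumes x: "x \<in> carrier L" and y: "y \<in> carrier L"
  shows "([(n::int)] \<cdot> x) \<bullet> y = [n] \<cdot> (x \<bullet> y)"
proof (induction n rule: int_induct[where k = 0])
  case base
  then show ?case
    using int_multiple_step(1)[OF x] int_multiple_step(1)[of "x \<bullet> y"] x y by simp
next
  case (step1 i)
  then show ?case
    using int_multiple_step(2)[OF x] int_multiple_step(2)[of "x \<bullet> y"] x y
    by (simp add: br_add_left)
next
  case (step2 i)
  then show ?case
    using int_multiple_step(3)[OF x] int_multiple_step(3)[of "x \<bullet> y"] x y
    by (simp add: br_add_left br_neg_left)
qed

lemma br_int_multiple_right:
  assumes x: "x \<in> carrier L" and y: "y \<in> carrier L"
  shows "x \<bullet> ([(n::int)] \<cdot> y) = [n] \<cdot> (x \<bullet> y)"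
proof (induction n rule: int_induct[where k = 0])
  case base
  then show ?case
    using int_multiple_step(1)[OF y] int_multiple_step(1)[of "x \<bullet> y"] x y by simp
next
  case (step1 i)
  then show ?case
    using int_multiple_step(2)[OF y] int_multiple_step(2)[of "x \<bullet> y"] x y
    by (simp add: br_add_right)
next
  case (step2 i)
  then show ?case
    using int_multiple_step(3)[OF y] int_multiple_step(3)[of "x \<bullet> y"] x y
    by (simp add: br_add_right br_neg_right)
qed

end

text \<open>
  The inverse in the group of automorphisms is a definite description and has to be identified
  with the given inverse map.
\<close>

lemma Lie_AutoGroup_subgroupI:
  assumes sub: "H \<subseteq> lie_auto R L" and one: "(\<lambda>x\<in>carrier L. x) \<in> H"
    and comp: "\<And>g h. \<lbrakk>g \<in> H; h \<in> H\<rbrakk> \<Longrightarrow> compose (carrier L) g h \<in> H"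
    and inv: "\<And>g. g \<in> H \<Longrightarrow> \<exists>h\<in>H. \<forall>x\<in>carrier L. g (h x) = x \<and> h (g x) = x"
  shows "subgroup H (Lie_AutoGroup R L)"
proof (rule subgroup.intro)
  let ?G = "Lie_AutoGroup R L"
  have Bij: "g \<in> Bij (carrier L)" if "g \<in> lie_auto R L" for g
    using that by (simp add: lie_auto_def)
  have mult: "g \<otimes>\<^bsub>?G\<^esub> h = compose (carrier L) g h" if "g \<in> lie_auto R L" "h \<in> lie_auto R L" for g h
    using that Bij by (simp add: Lie_AutoGroup_def BijGroup_def)
  have one_comp: "compose (carrier L) g h = (\<lambda>x\<in>carrier L. x)" if "\<And>x. x \<in> carrier L \<Longrightarrow> g (h x) = x" for g h
    using that by (auto simp: compose_def)
  have one_eq: "\<one>\<^bsub>?G\<^esub> = (\<lambda>x\<in>carrier L. x)" and car: "carrier ?G = lie_auto R L"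
    by (simp_all add: Lie_AutoGroup_def BijGroup_def)
  show "H \<subseteq> carrier ?G"
    using sub car by simp
  show "g \<otimes>\<^bsub>?G\<^esub> h \<in> H" if "g \<in> H" "h \<in> H" for g h
    using comp[OF that] mult[of g h] that sub by (simp add: subset_eq)
  show "\<one>\<^bsub>?G\<^esub> \<in> H"
    using one one_eq by simp
  show "inv\<^bsub>?G\<^esub> g \<in> H" if g: "g \<in> H" for g
  proof -
    obtain h where h: "h \<in> H" "\<And>x. x \<in> carrier L \<Longrightarrow> g (h x) = x" "\<And>x. x \<in> carrier L \<Longrightarrow> h (g x) = x"
      using inv[OF g] by blast
    have "inv\<^bsub>?G\<^esub> g = h"
      unfolding m_inv_def
    proof (rule the_equality)
      show "h \<in> carrier ?G \<and> g \<otimes>\<^bsub>?G\<^esub> h = \<one>\<^bsub>?G\<^esub> \<and> h \<otimes>\<^bsub>?G\<^esub> g = \<one>\<^bsub>?G\<^esub>"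
        using mult[of g h] mult[of h g] one_comp[of g h] one_comp[of h g] h g sub car one_eq
        by (simp add: subset_eq)
      fix f assume f: "f \<in> carrier ?G \<and> g \<otimes>\<^bsub>?G\<^esub> f = \<one>\<^bsub>?G\<^esub> \<and> f \<otimes>\<^bsub>?G\<^esub> g = \<one>\<^bsub>?G\<^esub>"
      then have fl: "f \<in> lie_auto R L" and eq: "compose (carrier L) f g = (\<lambda>x\<in>carrier L. x)"
        using mult[of f g] g sub car one_eq by auto
      have hl: "h \<in> lie_auto R L"
        using h(1) sub by blast
      show "f = h"
      proof (rule extensionalityI)
        show "f \<in> extensional (carrier L)" "h \<in> extensional (carrier L)"
          using Bij[OF fl] Bij[OF hl] by (simp_all add: Bij_def)
        fix x assume x: "x \<in> carrier L"
        have hx: "h x \<in> carrier L"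
          using Bij_imp_funcset[OF Bij[OF hl]] x by blast
        have "f (g (h x)) = h x"
          using fun_cong[OF eq, of "h x"] hx by (simp add: compose_def)
        then show "f x = h x"
          using h(2)[OF x] by simp
      qed
    qed
    then show ?thesis
      using h(1) by simp
  qed
qed

context double_automorphism_group
begin

lemma H_int_multiple:
  assumes h: "h \<in> H" and x: "x \<in> carrier L"
  shows "h (add_pow L (n::int) x) = add_pow L n (h x)"
proof (induction n rule: int_induct[where k = 0])
  case base
  then show ?case
    using LR.int_multiple_step(1)[OF x] LR.int_multiple_step(1)[OF H_auto(2)[OF h x]] H_zero[OF h] by simp
next
  case (step1 i)
  then show ?case
    using LR.int_multiple_step(2)[OF x] LR.int_multiple_step(2)[OF H_auto(2)[OF h x]] H_auto(3)[OF h] x by simp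
next
  case (step2 i)
  then show ?case
    using LR.int_multiple_step(3)[OF x] LR.int_multiple_step(3)[OF H_auto(2)[OF h x]] H_auto(3)[OF h] H_neg[OF h] x by simp
qed

lemma ex_inverse:
  assumes "finite H" "g \<in> H"
  shows "\<exists>h\<in>H. \<forall>x\<in>carrier L. g (h x) = x \<and> h (g x) = x"
proof -
  obtain h where h: "h \<in> H" and eq: "compose (carrier L) g h = (\<lambda>x\<in>carrier L. x)"
    using compose_permutes(2)[OF assms] one_in_H by (metis imageE)
  have gh: "g (h x) = x" if "x \<in> carrier L" for x
    using fun_cong[OF eq, of x] that by (simp add: compose_def)
  have "h (g x) = x" if x: "x \<in> carrier L" for x
    using inj_onD[OF H_auto(5)[OF assms(2)] gh[OF H_auto(2)[OF assms(2) x]]] H_auto(2) assms(2) h x by blast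
  then show ?thesis
    using h gh by blast
qed

end

text \<open>
  A Lie subring \<open>L'\<close> and a subgroup \<open>A'\<close>, closed under \<open>H\<close>,
  such that \<open>L'\<close> is generated by its homogeneous elements with degrees in
  \<open>A'\<close> and \<open>H\<close> still acts faithfully on \<open>L'\<close>. The
  injections \<open>p\<close> and \<open>r\<close> rename the elements; all operations are
  transported along them. Over the integers as ring of scalars every subring is a subalgebra.
\<close>

locale restriction = double_automorphism_group R A L C H act
  for R :: "'r ring" and A :: "'a ring" and L :: "('r, 'l) lie_algebra" and C :: "'a \<Rightarrow> 'l set"
    and H :: "('l \<Rightarrow> 'l) set" and act :: "('l \<Rightarrow> 'l) \<Rightarrow> 'a \<Rightarrow> 'a" +
  fixes L' :: "'l set" and A' :: "'a set" and p :: "'l \<Rightarrow> 'i" and r :: "'a \<Rightarrow> 'j"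
  assumes L'_addsub: "LR.addsub L'"
    and L'_br: "\<lbrakk>x \<in> L'; y \<in> L'\<rbrakk> \<Longrightarrow> bracket L x y \<in> L'"
    and L'_H: "\<lbrakk>h \<in> H; x \<in> L'\<rbrakk> \<Longrightarrow> h x \<in> L'"
    and A'_sub: "A' \<subseteq> carrier A" and A'_zero: "\<zero>\<^bsub>A\<^esub> \<in> A'"
    and A'_add: "\<lbrakk>a \<in> A'; b \<in> A'\<rbrakk> \<Longrightarrow> a \<oplus>\<^bsub>A\<^esub> b \<in> A'"
    and A'_neg: "a \<in> A' \<Longrightarrow> \<ominus>\<^bsub>A\<^esub> a \<in> A'"
    and A'_act: "\<lbrakk>h \<in> H; a \<in> A'\<rbrakk> \<Longrightarrow> act h a \<in> A'"
    and L'_span: "L' \<subseteq> LR.aspan (\<Union>a\<in>A'. C a \<inter> L')"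
    and faithful: "\<lbrakk>h \<in> H; h' \<in> H; \<And>x. x \<in> L' \<Longrightarrow> h x = h' x\<rbrakk> \<Longrightarrow> h = h'"
    and p_inj: "inj_on p L'" and r_inj: "inj_on r A'"
    and H_fin: "finite H"
begin

definition p' :: "'i \<Rightarrow> 'l" where "p' = inv_into L' p"
definition r' :: "'j \<Rightarrow> 'a" where "r' = inv_into A' r"

lemma p'_p [simp]: "x \<in> L' \<Longrightarrow> p' (p x) = x"
  by (simp add: p'_def p_inj)

lemma r'_r [simp]: "a \<in> A' \<Longrightarrow> r' (r a) = a"
  by (simp add: r'_def r_inj)

lemma p_eq_iff [simp]: "\<lbrakk>x \<in> L'; y \<in> L'\<rbrakk> \<Longrightarrow> p x = p y \<longleftrightarrow> x = y"
  using p_inj by (rule inj_on_eq_iff)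

lemma r_eq_iff [simp]: "\<lbrakk>a \<in> A'; b \<in> A'\<rbrakk> \<Longrightarrow> r a = r b \<longleftrightarrow> a = b"
  using r_inj by (rule inj_on_eq_iff)

lemma L'_carrier [simp]: "x \<in> L' \<Longrightarrow> x \<in> carrier L"
  using LR.addsubD(1)[OF L'_addsub] .

lemma A'_carrier [simp]: "a \<in> A' \<Longrightarrow> a \<in> carrier A"
  using A'_sub by blast

lemmas L'_closed [simp] = LR.addsubD(2-4)[OF L'_addsub] L'_br L'_H LR.addsub_int_multiple[OF L'_addsub]
lemmas A'_closed [simp] = A'_zero A'_add A'_neg A'_act

definition A1 :: "'j ring" where
  "A1 = \<lparr>carrier = r ` A', monoid.mult = (\<lambda>a b. a), one = r \<zero>\<^bsub>A\<^esub>, ring.zero = r \<zero>\<^bsub>A\<^esub>,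
     add = (\<lambda>a b. r (r' a \<oplus>\<^bsub>A\<^esub> r' b))\<rparr>"

definition L1 :: "(int, 'i) lie_algebra" where
  "L1 = \<lparr>carrier = p ` L', monoid.mult = (\<lambda>x y. x), one = p \<zero>\<^bsub>L\<^esub>, ring.zero = p \<zero>\<^bsub>L\<^esub>,
     add = (\<lambda>x y. p (p' x \<oplus>\<^bsub>L\<^esub> p' y)), smult = (\<lambda>n x. p (add_pow L n (p' x))),
     bracket = (\<lambda>x y. p (bracket L (p' x) (p' y)))\<rparr>"

definition C1 :: "'j \<Rightarrow> 'i set" where
  "C1 b = p ` (C (r' b) \<inter> L')"

definition res :: "('l \<Rightarrow> 'l) \<Rightarrow> 'i \<Rightarrow> 'i" where
  "res h = (\<lambda>y\<in>p ` L'. p (h (p' y)))"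

definition act1 :: "('i \<Rightarrow> 'i) \<Rightarrow> 'j \<Rightarrow> 'j" where
  "act1 g = (\<lambda>b\<in>r ` A'. r (act (inv_into H res g) (r' b)))"

lemma A1_simps [simp]:
  "carrier A1 = r ` A'" "\<zero>\<^bsub>A1\<^esub> = r \<zero>\<^bsub>A\<^esub>"
  "\<lbrakk>a \<in> A'; b \<in> A'\<rbrakk> \<Longrightarrow> r a \<oplus>\<^bsub>A1\<^esub> r b = r (a \<oplus>\<^bsub>A\<^esub> b)"
  by (simp_all add: A1_def)

lemma L1_simps [simp]:
  "carrier L1 = p ` L'" "\<zero>\<^bsub>L1\<^esub> = p \<zero>\<^bsub>L\<^esub>"
  "\<lbrakk>x \<in> L'; y \<in> L'\<rbrakk> \<Longrightarrow> p x \<oplus>\<^bsub>L1\<^esub> p y = p (x \<oplus>\<^bsub>L\<^esub> y)"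
  "x \<in> L' \<Longrightarrow> n \<odot>\<^bsub>L1\<^esub> p x = p (add_pow L n x)"
  "\<lbrakk>x \<in> L'; y \<in> L'\<rbrakk> \<Longrightarrow> bracket L1 (p x) (p y) = p (bracket L x y)"
  by (simp_all add: L1_def)

lemma abelian_group_A1: "abelian_group A1"
proof (rule abelian_groupI)
  fix x assume "x \<in> carrier A1"
  then obtain a where a: "x = r a" "a \<in> A'"
    by auto
  show "\<exists>y\<in>carrier A1. y \<oplus>\<^bsub>A1\<^esub> x = \<zero>\<^bsub>A1\<^esub>"
    by (rule bexI[of _ "r (\<ominus>\<^bsub>A\<^esub> a)"]) (use a in \<open>auto simp: A.l_neg\<close>)
qed (auto simp: A.a_ac)

lemma abelian_group_L1: "abelian_group L1"
proof (rule abelian_groupI)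
  fix x assume "x \<in> carrier L1"
  then obtain a where a: "x = p a" "a \<in> L'"
    by auto
  show "\<exists>y\<in>carrier L1. y \<oplus>\<^bsub>L1\<^esub> x = \<zero>\<^bsub>L1\<^esub>"
    by (rule bexI[of _ "p (\<ominus>\<^bsub>L\<^esub> a)"]) (use a in \<open>auto simp: M.l_neg\<close>)
qed (auto simp: M.a_ac)

lemma L1_neg:
  assumes "x \<in> L'"
  shows "\<ominus>\<^bsub>L1\<^esub> p x = p (\<ominus>\<^bsub>L\<^esub> x)"
proof -
  interpret L1: abelian_group L1
    by (rule abelian_group_L1)
  show ?thesis
    by (rule L1.minus_equality) (use assms in \<open>auto simp: M.l_neg\<close>)
qed

lemma lie_algebra_L1: "lie_algebra \<Z> L1"
proof (intro lie_algebra.intro moduleI lie_algebra_axioms.intro)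
  show "cring \<Z>"
    by (rule int_is_cring)
  show "abelian_group L1"
    by (rule abelian_group_L1)
  show "(a \<oplus>\<^bsub>\<Z>\<^esub> b) \<odot>\<^bsub>L1\<^esub> x = a \<odot>\<^bsub>L1\<^esub> x \<oplus>\<^bsub>L1\<^esub> b \<odot>\<^bsub>L1\<^esub> x" if "x \<in> carrier L1" for a b x
    using that by (auto simp: M.add.int_pow_mult)
  show "a \<odot>\<^bsub>L1\<^esub> (x \<oplus>\<^bsub>L1\<^esub> y) = a \<odot>\<^bsub>L1\<^esub> x \<oplus>\<^bsub>L1\<^esub> a \<odot>\<^bsub>L1\<^esub> y"
    if "x \<in> carrier L1" "y \<in> carrier L1" for a x y
    using that by (auto simp: M.add.int_pow_distrib)
  show "(a \<otimes>\<^bsub>\<Z>\<^esub> b) \<odot>\<^bsub>L1\<^esub> x = a \<odot>\<^bsub>L1\<^esub> (b \<odot>\<^bsub>L1\<^esub> x)" if "x \<in> carrier L1" for a b x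
    using that by (auto simp: M.add.int_pow_pow mult.commute)
qed (auto simp: bracket_add_left bracket_add_right bracket_self jacobi
    LR.br_int_multiple_left LR.br_int_multiple_right)

sublocale L1: lie_algebra "\<Z>" L1
  by (rule lie_algebra_L1)

lemma foldl_bracket_L1:
  "\<lbrakk>x \<in> L'; set xs \<subseteq> L'\<rbrakk> \<Longrightarrow>
    foldl (bracket L1) (p x) (map p xs) = p (foldl (bracket L) x xs) \<and> foldl (bracket L) x xs \<in> L'"
  by (induction xs arbitrary: x) auto

lemma foldl_bracket_L1_zero:
  assumes u: "u \<in> p ` U" and ys: "set ys \<subseteq> p ` K" "length ys = n" and sub: "U \<subseteq> L'" "K \<subseteq> L'"
    and zero: "\<And>x xs. \<lbrakk>x \<in> U; set xs \<subseteq> K; length xs = n\<rbrakk> \<Longrightarrow> foldl (bracket L) x xs = \<zero>\<^bsub>L\<^esub>"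
  shows "foldl (bracket L1) u ys = \<zero>\<^bsub>L1\<^esub>"
proof -
  obtain x where x: "u = p x" "x \<in> U"
    using u by blast
  define xs where "xs = map p' ys"
  have xs: "set xs \<subseteq> K"
  proof
    fix z assume "z \<in> set xs"
    then obtain y where y: "y \<in> set ys" "z = p' y"
      by (auto simp: xs_def)
    then obtain w where "w \<in> K" "y = p w"
      using ys(1) by blast
    then show "z \<in> K"
      using y(2) sub(2) by auto
  qed
  have "map p xs = ys"
    unfolding xs_def map_map
  proof (rule map_idI)
    fix y assume "y \<in> set ys"
    then obtain w where "w \<in> K" "y = p w"
      using ys(1) by blast
    then show "(p \<circ> p') y = y"
      using sub(2) by auto
  qed
  then have "foldl (bracket L1) u ys = p (foldl (bracket L) x xs)"
    using foldl_bracket_L1[of x xs] x xs sub by auto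
  then show ?thesis
    using zero[OF x(2) xs] ys(2) by (simp add: xs_def)
qed

text \<open>
  Since spans are transported, so is the description of direct sums by spanning and independence.
\<close>

lemma aspan_L1:
  assumes "S \<subseteq> L'"
  shows "L1.LR.aspan (p ` S) = p ` LR.aspan S" "LR.aspan S \<subseteq> L'"
proof -
  show sub: "LR.aspan S \<subseteq> L'"
    using assms by (auto intro: LR.aspan_least[OF L'_addsub])
  have "z \<in> p ` LR.aspan S" if "z \<in> L1.LR.aspan (p ` S)" for z
    using that
  proof induction
    case aspan_zero
    then show ?case
      by (auto intro: LR.aspan_zero)
  next
    case (aspan_base x)
    then obtain y where "x = p y" "y \<in> S"
      by blast
    moreover have "y \<in> LR.aspan S"
      using \<open>y \<in> S\<close> assms by (auto intro!: LR.aspan_base)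
    ultimately show ?case
      by blast
  next
    case (aspan_add x y)
    then obtain u v where uv: "x = p u" "y = p v" "u \<in> LR.aspan S" "v \<in> LR.aspan S"
      by blast
    then have "x \<oplus>\<^bsub>L1\<^esub> y = p (u \<oplus>\<^bsub>L\<^esub> v)"
      using sub by (simp add: subset_eq)
    then show ?case
      using LR.aspan_add[OF uv(3,4)] by blast
  next
    case (aspan_neg x)
    then obtain u where u: "x = p u" "u \<in> LR.aspan S"
      by blast
    then have "\<ominus>\<^bsub>L1\<^esub> x = p (\<ominus>\<^bsub>L\<^esub> u)"
      using sub by (simp add: subset_eq L1_neg)
    then show ?case
      using LR.aspan_neg[OF u(2)] by blast
  qed
  moreover have "p x \<in> L1.LR.aspan (p ` S)" if "x \<in> LR.aspan S" for x
    using that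
  proof induction
    case aspan_zero
    then show ?case
      using L1.LR.aspan_zero by simp
  next
    case (aspan_base x)
    then show ?case
      using assms by (auto intro!: L1.LR.aspan_base)
  next
    case (aspan_add x y)
    then show ?case
      using L1.LR.aspan_add[OF aspan_add.IH] sub by (simp add: subset_eq)
  next
    case (aspan_neg x)
    then show ?case
      using L1.LR.aspan_neg[OF aspan_neg.IH] sub by (simp add: subset_eq L1_neg)
  qed
  ultimately show "L1.LR.aspan (p ` S) = p ` LR.aspan S"
    by blast
qed

lemma graded_L1: "graded_lie_algebra \<Z> A1 L1 C1"
proof (rule graded_lie_algebraI)
  show "component_family \<Z> L1 (carrier A1) C1"
  proof (intro component_family.intro component_family_axioms.intro lie_algebra_L1 L1.submoduleI)
    fix a assume "a \<in> carrier A1"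
    then have a: "r' a \<in> carrier A"
      by auto
    note Ca = component_is_addsub[OF a]
    show "C1 a \<subseteq> carrier L1" "\<zero>\<^bsub>L1\<^esub> \<in> C1 a"
      using LR.addsubD(2)[OF Ca] by (auto simp: C1_def)
    show "\<ominus>\<^bsub>L1\<^esub> x \<in> C1 a" if "x \<in> C1 a" for x
      using that LR.addsubD(4)[OF Ca] by (auto simp: C1_def L1_neg)
    show "x \<oplus>\<^bsub>L1\<^esub> y \<in> C1 a" if "x \<in> C1 a" "y \<in> C1 a" for x y
      using that LR.addsubD(3)[OF Ca] by (auto simp: C1_def)
    show "n \<odot>\<^bsub>L1\<^esub> x \<in> C1 a" if "x \<in> C1 a" for n x
      using that LR.addsub_int_multiple[OF Ca] by (auto simp: C1_def)
  qed
  show "abelian_group A1"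
    by (rule abelian_group_A1)
  show "bracket L1 x y \<in> C1 (a \<oplus>\<^bsub>A1\<^esub> b)"
    if "a \<in> carrier A1" "b \<in> carrier A1" "x \<in> C1 a" "y \<in> C1 b" for a b x y
    using that bracket_component by (auto simp: C1_def)
  have img: "(\<Union>b\<in>r ` B. C1 b) = p ` (\<Union>a\<in>B. C a \<inter> L')" if "B \<subseteq> A'" for B
  proof -
    have "C1 (r a) = p ` (C a \<inter> L')" if "a \<in> B" for a
      using that \<open>B \<subseteq> A'\<close> by (auto simp: C1_def)
    then have "(\<Union>a\<in>B. C1 (r a)) = (\<Union>a\<in>B. p ` (C a \<inter> L'))"
      by (rule SUP_cong[OF refl])
    then show ?thesis
      unfolding image_UN image_image .
  qed
  have span: "L1.LR.aspan (\<Union>b\<in>r ` B. C1 b) = p ` LR.aspan (\<Union>a\<in>B. C a \<inter> L')" if "B \<subseteq> A'" for B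
    unfolding img[OF that] by (rule aspan_L1(1)) blast
  show "carrier L1 \<subseteq> lie_ring.aspan L1 (\<Union>a\<in>carrier A1. C1 a)"
    unfolding A1_simps(1) L1_simps(1) span[OF order_refl] using L'_span by (rule image_mono)
  show "x = \<zero>\<^bsub>L1\<^esub>"
    if a: "a \<in> carrier A1" "x \<in> C1 a" and x: "x \<in> lie_ring.aspan L1 (\<Union>b\<in>carrier A1 - {a}. C1 b)" for a x
  proof -
    obtain a' where a': "a = r a'" "a' \<in> A'"
      using a(1) by auto
    obtain y where y: "x = p y" "y \<in> C a'" "y \<in> L'"
      using a(2) a' by (auto simp: C1_def)
    have "carrier A1 - {a} = r ` (A' - {a'})"
      using a' by auto
    then have "x \<in> p ` LR.aspan (\<Union>b\<in>A' - {a'}. C b \<inter> L')"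
      using x span[of "A' - {a'}"] by (metis Diff_subset)
    then obtain y' where y': "x = p y'" "y' \<in> LR.aspan (\<Union>b\<in>A' - {a'}. C b \<inter> L')"
      by blast
    have "y' \<in> L'"
      using y'(2) aspan_L1(2)[of "\<Union>b\<in>A' - {a'}. C b \<inter> L'"] by blast
    then have "y' = y"
      using y y' inj_onD[OF p_inj, of y' y] by simp
    moreover have "(\<Union>b\<in>A' - {a'}. C b \<inter> L') \<subseteq> (\<Union>b\<in>carrier A - {a'}. C b)"
      using A'_sub by blast
    ultimately have "y \<in> LR.aspan (\<Union>b\<in>carrier A - {a'}. C b)"
      using y'(2) LR.aspan_mono by blast
    then have "y = \<zero>\<^bsub>L\<^esub>"
      by (rule graded_lie_ring.component_independent[OF graded_lie_ring A'_carrier[OF a'(2)] y(2)])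
    then show ?thesis
      using y by simp
  qed
qed

lemma res_apply [simp]: "x \<in> L' \<Longrightarrow> res h (p x) = p (h x)"
  by (simp add: res_def)

text \<open>
  Faithfulness makes the restriction of automorphisms injective, so the order of the group and its
  action on degrees are kept.
\<close>

lemma res_inj: "inj_on res H"
proof (rule inj_onI)
  fix h h' assume h: "h \<in> H" "h' \<in> H" and eq: "res h = res h'"
  show "h = h'"
  proof (rule faithful[OF h])
    fix x assume x: "x \<in> L'"
    have "p (h x) = p (h' x)"
      using fun_cong[OF eq, of "p x"] x by simp
    then show "h x = h' x"
      using inj_onD[OF p_inj] h x by simp
  qed
qed

lemma act1_apply [simp]: "\<lbrakk>h \<in> H; a \<in> A'\<rbrakk> \<Longrightarrow> act1 (res h) (r a) = r (act h a)"
  by (simp add: act1_def res_inj)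

lemma res_in_lie_auto:
  assumes h: "h \<in> H"
  shows "res h \<in> lie_auto \<Z> L1"
proof -
  obtain g where g: "g \<in> H" "\<And>x. x \<in> carrier L \<Longrightarrow> h (g x) = x"
    using ex_inverse[OF H_fin h] by blast
  have "bij_betw (res h) (p ` L') (p ` L')"
  proof (rule bij_betw_imageI)
    show "inj_on (res h) (p ` L')"
    proof (rule inj_onI)
      fix y y' assume "y \<in> p ` L'" "y' \<in> p ` L'" and eq: "res h y = res h y'"
      then obtain x x' where x: "y = p x" "y' = p x'" "x \<in> L'" "x' \<in> L'"
        by blast
      then have "h x = h x'"
        using eq h by simp
      then have "x = x'"
        by (rule inj_onD[OF H_auto(5)[OF h]]) (use x in auto)
      then show "y = y'"
        using x by simp
    qed
    show "res h ` p ` L' = p ` L'"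
    proof (intro equalityI subsetI)
      fix y assume "y \<in> p ` L'"
      then obtain x where x: "y = p x" "x \<in> L'"
        by blast
      then have "y = res h (p (g x))" "g x \<in> L'"
        using g by simp_all
      then show "y \<in> res h ` p ` L'"
        by blast
    qed (use h in auto)
  qed
  moreover have "res h \<in> extensional (p ` L')"
    by (simp add: res_def)
  ultimately show ?thesis
    using h by (auto simp: lie_auto_def Bij_def H_auto(3,4) H_int_multiple)
qed

lemma res_compose: "\<lbrakk>g \<in> H; h \<in> H\<rbrakk> \<Longrightarrow> compose (p ` L') (res g) (res h) = res (compose (carrier L) g h)"
  by (rule extensionalityI[where A = "p ` L'"]) (auto simp: compose_def res_def)

lemma res_one: "res (\<lambda>x\<in>carrier L. x) = (\<lambda>y\<in>p ` L'. y)"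
  by (auto simp: res_def fun_eq_iff)

lemma subgroup_res: "subgroup (res ` H) (Lie_AutoGroup \<Z> L1)"
proof (rule Lie_AutoGroup_subgroupI)
  show "res ` H \<subseteq> lie_auto \<Z> L1"
    using res_in_lie_auto by blast
  show "(\<lambda>x\<in>carrier L1. x) \<in> res ` H"
    using res_one one_in_H by (metis L1_simps(1) imageI)
  show "compose (carrier L1) g h \<in> res ` H" if gh: "g \<in> res ` H" "h \<in> res ` H" for g h
  proof -
    obtain g' h' where "g = res g'" "h = res h'" "g' \<in> H" "h' \<in> H"
      using gh by blast
    then show ?thesis
      using res_compose H_compose by simp
  qed
  show "\<exists>h\<in>res ` H. \<forall>x\<in>carrier L1. g (h x) = x \<and> h (g x) = x" if "g \<in> res ` H" for g
  proof -
    obtain g' where g': "g = res g'" "g' \<in> H"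
      using \<open>g \<in> res ` H\<close> by blast
    obtain h' where h': "h' \<in> H" "\<forall>x\<in>carrier L. g' (h' x) = x \<and> h' (g' x) = x"
      using ex_inverse[OF H_fin g'(2)] by blast
    have "\<forall>x\<in>carrier L1. g (res h' x) = x \<and> res h' (g x) = x"
      using g' h' by auto
    then show ?thesis
      using h'(1) by blast
  qed
qed

lemma act1_auto:
  assumes h: "h \<in> H"
  shows "act1 (res h) \<in> auto (add_monoid A1)"
proof -
  obtain g where g: "g \<in> H" "\<And>x. x \<in> carrier L \<Longrightarrow> h (g x) = x"
    using ex_inverse[OF H_fin h] by blast
  have "compose (carrier L) h g = (\<lambda>x\<in>carrier L. x)"
    using g(2) by (auto simp: compose_def)
  then have hg: "act h (act g a) = a" if "a \<in> carrier A" for a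
    using act_compose[OF h g(1) that] act_one[OF that] by simp
  have "bij_betw (act1 (res h)) (r ` A') (r ` A')"
  proof (rule bij_betw_imageI)
    show "inj_on (act1 (res h)) (r ` A')"
    proof (rule inj_onI)
      fix y y' assume "y \<in> r ` A'" "y' \<in> r ` A'" and eq: "act1 (res h) y = act1 (res h) y'"
      then obtain a a' where a: "y = r a" "y' = r a'" "a \<in> A'" "a' \<in> A'"
        by blast
      then have "act h a = act h a'"
        using eq h by simp
      then have "a = a'"
        by (rule inj_onD[OF act_auto(4)[OF h]]) (use a in auto)
      then show "y = y'"
        using a by simp
    qed
    show "act1 (res h) ` r ` A' = r ` A'"
    proof (intro equalityI subsetI)
      fix y assume "y \<in> r ` A'"
      then obtain a where a: "y = r a" "a \<in> A'"
        by blast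
      then have "y = act1 (res h) (r (act g a))" "act g a \<in> A'"
        using g h hg by simp_all
      then show "y \<in> act1 (res h) ` r ` A'"
        by blast
    qed (use h in auto)
  qed
  moreover have "act1 (res h) \<in> extensional (r ` A')"
    by (simp add: act1_def)
  ultimately show ?thesis
    using h by (auto simp: auto_def hom_def Bij_def act_auto(3))
qed

lemma double_automorphism_group_L1:
  "double_automorphism_group \<Z> A1 L1 C1 (res ` H) act1"
proof (intro double_automorphism_group.intro double_automorphism_group_axioms.intro)
  show "graded_lie_algebra \<Z> A1 L1 C1"
    by (rule graded_L1)
  show "subgroup (res ` H) (Lie_AutoGroup \<Z> L1)"
    by (rule subgroup_res)
  show "act1 \<in> hom (Lie_AutoGroup \<Z> L1\<lparr>carrier := res ` H\<rparr>) (AutoGroup (add_monoid A1))"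
  proof (rule homI)
    fix x assume "x \<in> carrier (Lie_AutoGroup \<Z> L1\<lparr>carrier := res ` H\<rparr>)"
    then show "act1 x \<in> carrier (AutoGroup (add_monoid A1))"
      using act1_auto by (auto simp: AutoGroup_def)
  next
    fix x y
    assume "x \<in> carrier (Lie_AutoGroup \<Z> L1\<lparr>carrier := res ` H\<rparr>)"
      "y \<in> carrier (Lie_AutoGroup \<Z> L1\<lparr>carrier := res ` H\<rparr>)"
    then obtain g h where gh: "x = res g" "y = res h" "g \<in> H" "h \<in> H"
      by auto
    have Bij: "res g \<in> Bij (p ` L')" "res h \<in> Bij (p ` L')"
      "act1 (res g) \<in> Bij (r ` A')" "act1 (res h) \<in> Bij (r ` A')"
      using res_in_lie_auto[OF gh(3)] res_in_lie_auto[OF gh(4)] act1_auto[OF gh(3)] act1_auto[OF gh(4)]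
      by (simp_all add: lie_auto_def auto_def)
    have "act1 (res (compose (carrier L) g h)) = compose (r ` A') (act1 (res g)) (act1 (res h))"
    proof (rule extensionalityI[where A = "r ` A'"])
      show "act1 (res (compose (carrier L) g h)) \<in> extensional (r ` A')"
        by (simp add: act1_def)
      fix y assume "y \<in> r ` A'"
      then obtain a where a: "y = r a" "a \<in> A'"
        by blast
      show "act1 (res (compose (carrier L) g h)) y = compose (r ` A') (act1 (res g)) (act1 (res h)) y"
        using a gh H_compose[OF gh(3,4)] act_compose[OF gh(3,4)] by (simp add: compose_def)
    qed (simp add: compose_def)
    then show "act1 (x \<otimes>\<^bsub>Lie_AutoGroup \<Z> L1\<lparr>carrier := res ` H\<rparr>\<^esub> y) =
        act1 x \<otimes>\<^bsub>AutoGroup (add_monoid A1)\<^esub> act1 y"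
      using gh Bij res_compose[OF gh(3,4)]
      by (simp add: Lie_AutoGroup_def AutoGroup_def BijGroup_def)
  qed
  fix g b assume "g \<in> res ` H" "b \<in> carrier A1"
  then obtain h a where ha: "g = res h" "h \<in> H" "b = r a" "a \<in> A'"
    by auto
  obtain h' where h': "h' \<in> H" "\<And>x. x \<in> carrier L \<Longrightarrow> h (h' x) = x" "\<And>x. x \<in> carrier L \<Longrightarrow> h' (h x) = x"
    using ex_inverse[OF H_fin ha(2)] by blast
  have "h ` (C a \<inter> L') = C (act h a) \<inter> L'"
  proof (intro equalityI subsetI)
    fix y assume "y \<in> h ` (C a \<inter> L')"
    then show "y \<in> C (act h a) \<inter> L'"
      using permutes_components[OF ha(2), of a] ha by auto
  next
    fix y assume y: "y \<in> C (act h a) \<inter> L'"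
    then have "y \<in> h ` C a"
      using permutes_components[OF ha(2), of a] ha by simp
    then obtain x where x: "y = h x" "x \<in> C a"
      by blast
    have "h' y = x"
      using x h'(3) component_subset[of a x] ha by simp
    then have "x \<in> L'"
      using L'_H[OF h'(1), of y] y by simp
    then show "y \<in> h ` (C a \<inter> L')"
      using x by blast
  qed
  moreover have "res h ` p ` (C a \<inter> L') = p ` h ` (C a \<inter> L')"
    by (simp add: image_image)
  ultimately show "g ` C1 b = C1 (act1 g b)"
    using ha by (simp add: C1_def)
qed

lemma admissible_L1:
  assumes "admissible q k c R A L C H act"
  shows "admissible q k c \<Z> A1 L1 C1 (res ` H) act1"
  unfolding admissible_def
proof (intro conjI ballI impI)
  have nil: "ad_nilpotent R L (C a) k" if "a \<in> carrier A" for a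
    using assms that by (simp add: admissible_def)
  show "double_automorphism_group \<Z> A1 L1 C1 (res ` H) act1"
    by (rule double_automorphism_group_L1)
  show "finite (res ` H)"
    using H_fin by simp
  show "card (res ` H) = q"
    using assms card_image[OF res_inj] by (simp add: admissible_def)
  show "ad_nilpotent \<Z> L1 (C1 b) k" if b: "b \<in> carrier A1" for b
  proof -
    obtain a where a: "b = r a" "a \<in> A'"
      using b by auto
    have zero: "foldl (bracket L) x xs = \<zero>\<^bsub>L\<^esub>" if "x \<in> L'" "set xs \<subseteq> C a \<inter> L'" "length xs = k" for x xs
    proof -
      have "C a \<subseteq> carrier L"
        using component_subset[of a] a by auto
      then have "\<forall>u\<in>carrier L. \<forall>ys. set ys \<subseteq> C a \<longrightarrow> length ys = k \<longrightarrow> foldl (bracket L) u ys = \<zero>\<^bsub>L\<^esub>"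
        using nil[of a] a comm_span_eq_zero_iff[of "carrier L" "C a" k] unfolding ad_nilpotent_def by simp
      then show ?thesis
        using that by simp
    qed
    have "C1 b \<subseteq> carrier L1"
      by (auto simp: C1_def)
    then show ?thesis
      unfolding ad_nilpotent_def using foldl_bracket_L1_zero[of _ L' _ "C a \<inter> L'" k] zero a
      by (subst L1.comm_span_eq_zero_iff) (auto simp: C1_def)
  qed
  show "{b \<in> carrier A1. act1 g b = b} = {\<zero>\<^bsub>A1\<^esub>}" if g: "g \<in> res ` H" "g \<noteq> \<one>\<^bsub>Lie_AutoGroup \<Z> L1\<^esub>" for g
  proof -
    obtain h where h: "g = res h" "h \<in> H"
      using g(1) by blast
    have "\<one>\<^bsub>Lie_AutoGroup \<Z> L1\<^esub> = res (\<lambda>x\<in>carrier L. x)"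
      by (simp add: res_one Lie_AutoGroup_def BijGroup_def)
    then have "h \<noteq> \<one>\<^bsub>Lie_AutoGroup R L\<^esub>"
      using g(2) h(1) one_eq by auto
    then have fix0: "{a \<in> carrier A. act h a = a} = {\<zero>\<^bsub>A\<^esub>}"
      using assms h(2) by (simp add: admissible_def)
    have "act1 g (r a) = r a \<longleftrightarrow> a = \<zero>\<^bsub>A\<^esub>" if a: "a \<in> A'" for a
    proof -
      have "act1 g (r a) = r a \<longleftrightarrow> act h a = a"
        using h a inj_on_eq_iff[OF r_inj] by simp
      also have "\<dots> \<longleftrightarrow> a \<in> {a \<in> carrier A. act h a = a}"
        using a by simp
      also have "\<dots> \<longleftrightarrow> a = \<zero>\<^bsub>A\<^esub>"
        unfolding fix0 by simp
      finally show ?thesis .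
    qed
    then show ?thesis
      by (auto simp: image_iff)
  qed
  have eq: "fixed_subalgebra L1 (res ` H) = p ` (fixed_subalgebra L H \<inter> L')"
  proof -
    have "res h (p x) = p x \<longleftrightarrow> h x = x" if "x \<in> L'" "h \<in> H" for x h
      using that inj_on_eq_iff[OF p_inj] by simp
    then show ?thesis
      by (auto simp: fixed_subalgebra_def)
  qed
  have zero: "foldl (bracket L) x xs = \<zero>\<^bsub>L\<^esub>"
    if "x \<in> fixed_subalgebra L H \<inter> L'" "set xs \<subseteq> fixed_subalgebra L H \<inter> L'" "length xs = c" for x xs
  proof -
    have "fixed_subalgebra L H \<subseteq> carrier L"
      by (auto simp: fixed_subalgebra_def)
    moreover have "comm_span R L (fixed_subalgebra L H) (fixed_subalgebra L H) c = {\<zero>\<^bsub>L\<^esub>}"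
      using assms by (simp add: admissible_def nilpotent_class_le_def)
    ultimately show ?thesis
      using that comm_span_eq_zero_iff by auto
  qed
  have sub: "p ` (fixed_subalgebra L H \<inter> L') \<subseteq> carrier L1"
    by auto
  show "nilpotent_class_le \<Z> L1 (fixed_subalgebra L1 (res ` H)) c"
    unfolding nilpotent_class_le_def eq L1.comm_span_eq_zero_iff[OF sub sub]
    by (intro ballI allI impI foldl_bracket_L1_zero[of _ "fixed_subalgebra L H \<inter> L'"
          _ "fixed_subalgebra L H \<inter> L'" c] zero) auto
qed

end

section \<open>Countable substructures\<close>

text \<open>
  Terms over countably many generators for the operations of the Lie ring and for the
  automorphisms. The type is countable, hence so is every set of values of terms.
\<close>

datatype trm = Gen nat | Zero | Add trm trm | Neg trm | Br trm trm | Act nat trm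

instance trm :: countable
  by countable_datatype

context double_automorphism_group
begin

primrec eval_L :: "('a \<times> 'l) list \<Rightarrow> ('l \<Rightarrow> 'l) list \<Rightarrow> trm \<Rightarrow> 'l" where
  "eval_L gs hs (Gen n) = (if n < length gs then snd (gs ! n) else \<zero>\<^bsub>L\<^esub>)"
| "eval_L gs hs Zero = \<zero>\<^bsub>L\<^esub>"
| "eval_L gs hs (Add s t) = eval_L gs hs s \<oplus>\<^bsub>L\<^esub> eval_L gs hs t"
| "eval_L gs hs (Neg t) = \<ominus>\<^bsub>L\<^esub> eval_L gs hs t"
| "eval_L gs hs (Br s t) = bracket L (eval_L gs hs s) (eval_L gs hs t)"
| "eval_L gs hs (Act n t) = (if n < length hs then (hs ! n) (eval_L gs hs t) else eval_L gs hs t)"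

text \<open>
  The same terms evaluated in the group of degrees. For homogeneous values, a bracket has the sum
  of the degrees as its degree.
\<close>

primrec eval_A :: "('a \<times> 'l) list \<Rightarrow> ('l \<Rightarrow> 'l) list \<Rightarrow> trm \<Rightarrow> 'a" where
  "eval_A gs hs (Gen n) = (if n < length gs then fst (gs ! n) else \<zero>\<^bsub>A\<^esub>)"
| "eval_A gs hs Zero = \<zero>\<^bsub>A\<^esub>"
| "eval_A gs hs (Add s t) = eval_A gs hs s \<oplus>\<^bsub>A\<^esub> eval_A gs hs t"
| "eval_A gs hs (Neg t) = \<ominus>\<^bsub>A\<^esub> eval_A gs hs t"
| "eval_A gs hs (Br s t) = eval_A gs hs s \<oplus>\<^bsub>A\<^esub> eval_A gs hs t"
| "eval_A gs hs (Act n t) = (if n < length hs then act (hs ! n) (eval_A gs hs t) else eval_A gs hs t)"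

lemma H_aspan:
  assumes h: "h \<in> H" and gen: "\<And>x. \<lbrakk>x \<in> S; x \<in> carrier L\<rbrakk> \<Longrightarrow> h x \<in> LR.aspan T"
    and x: "x \<in> LR.aspan S"
  shows "h x \<in> LR.aspan T"
  using x
proof induction
  case aspan_zero
  then show ?case
    using H_zero[OF h] LR.aspan_zero by simp
next
  case (aspan_base x)
  then show ?case
    by (rule gen)
next
  case (aspan_add x y)
  then show ?case
    using H_auto(3)[OF h LR.aspan_closed LR.aspan_closed] LR.aspan_add by metis
next
  case (aspan_neg x)
  then show ?case
    using H_neg[OF h LR.aspan_closed] LR.aspan_neg by metis
qed

lemma eval_closed:
  assumes gs: "set gs \<subseteq> Sigma (carrier A) C" and hs: "set hs \<subseteq> H"
  shows "eval_L gs hs t \<in> carrier L" "eval_A gs hs t \<in> carrier A"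
proof -
  have g: "fst (gs ! n) \<in> carrier A" "snd (gs ! n) \<in> C (fst (gs ! n))" if "n < length gs" for n
  proof -
    have "gs ! n \<in> Sigma (carrier A) C"
      using gs nth_mem[OF that] by blast
    then show "fst (gs ! n) \<in> carrier A" "snd (gs ! n) \<in> C (fst (gs ! n))"
      by auto
  qed
  have h: "hs ! n \<in> H" if "n < length hs" for n
    using hs nth_mem[OF that] by blast
  show "eval_L gs hs t \<in> carrier L"
    by (induction t) (auto simp: H_auto(2)[OF h] intro: component_subset[OF g(1) g(2)] bracket_closed)
  show "eval_A gs hs t \<in> carrier A"
    by (induction t) (auto simp: g(1) act_auto(2)[OF h])
qed

text \<open>
  A homogeneous summand and its degree are in general values of two different terms.
\<close>

lemma eval_span:
  assumes gs: "set gs \<subseteq> Sigma (carrier A) C" and hs: "set hs = H"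
  shows "eval_L gs hs t \<in> LR.aspan (\<Union>a\<in>range (eval_A gs hs). C a \<inter> range (eval_L gs hs))"
    (is "_ \<in> LR.aspan ?S")
proof (induction t)
  case (Gen n)
  show ?case
  proof (cases "n < length gs")
    case True
    then have "gs ! n \<in> Sigma (carrier A) C"
      using gs nth_mem by blast
    then have "snd (gs ! n) \<in> C (fst (gs ! n))" "snd (gs ! n) \<in> carrier L"
      using component_subset by auto
    then have "eval_L gs hs (Gen n) \<in> C (eval_A gs hs (Gen n))" "eval_L gs hs (Gen n) \<in> carrier L"
      using True by simp_all
    then show ?thesis
      by (intro LR.aspan_base UN_I[of "eval_A gs hs (Gen n)"] IntI rangeI)
  next
    case False
    then show ?thesis
      using LR.aspan_zero by simp
  qed
next
  case Zero
  then show ?case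
    using LR.aspan_zero by simp
next
  case (Add s t)
  then show ?case
    using LR.aspan_add by simp
next
  case (Neg t)
  then show ?case
    using LR.aspan_neg by simp
next
  case (Br s t)
  have "bracket L x y \<in> LR.aspan ?S" if xy: "x \<in> ?S" "y \<in> ?S" for x y
  proof -
    obtain s' s t' t where *: "x \<in> C (eval_A gs hs s')" "x = eval_L gs hs s"
      "y \<in> C (eval_A gs hs t')" "y = eval_L gs hs t"
      using xy by blast
    have "bracket L x y \<in> C (eval_A gs hs (Add s' t'))"
      using bracket_component[OF eval_closed(2)[OF gs] eval_closed(2)[OF gs] *(1,3)] hs by simp
    moreover have "bracket L x y = eval_L gs hs (Br s t)"
      using * by simp
    moreover have "eval_L gs hs (Br s t) \<in> carrier L"
      using eval_closed(1)[OF gs] hs by blast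
    ultimately show ?thesis
      by (metis (no_types, lifting) LR.aspan_base UN_I IntI rangeI)
  qed
  then show ?case
    unfolding eval_L.simps by (intro LR.br_aspan_aspan[OF LR.addsub_aspan _ Br.IH])
next
  case (Act n t)
  show ?case
  proof (cases "n < length hs")
    case True
    then have h: "hs ! n \<in> H"
      using hs nth_mem by blast
    have "(hs ! n) (eval_L gs hs t) \<in> LR.aspan ?S"
    proof (rule H_aspan[OF h _ Act.IH])
      fix x assume "x \<in> ?S" and xc: "x \<in> carrier L"
      then obtain s s' where *: "x \<in> C (eval_A gs hs s')" "x = eval_L gs hs s"
        by blast
      have "(hs ! n) x \<in> C (act (hs ! n) (eval_A gs hs s'))"
        using permutes_components[OF h eval_closed(2)[OF gs]] hs *(1) by blast
      moreover have "act (hs ! n) (eval_A gs hs s') = eval_A gs hs (Act n s')"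
        "(hs ! n) x = eval_L gs hs (Act n s)"
        using True *(2) by simp_all
      moreover have "(hs ! n) x \<in> carrier L"
        using H_auto(2)[OF h xc] .
      ultimately show "(hs ! n) x \<in> LR.aspan ?S"
        by (metis (no_types, lifting) LR.aspan_base UN_I IntI rangeI)
    qed
    then show ?thesis
      using True by simp
  next
    case False
    then show ?thesis
      using Act.IH by simp
  qed
qed

lemma restriction_eval:
  assumes fin: "finite H" and gs: "set gs \<subseteq> Sigma (carrier A) C" and hs: "set hs = H"
    and faithful: "\<And>h h'. \<lbrakk>h \<in> H; h' \<in> H; h \<noteq> h'\<rbrakk> \<Longrightarrow> \<exists>g\<in>set gs. h (snd g) \<noteq> h' (snd g)"
    and inj: "inj_on p (range (eval_L gs hs))" "inj_on r (range (eval_A gs hs))"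
  shows "restriction R A L C H act (range (eval_L gs hs)) (range (eval_A gs hs)) p r"
proof (intro restriction.intro double_automorphism_group_axioms restriction_axioms.intro)
  have hs': "set hs \<subseteq> H"
    using hs by simp
  show "LR.addsub (range (eval_L gs hs))"
  proof (rule LR.addsubI)
    show "range (eval_L gs hs) \<subseteq> carrier L"
      using eval_closed(1)[OF gs hs'] by blast
    show "\<zero>\<^bsub>L\<^esub> \<in> range (eval_L gs hs)"
      by (rule range_eqI[of _ _ Zero]) simp
    show "x \<oplus>\<^bsub>L\<^esub> y \<in> range (eval_L gs hs)" if xy: "x \<in> range (eval_L gs hs)" "y \<in> range (eval_L gs hs)" for x y
    proof -
      obtain s t where "x = eval_L gs hs s" "y = eval_L gs hs t"
        using xy by blast
      then show ?thesis
        by (intro range_eqI[of _ _ "Add s t"]) simp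
    qed
    show "\<ominus>\<^bsub>L\<^esub> x \<in> range (eval_L gs hs)" if x: "x \<in> range (eval_L gs hs)" for x
    proof -
      obtain s where "x = eval_L gs hs s"
        using x by blast
      then show ?thesis
        by (intro range_eqI[of _ _ "Neg s"]) simp
    qed
  qed
  show "bracket L x y \<in> range (eval_L gs hs)" if xy: "x \<in> range (eval_L gs hs)" "y \<in> range (eval_L gs hs)" for x y
  proof -
    obtain s t where "x = eval_L gs hs s" "y = eval_L gs hs t"
      using xy by blast
    then show ?thesis
      by (intro range_eqI[of _ _ "Br s t"]) simp
  qed
  show "h x \<in> range (eval_L gs hs)" if hx: "h \<in> H" "x \<in> range (eval_L gs hs)" for h x
  proof -
    obtain s where s: "x = eval_L gs hs s"
      using hx(2) by blast
    obtain n where "n < length hs" "hs ! n = h"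
      using hx(1) hs by (metis in_set_conv_nth)
    then show ?thesis
      using s by (intro range_eqI[of _ _ "Act n s"]) simp
  qed
  show "range (eval_A gs hs) \<subseteq> carrier A"
    using eval_closed(2)[OF gs hs'] by blast
  show "\<zero>\<^bsub>A\<^esub> \<in> range (eval_A gs hs)"
    by (rule range_eqI[of _ _ Zero]) simp
  show "a \<oplus>\<^bsub>A\<^esub> b \<in> range (eval_A gs hs)" if ab: "a \<in> range (eval_A gs hs)" "b \<in> range (eval_A gs hs)" for a b
  proof -
    obtain s t where "a = eval_A gs hs s" "b = eval_A gs hs t"
      using ab by blast
    then show ?thesis
      by (intro range_eqI[of _ _ "Add s t"]) simp
  qed
  show "\<ominus>\<^bsub>A\<^esub> a \<in> range (eval_A gs hs)" if a: "a \<in> range (eval_A gs hs)" for a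
  proof -
    obtain s where "a = eval_A gs hs s"
      using a by blast
    then show ?thesis
      by (intro range_eqI[of _ _ "Neg s"]) simp
  qed
  show "act h a \<in> range (eval_A gs hs)" if ha: "h \<in> H" "a \<in> range (eval_A gs hs)" for h a
  proof -
    obtain s where s: "a = eval_A gs hs s"
      using ha(2) by blast
    obtain n where "n < length hs" "hs ! n = h"
      using ha(1) hs by (metis in_set_conv_nth)
    then show ?thesis
      using s by (intro range_eqI[of _ _ "Act n s"]) simp
  qed
  show "range (eval_L gs hs) \<subseteq> LR.aspan (\<Union>a\<in>range (eval_A gs hs). C a \<inter> range (eval_L gs hs))"
    using eval_span[OF gs hs] by blast
  show "h = h'" if h: "h \<in> H" "h' \<in> H" and eq: "\<And>x. x \<in> range (eval_L gs hs) \<Longrightarrow> h x = h' x" for h h'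
  proof (rule ccontr)
    assume "h \<noteq> h'"
    then obtain g where g: "g \<in> set gs" "h (snd g) \<noteq> h' (snd g)"
      using faithful[OF h] by blast
    obtain n where "n < length gs" "gs ! n = g"
      using g(1) by (metis in_set_conv_nth)
    then have "snd g = eval_L gs hs (Gen n)"
      by simp
    then have "h (snd g) = h' (snd g)"
      using eq by blast
    then show False
      using g(2) by contradiction
  qed
qed (use fin inj in auto)

lemma ex_homogeneous_witness:
  assumes h: "h \<in> H" "h' \<in> H" "h \<noteq> h'"
  shows "\<exists>g\<in>Sigma (carrier A) C. h (snd g) \<noteq> h' (snd g)"
proof (rule ccontr)
  assume "\<not> (\<exists>g\<in>Sigma (carrier A) C. h (snd g) \<noteq> h' (snd g))"
  then have eq: "h x = h' x" if "a \<in> carrier A" "x \<in> C a" for a x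
    using that by force
  have "h x = h' x" if "x \<in> LR.aspan (\<Union>a\<in>carrier A. C a)" for x
    using that
  proof induction
    case aspan_zero
    then show ?case
      using H_zero[OF h(1)] H_zero[OF h(2)] by simp
  next
    case (aspan_base x)
    then show ?case
      using eq by blast
  next
    case (aspan_add x y)
    then have "x \<in> carrier L" "y \<in> carrier L"
      using LR.aspan_closed by blast+
    then show ?case
      using H_auto(3)[OF h(1)] H_auto(3)[OF h(2)] aspan_add.IH by simp
  next
    case (aspan_neg x)
    then have "x \<in> carrier L"
      using LR.aspan_closed by blast
    then show ?case
      using H_neg[OF h(1)] H_neg[OF h(2)] aspan_neg.IH by simp
  qed
  then have "h x = h' x" if "x \<in> carrier L" for x
    using that graded_lie_ring.component_span[OF graded_lie_ring] by blast
  then have "h = h'"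
    by (rule extensionalityI[OF H_auto(6)[OF h(1)] H_auto(6)[OF h(2)]])
  then show False
    using h(3) by contradiction
qed

text \<open>
  The generators are the entries of the commutator and, for any two automorphisms in
  \<open>H\<close>, a homogeneous element on which they differ.
\<close>

lemma homogeneous_commutator_zero:
  assumes adm: "admissible q k c R A L C H act" and g: "g \<in> Sigma (carrier A) C" and ps: "set ps \<subseteq> Sigma (carrier A) C"
    and len: "length ps = nilpotency_bound q k c"
  shows "foldl (bracket L) (snd g) (map snd ps) = \<zero>\<^bsub>L\<^esub>"
proof -
  have fin: "finite H"
    using adm by (simp add: admissible_def)
  obtain hs where hs: "set hs = H"
    using finite_list[OF fin] by blast
  define w where "w = (\<lambda>(h :: 'l \<Rightarrow> 'l, h' :: 'l \<Rightarrow> 'l). SOME g. g \<in> Sigma (carrier A) C \<and> h (snd g) \<noteq> h' (snd g))"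
  have w: "w (h, h') \<in> Sigma (carrier A) C \<and> h (snd (w (h, h'))) \<noteq> h' (snd (w (h, h')))"
    if h: "h \<in> H" "h' \<in> H" "h \<noteq> h'" for h h'
    unfolding w_def prod.case by (rule someI_ex) (use ex_homogeneous_witness[OF h] in blast)
  define ws where "ws = map w (filter (\<lambda>(h, h'). h \<noteq> h') (List.product hs hs))"
  define gs where "gs = (g # ps) @ ws"
  have gs: "set gs \<subseteq> Sigma (carrier A) C"
  proof -
    have "set ws \<subseteq> Sigma (carrier A) C"
    proof
      fix z assume "z \<in> set ws"
      then obtain h h' where "z = w (h, h')" "h \<in> H" "h' \<in> H" "h \<noteq> h'"
        using hs by (auto simp: ws_def)
      then show "z \<in> Sigma (carrier A) C"
        using w by blast
    qed
    then show ?thesis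
      using g ps by (simp add: gs_def)
  qed
  have faithful: "\<exists>g\<in>set gs. h (snd g) \<noteq> h' (snd g)" if h: "h \<in> H" "h' \<in> H" "h \<noteq> h'" for h h'
  proof -
    have "(h, h') \<in> set (filter (\<lambda>(h, h'). h \<noteq> h') (List.product hs hs))"
      using h hs by simp
    then have "w (h, h') \<in> set gs"
      unfolding gs_def ws_def by simp
    then show ?thesis
      using w[OF h] by blast
  qed
  define p :: "'l \<Rightarrow> int" where "p = int \<circ> to_nat_on (range (eval_L gs hs))"
  define r :: "'a \<Rightarrow> int" where "r = int \<circ> to_nat_on (range (eval_A gs hs))"
  have pi: "inj_on p (range (eval_L gs hs))" and ri: "inj_on r (range (eval_A gs hs))"
    unfolding p_def r_def by (intro comp_inj_on inj_on_to_nat_on inj_on_of_nat countable_image; simp)+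
  interpret res: restriction R A L C H act "range (eval_L gs hs)" "range (eval_A gs hs)" p r
    by (rule restriction_eval[OF fin gs hs faithful pi ri])
  have "nilpotent_class_le \<Z> res.L1 (carrier res.L1) (nilpotency_bound q k c)"
    by (rule nilpotency_bound_int[OF res.admissible_L1[OF adm]])
  then have zero: "foldl (bracket res.L1) u ys = \<zero>\<^bsub>res.L1\<^esub>"
    if "u \<in> carrier res.L1" "set ys \<subseteq> carrier res.L1" "length ys = nilpotency_bound q k c" for u ys
    using that unfolding nilpotent_class_le_def res.L1.comm_span_eq_zero_iff[OF order_refl order_refl] by blast
  have snd_range: "snd z \<in> range (eval_L gs hs)" if z: "z \<in> set (g # ps)" for z
  proof -
    have "z \<in> set gs"
      using z by (auto simp: gs_def)
    then obtain n where "n < length gs" "gs ! n = z"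
      by (metis in_set_conv_nth)
    then show ?thesis
      by (intro range_eqI[of _ _ "Gen n"]) simp
  qed
  have mem: "snd g \<in> range (eval_L gs hs)" "set (map snd ps) \<subseteq> range (eval_L gs hs)"
    using snd_range by auto
  have "p (foldl (bracket L) (snd g) (map snd ps)) = foldl (bracket res.L1) (p (snd g)) (map p (map snd ps))"
    using res.foldl_bracket_L1[OF mem] by simp
  also have "\<dots> = \<zero>\<^bsub>res.L1\<^esub>"
  proof (rule zero)
    show "p (snd g) \<in> carrier res.L1"
      unfolding res.L1_simps(1) using mem(1) by (rule imageI)
    show "set (map p (map snd ps)) \<subseteq> carrier res.L1"
      unfolding res.L1_simps(1) set_map[of p] using mem(2) by (rule image_mono)
  qed (use len in simp)
  also have "\<dots> = p \<zero>\<^bsub>L\<^esub>"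
    by simp
  finally show ?thesis
    using res.foldl_bracket_L1[OF mem] res.L'_closed(1) by (metis res.p_eq_iff)
qed

end

theorem theorem1p2:
  fixes q k c :: nat
    and R :: "'r ring" and A :: "'a ring" and L :: "('r, 'l) lie_algebra"
    and C :: "'a \<Rightarrow> 'l set"
    and H :: "('l \<Rightarrow> 'l) set" and act :: "('l \<Rightarrow> 'l) \<Rightarrow> 'a \<Rightarrow> 'a"
  assumes "q > 0" and "k > 0" and "c > 0"
    and "double_automorphism_group R A L C H act"
    and "\<forall>a\<in>carrier A. ad_nilpotent R L (C a) k"
    and "finite H" and "card H = q"
    and "\<forall>h\<in>H. h \<noteq> \<one>\<^bsub>Lie_AutoGroup R L\<^esub> \<longrightarrow> {a \<in> carrier A. act h a = a} = {\<zero>\<^bsub>A\<^esub>}"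
    and "nilpotent_class_le R L (fixed_subalgebra L H) c"
  shows "nilpotent_class_le R L (carrier L) (nilpotency_bound q k c)"
proof -
  interpret D: double_automorphism_group R A L C H act
    by fact
  interpret G: graded_lie_ring L "bracket L" A C
    by (rule D.graded_lie_ring)
  have adm: "admissible q k c R A L C H act"
    using assms by (simp add: admissible_def)
  let ?N = "nilpotency_bound q k c" and ?V = "\<Union>a\<in>carrier A. C a"
  have V: "?V \<subseteq> carrier L"
    using D.component_subset by blast
  have hom: "foldl (bracket L) u xs = \<zero>\<^bsub>L\<^esub>" if u: "u \<in> ?V" and xs: "set xs \<subseteq> ?V" "length xs = ?N" for u xs
  proof -
    obtain a where "(a, u) \<in> Sigma (carrier A) C"
      using u by blast
    moreover obtain ps where ps: "set ps \<subseteq> Sigma (carrier A) C" "map snd ps = xs"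
      using ex_labels[OF xs(1)] by (elim exE conjE)
    moreover have "length ps = ?N"
      using ps(2) xs(2) by (metis length_map)
    ultimately show ?thesis
      using D.homogeneous_commutator_zero[OF adm, of "(a, u)" ps] by simp
  qed
  have lin: "foldl (bracket L) x xs = \<zero>\<^bsub>L\<^esub>" if x: "x \<in> carrier L" and xs: "set xs \<subseteq> ?V" "length xs = ?N" for x xs
  proof -
    have "x \<in> D.LR.aspan ?V"
      using G.component_span x by blast
    then have "foldl (bracket L) x xs \<in> {\<zero>\<^bsub>L\<^esub>}"
      by (rule D.LR.comm_aspan_start[OF D.LR.addsub_zero, rotated]) (use hom xs V in blast)+
    then show ?thesis
      by simp
  qed
  have "foldl (bracket L) x xs \<in> {\<zero>\<^bsub>L\<^esub>}" if x: "x \<in> carrier L" and xs: "set xs \<subseteq> carrier L" "length xs = ?N" for x xs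
  proof (rule D.LR.comm_aspan_letters[where F = "carrier L" and V = ?V and K = "{}" and n = ?N])
    show "D.LR.addsub (carrier L)" "D.LR.addsub {\<zero>\<^bsub>L\<^esub>}"
      by (rule D.LR.addsub_carrier, rule D.LR.addsub_zero)
    show "set xs \<subseteq> D.LR.aspan ({} \<union> ?V)"
      using xs(1) G.component_span by auto
  qed (use V x xs lin in auto)
  then show ?thesis
    unfolding nilpotent_class_le_def D.comm_span_eq_zero_iff[OF order_refl order_refl] by blast
qed

end
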